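(* There exists an algorithm that, given an integer $k\ge 1$ and an $n$-vertex graph $G$ together with a linear $w$-expression (of size polynomial in $n$ and $w$) constructing $G$, computes the number of equitable $k$-colorings of $G$ in time $\max\{1,2^k-2\}^w\cdot n^{k+O(1)}$. In particular, for every fixed integer $k$, counting equitable $k$-colorings is polynomial-time solvable on every graph class of bounded linear clique-width, when a linear clique-width expression is given with the input.
   Context: Graphs are finite, without loops or parallel edges. A $k$-coloring of $G$ is a map $\varphi:V(G)\to[k]=\{1,\dots,k\}$ with $\varphi(u)\ne\varphi(v)$ for every edge $uv$; it is equitable if $\bigl||\varphi^{-1}(i)|-|\varphi^{-1}(j)|\bigr|\le 1$ for all $i,j\in[k]$. Colorings are counted as maps. For $w\ge 1$, a $w$-labelled graph is a graph $G$ together with a labelling function $\mathrm{lab}:V(G)\to[w]$. A $w$-expression is a valid term built from the operations: (1) for $i\in[w]$, introduce a single-vertex graph whose vertex has label $i$; (2) disjoint union of two $w$-labelled graphs; (3) for distinct $i,j\in[w]$, relabel every vertex of label $i$ to $j$; (4) for distinct $i,j\in[w]$, add all edges with one endpoint of label $i$ and the other of label $j$. The expression is linear if in every union operation the second operand is a single-vertex $w$-labelled graph. The linear clique-width $\mathrm{lcw}(G)$ is the least $w$ such that $G$ is the underlying unlabelled graph of some linear $w$-expression. A class has bounded linear clique-width if there is a constant $c$ with $\mathrm{lcw}(G)\le c$ for all $G$ in the class. *)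

theory Defs
  imports Complex_Main "HOL-Library.FuncSet" "HOL-Library.Log_Nat" "Graph_Theory.Pair_Digraph"
begin

section \<open>Equitable colorings\<close>

text \<open>A finite graph without loops or parallel edges is a \<^locale>\<open>pair_graph\<close>: finite, loop-free,
  with a symmetric arc relation, so that the edge \<open>uv\<close> is the pair of arcs \<open>(u,v)\<close>, \<open>(v,u)\<close>.
  Colorings are extensional functions, so that \<^const>\<open>card\<close> counts maps on the vertex set.\<close>

definition colorings :: "nat \<Rightarrow> 'a pair_pre_digraph \<Rightarrow> ('a \<Rightarrow> nat) set" where
  "colorings k G = {\<phi> \<in> pverts G \<rightarrow>\<^sub>E {1..k}. \<forall>(u, v) \<in> parcs G. \<phi> u \<noteq> \<phi> v}"

definition color_class :: "'a pair_pre_digraph \<Rightarrow> ('a \<Rightarrow> nat) \<Rightarrow> nat \<Rightarrow> 'a set" where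
  "color_class G \<phi> i = {v \<in> pverts G. \<phi> v = i}"

definition equitable_colorings :: "nat \<Rightarrow> 'a pair_pre_digraph \<Rightarrow> ('a \<Rightarrow> nat) set" where
  "equitable_colorings k G = {\<phi> \<in> colorings k G. \<forall>i \<in> {1..k}. \<forall>j \<in> {1..k}.
     \<bar>int (card (color_class G \<phi> i)) - int (card (color_class G \<phi> j))\<bar> \<le> 1}"


section \<open>Clique-width expressions\<close>

datatype cw_expr =
    Vertex nat
  | DisjUnion cw_expr cw_expr
  | Relabel nat nat cw_expr
  | Join nat nat cw_expr

fun num_ops :: "cw_expr \<Rightarrow> nat" where
  "num_ops (Vertex i) = 1"
| "num_ops (DisjUnion e f) = num_ops e + num_ops f + 1"
| "num_ops (Relabel i j e) = num_ops e + 1"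
| "num_ops (Join i j e) = num_ops e + 1"

text \<open>\<open>constructs w e G lab\<close>: \<open>e\<close> is a valid \<open>w\<close>-expression and \<open>(G, lab)\<close> is one of the
  \<open>w\<close>-labelled graphs it describes. Expressions describe graphs up to isomorphism only: the vertex
  created by \<^const>\<open>Vertex\<close> is arbitrary, and \<^const>\<open>DisjUnion\<close> requires the vertex sets to be
  disjoint. Labels outside the vertex set are irrelevant.\<close>

inductive constructs ::
    "nat \<Rightarrow> cw_expr \<Rightarrow> 'a pair_pre_digraph \<Rightarrow> ('a \<Rightarrow> nat) \<Rightarrow> bool" for w where
  Vertex: "i \<in> {1..w} \<Longrightarrow> constructs w (Vertex i) \<lparr>pverts = {v}, parcs = {}\<rparr> (\<lambda>_. i)"
| DisjUnion: "constructs w e G lab \<Longrightarrow> constructs w f H lab' \<Longrightarrow> pverts G \<inter> pverts H = {} \<Longrightarrow>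
    constructs w (DisjUnion e f)
      \<lparr>pverts = pverts G \<union> pverts H, parcs = parcs G \<union> parcs H\<rparr>
      (\<lambda>v. if v \<in> pverts G then lab v else lab' v)"
| Relabel: "constructs w e G lab \<Longrightarrow> i \<in> {1..w} \<Longrightarrow> j \<in> {1..w} \<Longrightarrow> i \<noteq> j \<Longrightarrow>
    constructs w (Relabel i j e) G (\<lambda>v. if lab v = i then j else lab v)"
| Join: "constructs w e G lab \<Longrightarrow> i \<in> {1..w} \<Longrightarrow> j \<in> {1..w} \<Longrightarrow> i \<noteq> j \<Longrightarrow>
    constructs w (Join i j e)
      \<lparr>pverts = pverts G,
       parcs = parcs G \<union> {(u, v). u \<in> pverts G \<and> v \<in> pverts G \<and>
                            (lab u = i \<and> lab v = j \<or> lab u = j \<and> lab v = i)}\<rparr>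
      lab"

text \<open>Number of vertices of the constructed graph.\<close>

fun num_vertices :: "cw_expr \<Rightarrow> nat" where
  "num_vertices (Vertex i) = 1"
| "num_vertices (DisjUnion e f) = num_vertices e + num_vertices f"
| "num_vertices (Relabel i j e) = num_vertices e"
| "num_vertices (Join i j e) = num_vertices e"

lemma constructs_num_vertices:
  "constructs w e G lab \<Longrightarrow> finite (pverts G) \<and> card (pverts G) = num_vertices e"
  by (induction rule: constructs.induct) (auto simp: card_Un_disjoint)

fun linear_expr :: "cw_expr \<Rightarrow> bool" where
  "linear_expr (Vertex i) = True"
| "linear_expr (DisjUnion e f) = (linear_expr e \<and> linear_expr f \<and> num_vertices f = 1)"
| "linear_expr (Relabel i j e) = linear_expr e"
| "linear_expr (Join i j e) = linear_expr e"

definition linear_expr_for :: "nat \<Rightarrow> cw_expr \<Rightarrow> 'a pair_pre_digraph \<Rightarrow> bool" where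
  "linear_expr_for w e G \<longleftrightarrow> linear_expr e \<and> (\<exists>lab. constructs w e G lab)"

text \<open>Every nonempty finite graph has a linear expression. The empty graph has none, and then the
  value of \<open>LEAST\<close> is one fixed unspecified number, which does not affect boundedness.\<close>

definition lcw :: "'a pair_pre_digraph \<Rightarrow> nat" where
  "lcw G = (LEAST w. \<exists>e. linear_expr_for w e G)"

definition bounded_lcw :: "'a pair_pre_digraph set \<Rightarrow> bool" where
  "bounded_lcw \<G> \<longleftrightarrow> (\<exists>c. \<forall>G \<in> \<G>. lcw G \<le> c)"


section \<open>Algorithms: random access machines with logarithmic cost\<close>

text \<open>The model is the random access machine of Aho, Hopcroft and Ullman under the logarithmic cost
  criterion: unboundedly many cells hold natural numbers, and every instruction costs the total
  length of all numbers (addresses included) that it handles. There are two deviations. Instructions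
  have three addresses and control is structured by \<open>Cond\<close> and \<open>While\<close>, rather than an accumulator
  and jumps; this affects running times by constant factors only. The read-only input is accessed by
  position rather than sequentially, which saves a program from copying it to memory first.\<close>

definition bits :: "nat \<Rightarrow> nat" where
  "bits x = max 1 (floorlog 2 x)"

datatype operand =
    Const nat    \<comment> \<open>literal\<close>
  | Cell nat     \<comment> \<open>content of the cell\<close>
  | Ind nat      \<comment> \<open>content of the cell whose address is in the given cell\<close>
  | Input nat    \<comment> \<open>input word at the position that is in the given cell, \<open>0\<close> beyond the end\<close>

datatype dest = ToCell nat | ToInd nat

datatype binop = Add | Sub | Mul | Div

datatype prog =
    Skip
  | Assign dest binop operand operand
  | Seq prog prog
  | Cond operand prog prog
  | While operand prog

type_synonym memory = "nat \<Rightarrow> nat"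

definition input_word :: "nat list \<Rightarrow> nat \<Rightarrow> nat" where
  "input_word xs p = (if p < length xs then xs ! p else 0)"

fun operand_val :: "nat list \<Rightarrow> memory \<Rightarrow> operand \<Rightarrow> nat" where
  "operand_val xs s (Const c) = c"
| "operand_val xs s (Cell a) = s a"
| "operand_val xs s (Ind a) = s (s a)"
| "operand_val xs s (Input a) = input_word xs (s a)"

fun operand_cost :: "nat list \<Rightarrow> memory \<Rightarrow> operand \<Rightarrow> nat" where
  "operand_cost xs s (Const c) = bits c"
| "operand_cost xs s (Cell a) = bits a + bits (s a)"
| "operand_cost xs s (Ind a) = bits a + bits (s a) + bits (s (s a))"
| "operand_cost xs s (Input a) = bits a + bits (s a) + bits (input_word xs (s a))"

fun dest_addr :: "memory \<Rightarrow> dest \<Rightarrow> nat" where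
  "dest_addr s (ToCell a) = a"
| "dest_addr s (ToInd a) = s a"

fun dest_cost :: "memory \<Rightarrow> dest \<Rightarrow> nat" where
  "dest_cost s (ToCell a) = bits a"
| "dest_cost s (ToInd a) = bits a + bits (s a)"

text \<open>Subtraction is truncated, and \<open>x div 0 = 0\<close>.\<close>

fun binop_val :: "binop \<Rightarrow> nat \<Rightarrow> nat \<Rightarrow> nat" where
  "binop_val Add x y = x + y"
| "binop_val Sub x y = x - y"
| "binop_val Mul x y = x * y"
| "binop_val Div x y = x div y"

text \<open>\<open>exec xs p s t s'\<close>: on input \<open>xs\<close>, program \<open>p\<close> started in memory \<open>s\<close> halts after time \<open>t\<close>
  in memory \<open>s'\<close>. Tests check for nonzero values.\<close>

inductive exec :: "nat list \<Rightarrow> prog \<Rightarrow> memory \<Rightarrow> nat \<Rightarrow> memory \<Rightarrow> bool" for xs where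
  Skip: "exec xs Skip s 1 s"
| Assign: "r = binop_val f (operand_val xs s x) (operand_val xs s y) \<Longrightarrow>
    exec xs (Assign d f x y) s
      (operand_cost xs s x + operand_cost xs s y + dest_cost s d + bits r)
      (s(dest_addr s d := r))"
| Seq: "exec xs p s t s' \<Longrightarrow> exec xs q s' t' s'' \<Longrightarrow> exec xs (Seq p q) s (t + t') s''"
| CondTrue: "operand_val xs s x \<noteq> 0 \<Longrightarrow> exec xs p s t s' \<Longrightarrow>
    exec xs (Cond x p q) s (operand_cost xs s x + t) s'"
| CondFalse: "operand_val xs s x = 0 \<Longrightarrow> exec xs q s t s' \<Longrightarrow>
    exec xs (Cond x p q) s (operand_cost xs s x + t) s'"
| WhileFalse: "operand_val xs s x = 0 \<Longrightarrow> exec xs (While x p) s (operand_cost xs s x) s"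
| WhileTrue: "operand_val xs s x \<noteq> 0 \<Longrightarrow> exec xs p s t s' \<Longrightarrow>
    exec xs (While x p) s' t' s'' \<Longrightarrow>
    exec xs (While x p) s (operand_cost xs s x + t + t') s''"

inductive_cases exec_SkipE: "exec xs Skip s t s'"
inductive_cases exec_AssignE: "exec xs (Assign d f x y) s t s'"
inductive_cases exec_SeqE: "exec xs (Seq p q) s t s'"
inductive_cases exec_CondE: "exec xs (Cond x p q) s t s'"
inductive_cases exec_WhileE: "exec xs (While x p) s t s'"

lemma exec_deterministic:
  "exec xs p s t s' \<Longrightarrow> exec xs p s u r \<Longrightarrow> u = t \<and> r = s'"
proof (induction arbitrary: u r rule: exec.induct)
  case (Skip s)
  then show ?case by (rule exec_SkipE) simp
next
  case (Assign v f s x y d)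
  from Assign.prems Assign.hyps show ?case by (elim exec_AssignE) simp
next
  case (Seq p s t s' q t' s'')
  from Seq.prems show ?case by (rule exec_SeqE) (auto dest!: Seq.IH)
next
  case (CondTrue s x p t s' q)
  from CondTrue.prems show ?case
    by (rule exec_CondE) (use CondTrue.hyps in \<open>auto dest!: CondTrue.IH\<close>)
next
  case (CondFalse s x q t s' p)
  from CondFalse.prems show ?case
    by (rule exec_CondE) (use CondFalse.hyps in \<open>auto dest!: CondFalse.IH\<close>)
next
  case (WhileFalse s x p)
  from WhileFalse.prems show ?case
    by (rule exec_WhileE) (use WhileFalse.hyps in auto)
next
  case (WhileTrue s x p t s' t' s'')
  from WhileTrue.prems show ?case
    by (rule exec_WhileE) (use WhileTrue.hyps in \<open>auto dest!: WhileTrue.IH\<close>)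
qed

text \<open>Memory is initially zero, and the result is left in cell \<open>0\<close>.\<close>

definition computes_in_time :: "prog \<Rightarrow> nat list \<Rightarrow> nat \<Rightarrow> nat \<Rightarrow> bool" where
  "computes_in_time p xs y T \<longleftrightarrow> (\<exists>t s. exec xs p (\<lambda>_. 0) t s \<and> s 0 = y \<and> t \<le> T)"

definition input_length :: "nat list \<Rightarrow> nat" where
  "input_length xs = (\<Sum>x\<leftarrow>xs. bits x)"


section \<open>Encoding of the input\<close>

text \<open>Graphs are given by their adjacency matrix, row by row, with respect to an enumeration \<open>vs\<close> of
  the vertices; expressions in postfix notation, preceded by the number of words used.\<close>

definition enumerates :: "'a list \<Rightarrow> 'a set \<Rightarrow> bool" where
  "enumerates vs V \<longleftrightarrow> distinct vs \<and> set vs = V"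

definition encode_graph :: "'a list \<Rightarrow> 'a pair_pre_digraph \<Rightarrow> nat list" where
  "encode_graph vs G = length vs # [of_bool ((u, v) \<in> parcs G). u \<leftarrow> vs, v \<leftarrow> vs]"

fun postfix_expr :: "cw_expr \<Rightarrow> nat list" where
  "postfix_expr (Vertex i) = [1, i]"
| "postfix_expr (DisjUnion e f) = postfix_expr e @ postfix_expr f @ [2]"
| "postfix_expr (Relabel i j e) = postfix_expr e @ [3, i, j]"
| "postfix_expr (Join i j e) = postfix_expr e @ [4, i, j]"

definition encode_expr :: "cw_expr \<Rightarrow> nat list" where
  "encode_expr e = length (postfix_expr e) # postfix_expr e"

definition encode ::
    "nat \<Rightarrow> 'a list \<Rightarrow> 'a pair_pre_digraph \<Rightarrow> nat \<Rightarrow> cw_expr \<Rightarrow> nat list" where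
  "encode k vs G w e = k # encode_graph vs G @ w # encode_expr e"

end

theory Submission
  imports Defs
begin

text \<open>
  Color the vertices one at a time. The future of a partial coloring depends only on its class sizes and
  on the colors that are forbidden for each uncolored vertex; call this its signature. The program counts
  the partial colorings per signature, stage by stage, and discards those that leave some uncolored
  vertex without a color. Signatures are numbers in base \<open>n + 1\<close>, and memory cells addressed by these
  numbers serve as a dictionary.

  Take the vertices in the order in which a linear \<open>w\<close>-expression introduces them. When the next vertex
  is introduced, old vertices with the same label are twins towards all new vertices. Hence
  the forbidden colors are determined by the color sets of at most \<open>w\<close> labels with uncolored neighbors,
  and each such set is nonempty and, in a coloring that is not discarded, different from the set
  of all colors. So there are at most \<open>(n + 1) ^ k * (2 ^ k - 2) ^ w\<close> signatures per stage.
  For \<open>k < n\<close> this gives the bound as \<open>(n + 1) ^ k \<le> 3 * n ^ k\<close>; for \<open>k \<ge> n\<close> one uses instead that there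
  are at most \<open>k ^ n \<le> k ^ 2 * n ^ k\<close> partial colorings per stage.
\<close>

section \<open>Expressions over scalar variables and arrays\<close>

text \<open>The constants \<open>C\<close> and \<open>c\<close> must not depend on \<open>k\<close>
  or \<open>w\<close>, yet handling one signature costs a polynomial in \<open>n\<close> and
  \<open>k\<close>, and reading the expression a polynomial in \<open>n\<close>, \<open>k\<close>
  and \<open>w\<close>. For \<open>k >= 2\<close> the surplus is absorbed by
  \<open>(2 ^ k - 2) ^ w\<close>, whose square is at least \<open>2 ^ (k * w)\<close>. For
  \<open>k = 1\<close> the main factor is \<open>1\<close> and absorbs nothing; but then a stage has
  at most one partial coloring in any vertex order, so the input matrix is used as it is. The case
  \<open>k >= n\<close> has the same cause: \<open>(n + 1) ^ k\<close> may exceed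
  \<open>n ^ k\<close> by a factor that grows with \<open>k\<close>. A signature has
  \<open>(n + 1) * k\<close> digits, so it is exponentially large as an address. Under logarithmic
  cost this is only a factor polynomial in \<open>n\<close> and \<open>k\<close>, and no search
  structure is needed. The dictionary is never cleared: the class sizes sum to the stage number, so
  signatures of different stages differ, and a zero cell means an absent signature. For bounded
  \<open>w\<close> and fixed \<open>k\<close> the same program serves; these parameters then go into
  the constant and the degree of a polynomial in the input length.\<close>

datatype loc = V nat | A nat nat

type_synonym store = "loc \<Rightarrow> nat"

text \<open>Cells \<open>0..63\<close> hold the scalars, cells \<open>64..127\<close> are temporaries, and the arrays are interleaved above.\<close>

definition array_addr :: "nat \<Rightarrow> nat \<Rightarrow> nat" where
  "array_addr r i = 128 + 4 * i + r"

text \<open>The temporaries \<open>64..127\<close> are left unconstrained, so evaluating an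
  expression there never disturbs the relation.\<close>

definition represents :: "memory \<Rightarrow> store \<Rightarrow> bool" where
  "represents m s \<longleftrightarrow> (\<forall>x<64. m x = s (V x)) \<and> (\<forall>r<4. \<forall>i. m (array_addr r i) = s (A r i))"

lemma array_addr_eq_iff: "r < 4 \<Longrightarrow> r' < 4 \<Longrightarrow> array_addr r i = array_addr r' i' \<longleftrightarrow> r = r' \<and> i = i'"
  unfolding array_addr_def by presburger

lemma represents_initial: "represents (\<lambda>_. 0) (\<lambda>_. 0)"
  by (simp add: represents_def)

lemma represents_update_scalar:
  assumes "represents m s" "x < 64" "\<And>a. a < 64 \<or> 128 \<le> a \<Longrightarrow> m' a = m a"
  shows "represents (m'(x := v)) (s(V x := v))"
  using assms by (auto simp: represents_def array_addr_def)

lemma represents_update_array: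
  assumes "represents m s" "r < 4" "\<And>a. a < 64 \<or> 128 \<le> a \<Longrightarrow> m' a = m a"
  shows "represents (m'(array_addr r i := v)) (s(A r i := v))"
  using assms array_addr_eq_iff by (auto simp: represents_def) (auto simp: array_addr_def)

datatype aexp = Num nat | Var nat | Arr nat aexp | Inp aexp | Bin binop aexp aexp

fun aval :: "nat list \<Rightarrow> store \<Rightarrow> aexp \<Rightarrow> nat" where
  "aval xs s (Num c) = c"
| "aval xs s (Var x) = s (V x)"
| "aval xs s (Arr r e) = s (A r (aval xs s e))"
| "aval xs s (Inp e) = input_word xs (aval xs s e)"
| "aval xs s (Bin f a b) = binop_val f (aval xs s a) (aval xs s b)"

fun esize :: "aexp \<Rightarrow> nat" where
  "esize (Num c) = 1"
| "esize (Var x) = 1"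
| "esize (Arr r e) = esize e + 3"
| "esize (Inp e) = esize e + 1"
| "esize (Bin f a b) = esize a + esize b + 1"

text \<open>Under logarithmic cost an instruction is as expensive as the numbers it handles. Hence
  intermediate values and array addresses are bounded as well, not only the final value.\<close>

fun fits :: "nat list \<Rightarrow> store \<Rightarrow> nat \<Rightarrow> aexp \<Rightarrow> bool" where
  "fits xs s M (Num c) = (c \<le> M)"
| "fits xs s M (Var x) = (s (V x) \<le> M)"
| "fits xs s M (Arr r e) = (fits xs s M e \<and> array_addr r (aval xs s e) \<le> M \<and> s (A r (aval xs s e)) \<le> M)"
| "fits xs s M (Inp e) = (fits xs s M e \<and> input_word xs (aval xs s e) \<le> M)"
| "fits xs s M (Bin f a b) = (fits xs s M a \<and> fits xs s M b \<and> binop_val f (aval xs s a) (aval xs s b) \<le> M)"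

text \<open>The number \<open>d\<close> is the temporary cell that receives the value. Right
  operands are evaluated one cell higher, so this bounds the depth of the evaluation stack and keeps
  it below the arrays.\<close>

fun wf_exp :: "nat \<Rightarrow> aexp \<Rightarrow> bool" where
  "wf_exp d (Num c) = (d < 128)"
| "wf_exp d (Var x) = (d < 128 \<and> x < 64)"
| "wf_exp d (Arr r e) = (wf_exp d e \<and> r < 4)"
| "wf_exp d (Inp e) = wf_exp d e"
| "wf_exp d (Bin f a b) = (wf_exp d a \<and> wf_exp (Suc d) b)"

fun compile_exp :: "nat \<Rightarrow> aexp \<Rightarrow> prog" where
  "compile_exp d (Num c) = Assign (ToCell d) Add (Const c) (Const 0)"
| "compile_exp d (Var x) = Assign (ToCell d) Add (Cell x) (Const 0)"
| "compile_exp d (Arr r e) =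
     Seq (compile_exp d e)
       (Seq (Assign (ToCell d) Mul (Const 4) (Cell d))
         (Seq (Assign (ToCell d) Add (Const (128 + r)) (Cell d))
           (Assign (ToCell d) Add (Ind d) (Const 0))))"
| "compile_exp d (Inp e) = Seq (compile_exp d e) (Assign (ToCell d) Add (Input d) (Const 0))"
| "compile_exp d (Bin f a b) =
     Seq (compile_exp d a) (Seq (compile_exp (Suc d) b) (Assign (ToCell d) f (Cell d) (Cell (Suc d))))"

lemma wf_exp_less: "wf_exp d e \<Longrightarrow> d < 128"
  by (induction e arbitrary: d) auto

lemma bits_mono: "a \<le> b \<Longrightarrow> bits a \<le> bits b"
  unfolding bits_def using floorlog_mono[of a b 2] by linarith

lemma bits_ge_1: "1 \<le> bits a"
  by (simp add: bits_def)

lemma exec_Assign_le: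
  assumes "r = binop_val f (operand_val xs s x) (operand_val xs s y)"
    "operand_cost xs s x + operand_cost xs s y + dest_cost s d + bits r \<le> T"
  shows "\<exists>t. exec xs (Assign d f x y) s t (s(dest_addr s d := r)) \<and> t \<le> T"
  using exec.Assign[OF assms(1), of d] assms(2) by blast

lemma exec_Seq_le:
  assumes "\<exists>t. exec xs p s t s' \<and> t \<le> T" "\<exists>t. exec xs q s' t s'' \<and> t \<le> T'"
  shows "\<exists>t. exec xs (Seq p q) s t s'' \<and> t \<le> T + T'"
  using assms exec.Seq add_mono by meson

text \<open>The factor \<open>9\<close> covers every instruction: two operands handling at most
  three numbers each, a destination handling at most two, and the result. \<open>200 <= M\<close>
  covers the literals and cell numbers that the compiler itself produces. Cells below
  \<open>d\<close> survive, which protects the left operand while the right one is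
  evaluated.\<close>

lemma exec_compile_exp:
  assumes "fits xs s M e" "represents m s" "wf_exp d e" "64 \<le> d" "200 \<le> M"
  shows "\<exists>m'. (\<exists>t. exec xs (compile_exp d e) m t m' \<and> t \<le> esize e * (9 * bits M)) \<and>
     m' d = aval xs s e \<and> (\<forall>a. a < d \<or> 128 \<le> a \<longrightarrow> m' a = m a)"
  using assms
proof (induction e arbitrary: m d)
  case (Num c)
  have "bits c \<le> bits M" "bits d \<le> bits M" "bits 0 \<le> bits M"
    using Num by (auto intro!: bits_mono)
  then have "\<exists>t. exec xs (compile_exp d (Num c)) m t (m(d := c)) \<and> t \<le> 9 * bits M"
    unfolding compile_exp.simps
    using exec_Assign_le[of c Add xs m "Const c" "Const 0" "ToCell d" "9 * bits M"] by simp
  then show ?case using Num.prems by (intro exI[of _ "m(d := c)"]) (simp del: compile_exp.simps fun_upd_apply, simp)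
next
  case (Var x)
  then have mx: "m x = s (V x)" by (simp add: represents_def)
  have "bits x \<le> bits M" "bits (m x) \<le> bits M" "bits d \<le> bits M" "bits 0 \<le> bits M"
    using Var mx by (auto intro!: bits_mono)
  then have "\<exists>t. exec xs (compile_exp d (Var x)) m t (m(d := m x)) \<and> t \<le> 9 * bits M"
    unfolding compile_exp.simps
    using exec_Assign_le[of "m x" Add xs m "Cell x" "Const 0" "ToCell d" "9 * bits M"] by simp
  then show ?case using mx Var.prems by (intro exI[of _ "m(d := m x)"]) (simp del: compile_exp.simps fun_upd_apply, simp)
next
  case (Arr r e)
  let ?v = "aval xs s e"
  let ?U = "9 * bits M"
  obtain m1 where m1: "\<exists>t. exec xs (compile_exp d e) m t m1 \<and> t \<le> esize e * ?U"
      "m1 d = ?v" "\<forall>a. a < d \<or> 128 \<le> a \<longrightarrow> m1 a = m a"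
    using Arr.IH[of m d] Arr.prems by auto
  have d: "d < 128" using Arr.prems wf_exp_less by auto
  define m2 where "m2 = m1(d := 4 * ?v)"
  define m3 where "m3 = m2(d := array_addr r ?v)"
  define m4 where "m4 = m3(d := s (A r ?v))"
  have addr: "array_addr r ?v \<le> M" using Arr.prems by simp
  have b: "bits d \<le> bits M" "bits ?v \<le> bits M" "bits (4 * ?v) \<le> bits M" "bits 4 \<le> bits M" "bits 0 \<le> bits M"
    "bits (128 + r) \<le> bits M" "bits (array_addr r ?v) \<le> bits M" "bits (s (A r ?v)) \<le> bits M"
    using d addr Arr.prems by (auto intro!: bits_mono simp: array_addr_def)
  have "m3 (array_addr r ?v) = m (array_addr r ?v)"
    using d m1(3) by (simp add: m3_def m2_def array_addr_def)
  then have m3: "m3 (array_addr r ?v) = s (A r ?v)"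
    using Arr.prems by (simp add: represents_def)
  have e2: "\<exists>t. exec xs (Assign (ToCell d) Mul (Const 4) (Cell d)) m1 t m2 \<and> t \<le> ?U"
    using exec_Assign_le[of "4 * ?v" Mul xs m1 "Const 4" "Cell d" "ToCell d" ?U] b m1
    by (simp add: m2_def)
  have e3: "\<exists>t. exec xs (Assign (ToCell d) Add (Const (128 + r)) (Cell d)) m2 t m3 \<and> t \<le> ?U"
    using exec_Assign_le[of "array_addr r ?v" Add xs m2 "Const (128 + r)" "Cell d" "ToCell d" ?U] b m1
    by (simp add: m3_def m2_def array_addr_def)
  have e4: "\<exists>t. exec xs (Assign (ToCell d) Add (Ind d) (Const 0)) m3 t m4 \<and> t \<le> ?U"
    using exec_Assign_le[of "s (A r ?v)" Add xs m3 "Ind d" "Const 0" "ToCell d" ?U] b m1 m3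
    by (simp add: m4_def) (simp add: m3_def)
  have "\<exists>t. exec xs (compile_exp d (Arr r e)) m t m4 \<and> t \<le> esize e * ?U + (?U + (?U + ?U))"
    unfolding compile_exp.simps by (intro exec_Seq_le[OF m1(1)] exec_Seq_le[OF e2] exec_Seq_le[OF e3] e4)
  moreover have "m4 d = aval xs s (Arr r e)" "\<forall>a. a < d \<or> 128 \<le> a \<longrightarrow> m4 a = m a"
    using d m1 by (simp_all add: m4_def m3_def m2_def)
  ultimately show ?case
    by (intro exI[of _ m4]) (simp add: distrib_right del: compile_exp.simps)
next
  case (Inp e)
  let ?v = "aval xs s e"
  let ?U = "9 * bits M"
  obtain m1 where m1: "\<exists>t. exec xs (compile_exp d e) m t m1 \<and> t \<le> esize e * ?U"
      "m1 d = ?v" "\<forall>a. a < d \<or> 128 \<le> a \<longrightarrow> m1 a = m a"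
    using Inp.IH[of m d] Inp.prems by auto
  have d: "d < 128" using Inp.prems wf_exp_less by auto
  have vM: "?v \<le> M"
    using Inp.prems(1) by (cases e) auto
  have b: "bits d \<le> bits M" "bits ?v \<le> bits M" "bits 0 \<le> bits M" "bits (input_word xs ?v) \<le> bits M"
    using d vM Inp.prems by (auto intro!: bits_mono)
  define m2 where "m2 = m1(d := input_word xs ?v)"
  have e2: "\<exists>t. exec xs (Assign (ToCell d) Add (Input d) (Const 0)) m1 t m2 \<and> t \<le> ?U"
    using exec_Assign_le[of "input_word xs ?v" Add xs m1 "Input d" "Const 0" "ToCell d" ?U] b m1
    by (simp add: m2_def)
  have "\<exists>t. exec xs (compile_exp d (Inp e)) m t m2 \<and> t \<le> esize e * ?U + ?U"
    unfolding compile_exp.simps by (intro exec_Seq_le[OF m1(1)] e2)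
  moreover have "m2 d = aval xs s (Inp e)" "\<forall>a. a < d \<or> 128 \<le> a \<longrightarrow> m2 a = m a"
    using d m1 by (simp_all add: m2_def)
  ultimately show ?case
    by (intro exI[of _ m2]) (simp add: distrib_right add.commute del: compile_exp.simps)
next
  case (Bin f a b)
  let ?v = "aval xs s a" and ?w = "aval xs s b"
  let ?U = "9 * bits M"
  obtain m1 where m1: "\<exists>t. exec xs (compile_exp d a) m t m1 \<and> t \<le> esize a * ?U"
      "m1 d = ?v" "\<forall>a. a < d \<or> 128 \<le> a \<longrightarrow> m1 a = m a"
    using Bin.IH(1)[of m d] Bin.prems by auto
  have d: "Suc d < 128" using Bin.prems wf_exp_less[of "Suc d" b] by auto
  have "represents m1 s"
    using Bin.prems m1(3) by (auto simp: represents_def array_addr_def)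
  then obtain m2 where m2: "\<exists>t. exec xs (compile_exp (Suc d) b) m1 t m2 \<and> t \<le> esize b * ?U"
      "m2 (Suc d) = ?w" "\<forall>a. a < Suc d \<or> 128 \<le> a \<longrightarrow> m2 a = m1 a"
    using Bin.IH(2)[of m1 "Suc d"] Bin.prems by auto
  have le: "?v \<le> M" "?w \<le> M"
    using Bin.prems(1) by (cases a, auto)  (cases b, auto)
  define r where "r = binop_val f ?v ?w"
  have b: "bits d \<le> bits M" "bits (Suc d) \<le> bits M" "bits ?v \<le> bits M" "bits ?w \<le> bits M" "bits r \<le> bits M"
    using d le Bin.prems by (auto intro!: bits_mono simp: r_def)
  define m3 where "m3 = m2(d := r)"
  have e3: "\<exists>t. exec xs (Assign (ToCell d) f (Cell d) (Cell (Suc d))) m2 t m3 \<and> t \<le> ?U"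
    using exec_Assign_le[of r f xs m2 "Cell d" "Cell (Suc d)" "ToCell d" ?U] b m1 m2
    by (simp add: m3_def r_def)
  have "\<exists>t. exec xs (compile_exp d (Bin f a b)) m t m3 \<and> t \<le> esize a * ?U + (esize b * ?U + ?U)"
    unfolding compile_exp.simps by (intro exec_Seq_le[OF m1(1)] exec_Seq_le[OF m2(1)] e3)
  moreover have "m3 d = aval xs s (Bin f a b)" "\<forall>a. a < d \<or> 128 \<le> a \<longrightarrow> m3 a = m a"
    using d m1 m2 by (simp_all add: m3_def r_def)
  ultimately show ?case
    by (intro exI[of _ m3]) (simp add: distrib_right distrib_left ac_simps del: compile_exp.simps)
qed

lemma aval_le: "fits xs s M e \<Longrightarrow> aval xs s e \<le> M"
  by (cases e) auto

text \<open>Every nonzero number counts as true.\<close>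

definition eq_exp :: "aexp \<Rightarrow> aexp \<Rightarrow> aexp" where
  "eq_exp a b = Bin Sub (Num 1) (Bin Add (Bin Sub a b) (Bin Sub b a))"
definition less_exp :: "aexp \<Rightarrow> aexp \<Rightarrow> aexp" where
  "less_exp a b = Bin Sub (Num 1) (Bin Sub (Num 1) (Bin Sub b a))"
definition and_exp :: "aexp \<Rightarrow> aexp \<Rightarrow> aexp" where
  "and_exp a b = Bin Mul (Bin Sub (Num 1) (Bin Sub (Num 1) a)) (Bin Sub (Num 1) (Bin Sub (Num 1) b))"
definition or_exp :: "aexp \<Rightarrow> aexp \<Rightarrow> aexp" where
  "or_exp a b = Bin Sub (Num 1) (Bin Mul (Bin Sub (Num 1) a) (Bin Sub (Num 1) b))"
definition if_exp :: "aexp \<Rightarrow> aexp \<Rightarrow> aexp \<Rightarrow> aexp" where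
  "if_exp c a b = Bin Add (Bin Mul (Bin Sub (Num 1) (Bin Sub (Num 1) c)) a) (Bin Mul (Bin Sub (Num 1) c) b)"
definition mod_exp :: "aexp \<Rightarrow> aexp \<Rightarrow> aexp" where
  "mod_exp a b = Bin Sub a (Bin Mul (Bin Div a b) b)"
definition max_exp :: "aexp \<Rightarrow> aexp \<Rightarrow> aexp" where
  "max_exp a b = Bin Add a (Bin Sub b a)"
definition min_exp :: "aexp \<Rightarrow> aexp \<Rightarrow> aexp" where
  "min_exp a b = Bin Sub a (Bin Sub a b)"

lemmas exp_defs = eq_exp_def less_exp_def and_exp_def or_exp_def if_exp_def mod_exp_def
  max_exp_def min_exp_def

text \<open>Truncated subtraction from \<open>1\<close> is negation, and two negations normalise a
  truth value to \<open>0\<close> or \<open>1\<close>. All the logical expressions are built on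
  this.\<close>

lemma diff_1_nat: "1 - x = of_bool (x = (0 :: nat))"
  by (cases x) auto

lemma aval_exp [simp]:
  "aval xs s (eq_exp a b) = of_bool (aval xs s a = aval xs s b)"
  "aval xs s (less_exp a b) = of_bool (aval xs s a < aval xs s b)"
  "aval xs s (and_exp a b) = of_bool (aval xs s a \<noteq> 0 \<and> aval xs s b \<noteq> 0)"
  "aval xs s (or_exp a b) = of_bool (aval xs s a \<noteq> 0 \<or> aval xs s b \<noteq> 0)"
  "aval xs s (if_exp c a b) = (if aval xs s c \<noteq> 0 then aval xs s a else aval xs s b)"
  "aval xs s (mod_exp a b) = aval xs s a mod aval xs s b"
  "aval xs s (max_exp a b) = max (aval xs s a) (aval xs s b)"
  "aval xs s (min_exp a b) = min (aval xs s a) (aval xs s b)"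
  by (auto simp: exp_defs minus_div_mult_eq_mod diff_1_nat simp del: One_nat_def)

lemma esize_exp [simp]:
  "esize (eq_exp a b) = 2 * esize a + 2 * esize b + 5"
  "esize (less_exp a b) = esize a + esize b + 5"
  "esize (and_exp a b) = esize a + esize b + 9"
  "esize (or_exp a b) = esize a + esize b + 7"
  "esize (if_exp c a b) = 2 * esize c + esize a + esize b + 9"
  "esize (mod_exp a b) = 2 * esize a + 2 * esize b + 3"
  "esize (max_exp a b) = 2 * esize a + esize b + 2"
  "esize (min_exp a b) = 2 * esize a + esize b + 2"
  by (simp_all add: exp_defs)

lemma wf_exp_simps [simp]:
  "wf_exp d (eq_exp a b) = (wf_exp (Suc d) a \<and> wf_exp (Suc (Suc d)) b \<and> wf_exp (Suc (Suc (Suc d))) a)"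
  "wf_exp d (less_exp a b) = (wf_exp (Suc (Suc d)) b \<and> wf_exp (Suc (Suc (Suc d))) a)"
  "wf_exp d (and_exp a b) = (wf_exp (Suc (Suc d)) a \<and> wf_exp (Suc (Suc (Suc d))) b)"
  "wf_exp d (or_exp a b) = (wf_exp (Suc (Suc d)) a \<and> wf_exp (Suc (Suc (Suc d))) b)"
  "wf_exp d (if_exp c a b) = (wf_exp (Suc (Suc d)) c \<and> wf_exp (Suc d) a \<and> wf_exp (Suc (Suc d)) c \<and> wf_exp (Suc (Suc d)) b)"
  "wf_exp d (mod_exp a b) = (wf_exp d a \<and> wf_exp (Suc d) a \<and> wf_exp (Suc (Suc d)) b)"
  "wf_exp d (max_exp a b) = (wf_exp d a \<and> wf_exp (Suc d) b \<and> wf_exp (Suc (Suc d)) a)"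
  "wf_exp d (min_exp a b) = (wf_exp d a \<and> wf_exp (Suc d) a \<and> wf_exp (Suc (Suc d)) b)"
  by (auto simp: exp_defs dest: wf_exp_less)

text \<open>The products formed on the way do no harm: \<open>(a div b) * b <= a\<close>, and in a
  conditional one of the two summands is \<open>0\<close>. Both branches of a conditional are
  evaluated, so both must fit.\<close>

lemma fits_exp [simp]:
  assumes "1 \<le> M" "fits xs s M a" "fits xs s M b"
  shows "fits xs s M (eq_exp a b)" "fits xs s M (less_exp a b)"
    "fits xs s M (and_exp a b)" "fits xs s M (or_exp a b)" "fits xs s M c \<Longrightarrow> fits xs s M (if_exp c a b)"
    "fits xs s M (mod_exp a b)" "fits xs s M (max_exp a b)" "fits xs s M (min_exp a b)"
proof -
  note le = aval_le[OF assms(2)] aval_le[OF assms(3)]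
  show "fits xs s M (mod_exp a b)"
  proof -
    have "aval xs s a div aval xs s b * aval xs s b \<le> M" "aval xs s a div aval xs s b \<le> M"
      "aval xs s a - aval xs s a div aval xs s b * aval xs s b \<le> M"
      using le(1) div_times_less_eq_dividend[of "aval xs s a" "aval xs s b"]
        div_le_dividend[of "aval xs s a" "aval xs s b"] by linarith+
    then show ?thesis
      using assms by (simp add: exp_defs)
  qed
qed (use assms aval_le[OF assms(2)] aval_le[OF assms(3)] in \<open>auto simp: exp_defs diff_1_nat simp del: One_nat_def\<close>)

section \<open>Commands and their cost\<close>

definition assign :: "nat \<Rightarrow> aexp \<Rightarrow> prog" where
  "assign x e = Seq (compile_exp 64 e) (Assign (ToCell x) Add (Cell 64) (Const 0))"

definition assign_array :: "nat \<Rightarrow> aexp \<Rightarrow> aexp \<Rightarrow> prog" where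
  "assign_array r i e =
     Seq (compile_exp 64 i)
       (Seq (compile_exp 65 e)
         (Seq (Assign (ToCell 64) Mul (Const 4) (Cell 64))
           (Seq (Assign (ToCell 64) Add (Const (128 + r)) (Cell 64))
             (Assign (ToInd 64) Add (Cell 65) (Const 0)))))"

definition if_then_else :: "aexp \<Rightarrow> prog \<Rightarrow> prog \<Rightarrow> prog" where
  "if_then_else e p q = Seq (compile_exp 64 e) (Cond (Cell 64) p q)"

text \<open>Tests only check for nonzero values, so the remaining iterations are counted down in \<open>y\<close>.\<close>

definition for_loop :: "nat \<Rightarrow> nat \<Rightarrow> aexp \<Rightarrow> prog \<Rightarrow> prog" where
  "for_loop x y e p =
     Seq (assign y e)
       (Seq (assign x (Num 0))
         (While (Cell y)
           (Seq p (Seq (assign x (Bin Add (Var x) (Num 1))) (assign y (Bin Sub (Var y) (Num 1)))))))"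

text \<open>\<open>9 * bits M\<close> bounds the cost of a single instruction on numbers up to \<open>M\<close>.\<close>

definition runs :: "nat list \<Rightarrow> nat \<Rightarrow> prog \<Rightarrow> store \<Rightarrow> nat \<Rightarrow> store \<Rightarrow> bool" where
  "runs xs M p s N s' \<longleftrightarrow> 200 \<le> M \<and>
     (\<forall>m. represents m s \<longrightarrow>
       (\<exists>m'. represents m' s' \<and> (\<exists>t. exec xs p m t m' \<and> t \<le> N * (9 * bits M))))"

lemma runs_assign:
  assumes "fits xs s M e" "wf_exp 64 e" "x < 64" "200 \<le> M"
  shows "runs xs M (assign x e) s (esize e + 1) (s(V x := aval xs s e))"
  unfolding runs_def
proof (intro conjI allI impI)
  fix m assume rep: "represents m s"
  let ?U = "9 * bits M" and ?v = "aval xs s e"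
  obtain m1 where m1: "\<exists>t. exec xs (compile_exp 64 e) m t m1 \<and> t \<le> esize e * ?U"
      "m1 64 = ?v" "\<forall>a. a < 64 \<or> 128 \<le> a \<longrightarrow> m1 a = m a"
    using exec_compile_exp[OF assms(1) rep assms(2) _ assms(4)] by auto
  have b: "bits x \<le> bits M" "bits 64 \<le> bits M" "bits 0 \<le> bits M" "bits ?v \<le> bits M"
    using assms aval_le[OF assms(1)] by (auto intro!: bits_mono)
  have "\<exists>t. exec xs (Assign (ToCell x) Add (Cell 64) (Const 0)) m1 t (m1(x := ?v)) \<and> t \<le> ?U"
    using exec_Assign_le[of ?v Add xs m1 "Cell 64" "Const 0" "ToCell x" ?U] b m1 by simp
  then have "\<exists>t. exec xs (assign x e) m t (m1(x := ?v)) \<and> t \<le> esize e * ?U + ?U"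
    unfolding assign_def by (intro exec_Seq_le[OF m1(1)])
  moreover have "represents (m1(x := ?v)) (s(V x := ?v))"
    using represents_update_scalar[OF rep assms(3)] m1(3) by blast
  ultimately show "\<exists>m'. represents m' (s(V x := ?v)) \<and> (\<exists>t. exec xs (assign x e) m t m' \<and> t \<le> (esize e + 1) * ?U)"
    by (intro exI[of _ "m1(x := ?v)"]) (simp add: distrib_right add.commute)
qed (rule assms)

lemma runs_assign_array:
  assumes "fits xs s M i" "fits xs s M e" "wf_exp 64 i" "wf_exp 65 e" "r < 4"
    "array_addr r (aval xs s i) \<le> M" "200 \<le> M"
  shows "runs xs M (assign_array r i e) s (esize i + esize e + 3) (s(A r (aval xs s i) := aval xs s e))"
  unfolding runs_def
proof (intro conjI allI impI)
  fix m assume rep: "represents m s"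
  let ?U = "9 * bits M" and ?v = "aval xs s e" and ?i = "aval xs s i"
  obtain m1 where m1: "\<exists>t. exec xs (compile_exp 64 i) m t m1 \<and> t \<le> esize i * ?U"
      "m1 64 = ?i" "\<forall>a. a < 64 \<or> 128 \<le> a \<longrightarrow> m1 a = m a"
    using exec_compile_exp[OF assms(1) rep assms(3) _ assms(7)] by auto
  have "represents m1 s"
    using rep m1(3) by (auto simp: represents_def array_addr_def)
  then obtain m2 where m2: "\<exists>t. exec xs (compile_exp 65 e) m1 t m2 \<and> t \<le> esize e * ?U"
      "m2 65 = ?v" "\<forall>a. a < 65 \<or> 128 \<le> a \<longrightarrow> m2 a = m1 a"
    using exec_compile_exp[OF assms(2) _ assms(4) _ assms(7), of m1] by auto
  define m3 where "m3 = m2(64 := 4 * ?i)"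
  define m4 where "m4 = m3(64 := array_addr r ?i)"
  define m5 where "m5 = m4(array_addr r ?i := ?v)"
  have b: "bits 64 \<le> bits M" "bits 65 \<le> bits M" "bits 0 \<le> bits M" "bits 4 \<le> bits M" "bits ?v \<le> bits M"
    "bits ?i \<le> bits M" "bits (4 * ?i) \<le> bits M" "bits (128 + r) \<le> bits M" "bits (array_addr r ?i) \<le> bits M"
    using assms aval_le[OF assms(1)] aval_le[OF assms(2)] by (auto intro!: bits_mono simp: array_addr_def)
  have e3: "\<exists>t. exec xs (Assign (ToCell 64) Mul (Const 4) (Cell 64)) m2 t m3 \<and> t \<le> ?U"
    using exec_Assign_le[of "4 * ?i" Mul xs m2 "Const 4" "Cell 64" "ToCell 64" ?U] b m1 m2
    by (simp add: m3_def)
  have e4: "\<exists>t. exec xs (Assign (ToCell 64) Add (Const (128 + r)) (Cell 64)) m3 t m4 \<and> t \<le> ?U"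
    using exec_Assign_le[of "array_addr r ?i" Add xs m3 "Const (128 + r)" "Cell 64" "ToCell 64" ?U] b
    by (simp add: m3_def m4_def array_addr_def)
  have e5: "\<exists>t. exec xs (Assign (ToInd 64) Add (Cell 65) (Const 0)) m4 t m5 \<and> t \<le> ?U"
    using exec_Assign_le[of ?v Add xs m4 "Cell 65" "Const 0" "ToInd 64" ?U] b m2
    by (simp add: m3_def m4_def m5_def)
  have "\<exists>t. exec xs (assign_array r i e) m t m5 \<and> t \<le> esize i * ?U + (esize e * ?U + (?U + (?U + ?U)))"
    unfolding assign_array_def
    by (intro exec_Seq_le[OF m1(1)] exec_Seq_le[OF m2(1)] exec_Seq_le[OF e3] exec_Seq_le[OF e4] e5)
  moreover have "represents m5 (s(A r ?i := ?v))"
    unfolding m5_def m4_def m3_def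
    by (rule represents_update_array[OF rep assms(5)]) (use m1(3) m2(3) in auto)
  ultimately show "\<exists>m'. represents m' (s(A r ?i := ?v)) \<and>
      (\<exists>t. exec xs (assign_array r i e) m t m' \<and> t \<le> (esize i + esize e + 3) * ?U)"
    by (intro exI[of _ m5]) (simp add: distrib_right distrib_left ac_simps)
qed (rule assms)

lemma runs_Seq:
  assumes "runs xs M p s N s'" "runs xs M q s' N' s''"
  shows "runs xs M (Seq p q) s (N + N') s''"
  using assms exec_Seq_le unfolding runs_def distrib_right by meson

lemma runs_Skip: "200 \<le> M \<Longrightarrow> runs xs M Skip s 1 s"
  unfolding runs_def using exec.Skip bits_ge_1[of M] by fastforce

lemma runs_if_then_else:
  assumes "fits xs s M e" "wf_exp 64 e"
    "runs xs M (if aval xs s e \<noteq> 0 then p else q) s N s'"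
  shows "runs xs M (if_then_else e p q) s (esize e + 1 + N) s'"
  unfolding runs_def
proof (intro conjI allI impI)
  show M: "200 \<le> M" using assms(3) by (simp add: runs_def)
  fix m assume rep: "represents m s"
  let ?U = "9 * bits M" and ?v = "aval xs s e"
  obtain m1 where m1: "\<exists>t. exec xs (compile_exp 64 e) m t m1 \<and> t \<le> esize e * ?U"
      "m1 64 = ?v" "\<forall>a. a < 64 \<or> 128 \<le> a \<longrightarrow> m1 a = m a"
    using exec_compile_exp[OF assms(1) rep assms(2) _ M] by auto
  have "represents m1 s"
    using rep m1(3) by (auto simp: represents_def array_addr_def)
  then obtain m2 t where m2: "represents m2 s'"
      "exec xs (if ?v \<noteq> 0 then p else q) m1 t m2" "t \<le> N * ?U"
    using assms(3) by (auto simp: runs_def)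
  have b: "bits 64 \<le> bits M" "bits ?v \<le> bits M"
    using M aval_le[OF assms(1)] by (auto intro!: bits_mono)
  have "exec xs (Cond (Cell 64) p q) m1 (bits 64 + bits ?v + t) m2"
    using m1(2) m2(2) exec.CondTrue[of xs m1 "Cell 64" p t m2 q] exec.CondFalse[of xs m1 "Cell 64" q t m2 p]
    by (cases "?v = 0") auto
  moreover have "bits 64 + bits ?v + t \<le> ?U + N * ?U"
    using b m2(3) by linarith
  ultimately have "\<exists>t. exec xs (if_then_else e p q) m t m2 \<and> t \<le> esize e * ?U + (?U + N * ?U)"
    unfolding if_then_else_def by (intro exec_Seq_le[OF m1(1)]) blast
  then show "\<exists>m'. represents m' s' \<and> (\<exists>t. exec xs (if_then_else e p q) m t m' \<and> t \<le> (esize e + 1 + N) * ?U)"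
    using m2(1) by (intro exI[of _ m2]) (simp add: distrib_right distrib_left ac_simps)
qed

lemma runs_mono:
  assumes "runs xs M p s N s'" "N \<le> N'"
  shows "runs xs M p s N' s'"
proof -
  have "t \<le> N' * (9 * bits M)" if "t \<le> N * (9 * bits M)" for t
    using that mult_le_mono1[OF assms(2)] le_trans by blast
  then show ?thesis
    using assms(1) unfolding runs_def by meson
qed

lemma runs_While_done:
  assumes "s (V y) = 0" "y < 64" "200 \<le> M"
  shows "runs xs M (While (Cell y) p) s 1 s"
  unfolding runs_def
proof (intro conjI allI impI)
  fix m assume rep: "represents m s"
  then have my: "m y = 0" using assms by (simp add: represents_def)
  have "bits y \<le> bits M" "bits 0 \<le> bits M"
    using assms by (auto intro!: bits_mono)
  then show "\<exists>m'. represents m' s \<and> (\<exists>t. exec xs (While (Cell y) p) m t m' \<and> t \<le> 1 * (9 * bits M))"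
    using rep my exec.WhileFalse[of xs m "Cell y" p] by (intro exI[of _ m]) auto
qed (rule assms)

lemma runs_While_step:
  assumes "s (V y) \<noteq> 0" "s (V y) \<le> M" "y < 64" "runs xs M p s N s'" "runs xs M (While (Cell y) p) s' N' s''"
  shows "runs xs M (While (Cell y) p) s (N + 1 + N') s''"
  unfolding runs_def
proof (intro conjI allI impI)
  show M: "200 \<le> M" using assms(4) by (simp add: runs_def)
  let ?U = "9 * bits M"
  fix m assume rep: "represents m s"
  then have my: "m y = s (V y)" using assms by (simp add: represents_def)
  have b: "bits y \<le> bits M" "bits (m y) \<le> bits M"
    using assms M my by (auto intro!: bits_mono)
  obtain m1 t1 where 1: "represents m1 s'" "exec xs p m t1 m1" "t1 \<le> N * ?U"
    using assms(4) rep by (auto simp: runs_def)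
  obtain m2 t2 where 2: "represents m2 s''" "exec xs (While (Cell y) p) m1 t2 m2" "t2 \<le> N' * ?U"
    using assms(5) 1(1) by (auto simp: runs_def)
  have "exec xs (While (Cell y) p) m (bits y + bits (m y) + t1 + t2) m2"
    using exec.WhileTrue[of xs m "Cell y" p t1 m1 t2 m2] 1 2 my assms(1) by simp
  moreover have "bits y + bits (m y) + t1 + t2 \<le> (N + 1 + N') * ?U"
    using b 1(3) 2(3) unfolding distrib_right by linarith
  ultimately show "\<exists>m'. represents m' s'' \<and>
      (\<exists>t. exec xs (While (Cell y) p) m t m' \<and> t \<le> (N + 1 + N') * ?U)"
    using 2(1) by blast
qed

text \<open>A weakest precondition that threads the number \<open>n\<close> of instructions spent so far.\<close>

definition reaches :: "nat list \<Rightarrow> nat \<Rightarrow> prog \<Rightarrow> store \<Rightarrow> nat \<Rightarrow> (nat \<Rightarrow> store \<Rightarrow> bool) \<Rightarrow> bool" where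
  "reaches xs M p s n Q \<longleftrightarrow> 200 \<le> M \<and> (\<exists>N s'. runs xs M p s N s' \<and> Q (n + N) s')"

lemma reaches_assign:
  assumes "200 \<le> M" "wf_exp 64 e" "x < 64" "fits xs s M e" "Q (n + esize e + 1) (s(V x := aval xs s e))"
  shows "reaches xs M (assign x e) s n Q"
  using assms runs_assign unfolding reaches_def by (metis add.assoc)

lemma reaches_assign_val:
  assumes "200 \<le> M" "wf_exp 64 e" "x < 64" "fits xs s M e" "aval xs s e = v" "Q (n + (esize e + 1)) (s(V x := v))"
  shows "reaches xs M (assign x e) s n Q"
  using reaches_assign[OF assms(1-4)] assms(5,6) by (simp add: add.assoc)

lemma reaches_assign_array:
  assumes "200 \<le> M" "wf_exp 64 i" "wf_exp 65 e" "r < 4" "fits xs s M i" "fits xs s M e"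
    "array_addr r (aval xs s i) \<le> M"
    "Q (n + esize i + esize e + 3) (s(A r (aval xs s i) := aval xs s e))"
  shows "reaches xs M (assign_array r i e) s n Q"
  using assms runs_assign_array unfolding reaches_def by (metis add.assoc)

lemma reaches_Skip: "200 \<le> M \<Longrightarrow> Q (n + 1) s \<Longrightarrow> reaches xs M Skip s n Q"
  using runs_Skip unfolding reaches_def by blast

lemma reaches_Seq:
  assumes "reaches xs M p s n (\<lambda>n' s'. reaches xs M q s' n' Q)"
  shows "reaches xs M (Seq p q) s n Q"
  using assms runs_Seq unfolding reaches_def by (metis add.assoc)

lemma reaches_if_then_else:
  assumes "wf_exp 64 e" "fits xs s M e"
    "aval xs s e \<noteq> 0 \<Longrightarrow> reaches xs M p s (n + esize e + 1) Q"
    "aval xs s e = 0 \<Longrightarrow> reaches xs M q s (n + esize e + 1) Q"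
  shows "reaches xs M (if_then_else e p q) s n Q"
proof (cases "aval xs s e = 0")
  case True
  with assms(4) obtain N s' where "200 \<le> M" "runs xs M q s N s'" "Q (n + esize e + 1 + N) s'"
    unfolding reaches_def by blast
  with True runs_if_then_else[OF assms(2,1), of p q N s'] show ?thesis
    unfolding reaches_def by (intro conjI exI[of _ "esize e + 1 + N"] exI[of _ s']) (auto simp: add.assoc)
next
  case False
  with assms(3) obtain N s' where "200 \<le> M" "runs xs M p s N s'" "Q (n + esize e + 1 + N) s'"
    unfolding reaches_def by blast
  with False runs_if_then_else[OF assms(2,1), of p q N s'] show ?thesis
    unfolding reaches_def by (intro conjI exI[of _ "esize e + 1 + N"] exI[of _ s']) (auto simp: add.assoc)
qed

lemma reaches_mono:
  assumes "reaches xs M p s 0 Q" "\<And>N s'. Q N s' \<Longrightarrow> Q' (n + N) s'"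
  shows "reaches xs M p s n Q'"
  using assms unfolding reaches_def by (metis add_0)

text \<open>Per iteration, \<open>9\<close> pays for two counter updates of four instructions each
  and one test. The term \<open>esize e + 4\<close> pays for the two initial assignments and the
  final failing test. The invariant speaks about the store in which both counters are already
  advanced.\<close>

lemma reaches_for_loop:
  assumes M: "200 \<le> M" and e: "wf_exp 64 e" "fits xs s M e" and xy: "x < 64" "y < 64" "x \<noteq> y"
    and init: "I 0 (s(V y := aval xs s e, V x := 0))"
    and step: "\<And>j s. j < m \<Longrightarrow> I j s \<Longrightarrow> s (V x) = j \<Longrightarrow> s (V y) = m - j \<Longrightarrow>
      reaches xs M p s 0 (\<lambda>N s'. N \<le> B \<and> s' (V x) = j \<and> s' (V y) = m - j \<and>
        I (Suc j) (s'(V x := Suc j, V y := m - Suc j)))"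
    and final: "\<And>N s'. N \<le> esize e + 4 + m * (B + 9) \<Longrightarrow> I m s' \<Longrightarrow> s' (V x) = m \<Longrightarrow> s' (V y) = 0 \<Longrightarrow>
      Q (n + N) s'"
    and m: "m = aval xs s e"
  shows "reaches xs M (for_loop x y e p) s n Q"
proof -
  define inc where "inc = Seq (assign x (Bin Add (Var x) (Num 1))) (assign y (Bin Sub (Var y) (Num 1)))"
  have mM: "m \<le> M" using m aval_le[OF e(2)] by simp
  have loop: "\<exists>s'. I m s' \<and> s' (V x) = m \<and> s' (V y) = 0 \<and>
      runs xs M (While (Cell y) (Seq p inc)) s (i * (B + 9) + 1) s'"
    if "i \<le> m" "I (m - i) s" "s (V x) = m - i" "s (V y) = i" for i s
    using that
  proof (induction i arbitrary: s)
    case 0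
    then show ?case using runs_While_done[of s y M xs] M xy by auto
  next
    case (Suc i)
    have "reaches xs M p s 0 (\<lambda>N s'. N \<le> B \<and> s' (V x) = m - Suc i \<and> s' (V y) = m - (m - Suc i) \<and>
        I (Suc (m - Suc i)) (s'(V x := Suc (m - Suc i), V y := m - Suc (m - Suc i))))"
      using Suc.prems by (intro step) auto
    then obtain N s1 where s1: "runs xs M p s N s1" "N \<le> B" "s1 (V x) = m - Suc i" "s1 (V y) = Suc i"
       "I (m - i) (s1(V x := m - i, V y := i))"
      using Suc.prems(1) by (auto simp: reaches_def Suc_diff_Suc)
    let ?s2 = "s1(V x := m - i)" and ?s3 = "s1(V x := m - i, V y := i)"
    have le: "m - Suc i \<le> M" "m - i \<le> M" using mM by simp_all
    have r2: "runs xs M (assign x (Bin Add (Var x) (Num 1))) s1 (1 + 1 + 1 + 1) ?s2"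
      using runs_assign[of xs s1 M "Bin Add (Var x) (Num 1)" x] s1(3) xy M mM le Suc.prems(1)
      by (simp add: Suc_diff_Suc)
    have r3: "runs xs M (assign y (Bin Sub (Var y) (Num 1))) ?s2 (1 + 1 + 1 + 1) ?s3"
      using runs_assign[of xs ?s2 M "Bin Sub (Var y) (Num 1)" y] s1 xy M mM Suc.prems(1)
      by simp
    have "runs xs M inc s1 8 ?s3"
      unfolding inc_def by (rule runs_mono[OF runs_Seq[OF r2 r3]]) simp
    then have rb: "runs xs M (Seq p inc) s (B + 8) ?s3"
      using runs_Seq[OF runs_mono[OF s1(1,2)]] by blast
    obtain s' where s': "I m s'" "s' (V x) = m" "s' (V y) = 0"
       "runs xs M (While (Cell y) (Seq p inc)) ?s3 (i * (B + 9) + 1) s'"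
      using Suc.IH[of ?s3] Suc.prems(1) s1 xy by (auto simp del: fun_upd_apply simp: fun_upd_same fun_upd_other)
    have "runs xs M (While (Cell y) (Seq p inc)) s (B + 8 + 1 + (i * (B + 9) + 1)) s'"
      using runs_While_step[OF _ _ xy(2) rb s'(4)] Suc.prems mM by simp
    then show ?case using s' by (intro exI[of _ s']) (simp add: algebra_simps)
  qed
  let ?s1 = "s(V y := aval xs s e)"
  have r1: "runs xs M (assign y e) s (esize e + 1) ?s1"
    using runs_assign e xy M by blast
  have r2: "runs xs M (assign x (Num 0)) ?s1 (1 + 1) (?s1(V x := 0))"
    using runs_assign[of xs ?s1 M "Num 0" x] xy M by simp
  obtain s' where s': "I m s'" "s' (V x) = m" "s' (V y) = 0"
     "runs xs M (While (Cell y) (Seq p inc)) (?s1(V x := 0)) (m * (B + 9) + 1) s'"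
    using loop[of m "?s1(V x := 0)"] init m xy by auto
  have "runs xs M (for_loop x y e p) s (esize e + 1 + ((1 + 1) + (m * (B + 9) + 1))) s'"
    unfolding for_loop_def inc_def[symmetric] by (intro runs_Seq[OF r1] runs_Seq[OF r2] s'(4))
  moreover have "Q (n + (esize e + 1 + ((1 + 1) + (m * (B + 9) + 1)))) s'"
    by (rule final[OF _ s'(1-3)]) simp
  ultimately show ?thesis
    unfolding reaches_def using M by blast
qed

section \<open>Signatures of partial colorings\<close>

definition digits :: "nat \<Rightarrow> (nat \<Rightarrow> nat) \<Rightarrow> nat \<Rightarrow> nat" where
  "digits B f m = (\<Sum>d<m. f d * B ^ d)"

lemma digits_simps [simp]:
  "digits B f 0 = 0"
  "digits B f (Suc m) = digits B f m + f m * B ^ m"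
  by (simp_all add: digits_def)

lemma digits_less: "(\<And>d. d < m \<Longrightarrow> f d < B) \<Longrightarrow> digits B f m < B ^ m"
proof (induction m)
  case (Suc m)
  then have "digits B f m + f m * B ^ m < B ^ m + f m * B ^ m"
    by simp
  also have "\<dots> = Suc (f m) * B ^ m" by simp
  also have "\<dots> \<le> B * B ^ m"
    using Suc.prems[of m] by (intro mult_le_mono1) simp
  finally show ?case by simp
qed simp

lemma digits_nth: "(\<And>d. d < m \<Longrightarrow> f d < B) \<Longrightarrow> d < m \<Longrightarrow> digits B f m div B ^ d mod B = f d"
proof (induction m)
  case (Suc m)
  then have B: "0 < B" using not_less_zero by (metis gr0I)
  show ?case
  proof (cases "d = m")
    case True
    then show ?thesis using digits_less[of m f B] Suc.prems B by simp
  next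
    case False
    then have d: "d < m" using Suc.prems by simp
    then obtain e where e: "m = Suc (d + e)" using less_imp_Suc_add by blast
    \<comment> \<open>The top digit contributes a multiple of \<open>B * B ^ d\<close>, which
      disappears after division by \<open>B ^ d\<close> and reduction modulo
      \<open>B\<close>.\<close>
    then have "f m * B ^ m = (f m * B ^ e * B) * B ^ d"
      by (simp add: power_add)
    then have "digits B f (Suc m) div B ^ d mod B = (digits B f m div B ^ d + f m * B ^ e * B) mod B"
      using B by (simp only: digits_simps div_mult_self3 add.commute) simp
    then show ?thesis using Suc d by simp
  qed
qed simp

lemma digits_cong: "(\<And>d. d < m \<Longrightarrow> f d = g d) \<Longrightarrow> digits B f m = digits B g m"
  by (simp add: digits_def)

definition forbidden :: "(nat \<Rightarrow> nat \<Rightarrow> bool) \<Rightarrow> nat list \<Rightarrow> nat \<Rightarrow> nat \<Rightarrow> bool" where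
  "forbidden adj cs v c \<longleftrightarrow> (\<exists>a<length cs. adj a v \<and> cs ! a = c)"

text \<open>Row \<open>0\<close> of a signature holds the class sizes; row \<open>v + 1\<close> flags the forbidden colors of vertex \<open>v\<close>,
  as long as \<open>v\<close> is uncolored.\<close>

definition sig :: "(nat \<Rightarrow> nat \<Rightarrow> bool) \<Rightarrow> nat list \<Rightarrow> nat \<Rightarrow> nat \<Rightarrow> nat" where
  "sig adj cs u c = (if u = 0 then count_list cs c
     else of_bool (length cs < u \<and> forbidden adj cs (u - 1) c))"

text \<open>The transition when vertex \<open>i\<close> receives color \<open>c\<close>. The guard
  \<open>i + 1 < u\<close> also erases row \<open>i + 1\<close>, because vertex \<open>i\<close> is
  no longer uncolored; old flags would distinguish colorings with the same future.\<close>

definition next_sig :: "(nat \<Rightarrow> nat \<Rightarrow> bool) \<Rightarrow> nat \<Rightarrow> nat \<Rightarrow> nat \<Rightarrow> nat \<Rightarrow> nat \<Rightarrow> nat" where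
  "next_sig adj i c u c' dg = (if u = 0 then dg + of_bool (c' = c)
     else of_bool (i + 1 < u \<and> (dg \<noteq> 0 \<or> (c' = c \<and> adj i (u - 1)))))"

lemma forbidden_snoc:
  "forbidden adj (cs @ [c]) v c' \<longleftrightarrow> forbidden adj cs v c' \<or> (c' = c \<and> adj (length cs) v)"
proof -
  have "adj a v \<and> (cs @ [c]) ! a = c' \<longleftrightarrow> adj a v \<and> cs ! a = c'" if "a < length cs" for a
    using that by (simp add: nth_append)
  then show ?thesis
    unfolding forbidden_def length_append_singleton Ex_less_Suc by auto
qed

text \<open>A digit of the new signature depends only on the old digit at the same place. So equal
  signatures have equal successors, and a single pass over the digits computes the
  successor.\<close>

lemma sig_snoc:
  "sig adj (cs @ [c]) u c' = next_sig adj (length cs) c u c' (sig adj cs u c')"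
  by (cases "u = 0") (simp_all add: sig_def next_sig_def forbidden_snoc)

lemma sig_le: "length cs \<le> n \<Longrightarrow> sig adj cs u c \<le> max 1 n"
  using count_le_length[of cs c] by (auto simp: sig_def)

locale coloring_dp =
  fixes k n :: nat and adj :: "nat \<Rightarrow> nat \<Rightarrow> bool"
  assumes k_pos: "0 < k" and n_pos: "0 < n"
begin

definition code :: "nat list \<Rightarrow> nat" where
  "code cs = digits (n + 1) (\<lambda>d. sig adj cs (d div k) (d mod k)) ((n + 1) * k)"

definition digit :: "nat \<Rightarrow> nat \<Rightarrow> nat" where
  "digit x d = x div (n + 1) ^ d mod (n + 1)"

definition next_digit :: "nat \<Rightarrow> nat \<Rightarrow> nat \<Rightarrow> nat \<Rightarrow> nat" where
  "next_digit i c x d = next_sig adj i c (d div k) (d mod k) (digit x d)"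

definition next_code :: "nat \<Rightarrow> nat \<Rightarrow> nat \<Rightarrow> nat" where
  "next_code i c x = digits (n + 1) (next_digit i c x) ((n + 1) * k)"

definition full_row :: "nat \<Rightarrow> nat \<Rightarrow> nat \<Rightarrow> nat \<Rightarrow> bool" where
  "full_row i c x u \<longleftrightarrow> 0 < u \<and> (\<forall>c'<k. next_digit i c x (u * k + c') \<noteq> 0)"

text \<open>Both reasons to discard an extension, read off the code alone: color \<open>c\<close> is
  already forbidden for vertex \<open>i\<close>, or afterwards some uncolored vertex has no color
  left. Row \<open>0\<close> cannot count as full, since it holds class sizes.\<close>

definition blocked :: "nat \<Rightarrow> nat \<Rightarrow> nat \<Rightarrow> bool" where
  "blocked i c x \<longleftrightarrow> digit x ((i + 1) * k + c) \<noteq> 0 \<or> (\<exists>u\<le>n. full_row i c x u)"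

text \<open>For \<open>i = n\<close> the look-ahead clause is vacuous, so \<open>viable n\<close>
  consists of all complete proper colorings.\<close>

definition viable :: "nat \<Rightarrow> nat list set" where
  "viable i = {cs. length cs = i \<and> set cs \<subseteq> {..<k} \<and>
     (\<forall>b<i. \<forall>a<b. adj a b \<longrightarrow> cs ! a \<noteq> cs ! b) \<and>
     (\<forall>v. i \<le> v \<and> v < n \<longrightarrow> (\<exists>c<k. \<not> forbidden adj cs v c))}"

lemma digit_le: "digit x d \<le> n"
  unfolding digit_def by (metis Suc_eq_plus1 less_Suc_eq_le mod_less_divisor zero_less_Suc)

lemma digit_index_less: "u \<le> n \<Longrightarrow> c < k \<Longrightarrow> u * k + c < (n + 1) * k"
proof -
  assume "u \<le> n" "c < k"
  then have "u * k + c < u * k + k" "(u + 1) * k \<le> (n + 1) * k" by (auto intro: mult_le_mono1)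
  then show ?thesis unfolding distrib_right by linarith
qed

lemma digit_code:
  assumes "length cs \<le> n" "d < (n + 1) * k"
  shows "digit (code cs) d = sig adj cs (d div k) (d mod k)"
  unfolding digit_def code_def
proof (rule digits_nth[OF _ assms(2)])
  show "sig adj cs (d div k) (d mod k) < n + 1" for d
    using sig_le[OF assms(1), of adj "d div k" "d mod k"] n_pos by simp
qed

lemma digit_code_row:
  assumes "length cs \<le> n" "u \<le> n" "c < k"
  shows "digit (code cs) (u * k + c) = sig adj cs u c"
  using digit_code[OF assms(1) digit_index_less[OF assms(2,3)]] assms(3) by simp

lemma code_less: "length cs \<le> n \<Longrightarrow> code cs < (n + 1) ^ ((n + 1) * k)"
  unfolding code_def
proof (rule digits_less)
  show "length cs \<le> n \<Longrightarrow> sig adj cs (d div k) (d mod k) < n + 1" for d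
    using sig_le[of cs n adj "d div k" "d mod k"] n_pos by simp
qed

lemma next_digit_code:
  "length cs \<le> n \<Longrightarrow> d < (n + 1) * k \<Longrightarrow> next_digit (length cs) c (code cs) d = sig adj (cs @ [c]) (d div k) (d mod k)"
  by (simp add: next_digit_def digit_code sig_snoc)

lemma next_code_code:
  "length cs < n \<Longrightarrow> next_code (length cs) c (code cs) = code (cs @ [c])"
  unfolding next_code_def code_def[of "cs @ [c]"]
  by (rule digits_cong, rule next_digit_code) auto

lemma viable_length: "cs \<in> viable i \<Longrightarrow> length cs = i"
  by (simp add: viable_def)

lemma finite_viable [simp]: "finite (viable i)"
  by (rule finite_subset[OF _ finite_lists_length_eq[of "{..<k}" i]]) (auto simp: viable_def)

lemma viable_0: "viable 0 = {[]}"
  using k_pos by (auto simp: viable_def forbidden_def)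

text \<open>Discarding dead partial colorings loses no complete one. For vertex \<open>i\<close> the
  color \<open>c\<close> itself witnesses that a color was free; for later vertices the forbidden
  sets only grow.\<close>

lemma viable_prefix:
  assumes "cs @ [c] \<in> viable (Suc i)" "i < n"
  shows "cs \<in> viable i" "c < k"
proof -
  have len: "length cs = i" and c: "c < k" and cs: "set cs \<subseteq> {..<k}"
    using assms(1) by (auto simp: viable_def)
  have proper: "cs ! a \<noteq> (cs @ [c]) ! b" if "a < b" "b < Suc i" "adj a b" for a b
    using assms(1) that len by (auto simp: viable_def nth_append)
  have "\<exists>c'<k. \<not> forbidden adj cs v c'" if "i \<le> v" "v < n" for v
  proof (cases "v = i")
    case True
    have "cs ! a \<noteq> c" if "a < i" "adj a i" for a
      using proper[of a i] that by (simp add: nth_append len)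
    then have "\<not> forbidden adj cs v c"
      unfolding forbidden_def True len by blast
    then show ?thesis using c by blast
  next
    case False
    then have "Suc i \<le> v" using that by simp
    moreover have "\<forall>v. Suc i \<le> v \<and> v < n \<longrightarrow> (\<exists>c'<k. \<not> forbidden adj (cs @ [c]) v c')"
      using assms(1) unfolding viable_def by blast
    ultimately obtain c' where "c' < k" "\<not> forbidden adj (cs @ [c]) v c'"
      using \<open>v < n\<close> by blast
    then show ?thesis unfolding forbidden_snoc by blast
  qed
  moreover have "cs ! a \<noteq> cs ! b" if "a < b" "b < i" "adj a b" for a b
    using proper[of a b] that len by (simp add: nth_append)
  ultimately show "cs \<in> viable i" "c < k"
    using len cs c unfolding viable_def by blast+
qed

text \<open>The right-hand side mentions \<open>cs\<close> only through its code, so all colorings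
  with one signature are extended or discarded together.\<close>

lemma snoc_viable_iff:
  assumes cs: "cs \<in> viable i" and c: "c < k" and i: "i < n"
  shows "cs @ [c] \<in> viable (Suc i) \<longleftrightarrow> \<not> blocked i c (code cs)"
proof -
  have len: "length cs = i" using cs by (rule viable_length)
  have row: "next_digit i c (code cs) (u * k + c') = sig adj (cs @ [c]) u c'" if "u \<le> n" "c' < k" for u c'
    using next_digit_code[of cs "u * k + c'" c] digit_index_less[OF that] len i that by simp
  have "digit (code cs) ((i + 1) * k + c) \<noteq> 0 \<longleftrightarrow> forbidden adj cs i c"
    using digit_code_row[of cs "i + 1" c] len i c by (simp add: sig_def)
  \<comment> \<open>Row \<open>u\<close> belongs to vertex \<open>u - 1\<close>. The rows up to
    \<open>i + 1\<close> of the new signature, other than row \<open>0\<close>, are erased and hence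
    never full, because \<open>0 < k\<close>.\<close>
  moreover have "full_row i c (code cs) u \<longleftrightarrow> Suc i \<le> u - 1 \<and> (\<forall>c'<k. forbidden adj (cs @ [c]) (u - 1) c')"
    if "u \<le> n" for u
    using that row[of u] k_pos len unfolding full_row_def by (auto simp: sig_def)
  ultimately have 1: "blocked i c (code cs) \<longleftrightarrow> forbidden adj cs i c \<or>
      (\<exists>u\<le>n. Suc i \<le> u - 1 \<and> (\<forall>c'<k. forbidden adj (cs @ [c]) (u - 1) c'))"
    unfolding blocked_def by auto
  have 2: "(\<exists>u\<le>n. Suc i \<le> u - 1 \<and> (\<forall>c'<k. forbidden adj (cs @ [c]) (u - 1) c')) \<longleftrightarrow>
      (\<exists>v. Suc i \<le> v \<and> v < n \<and> (\<forall>c'<k. forbidden adj (cs @ [c]) v c'))"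
    (is "(\<exists>u\<le>n. ?P u) \<longleftrightarrow> (\<exists>v. ?Q v)")
  proof
    assume "\<exists>u\<le>n. ?P u"
    then obtain u where "u \<le> n" "?P u" by blast
    then show "\<exists>v. ?Q v" by (intro exI[of _ "u - 1"]) auto
  next
    assume "\<exists>v. ?Q v"
    then obtain v where "?Q v" by blast
    then show "\<exists>u\<le>n. ?P u" by (intro exI[of _ "Suc v"]) auto
  qed
  have 3: "(\<forall>b<Suc i. \<forall>a<b. adj a b \<longrightarrow> (cs @ [c]) ! a \<noteq> (cs @ [c]) ! b) \<longleftrightarrow> \<not> forbidden adj cs i c"
    using cs len by (auto simp: viable_def forbidden_def nth_append less_Suc_eq)
  show ?thesis
    unfolding 1 2 using cs c len by (auto simp: viable_def 3)
qed

lemma sum_sizes: "cs \<in> viable i \<Longrightarrow> (\<Sum>c<k. sig adj cs 0 c) = i"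
  using sum_count_set[of cs "{..<k}"] by (simp add: sig_def viable_def)

text \<open>The class sizes in row \<open>0\<close> sum to the number of colored vertices, so the
  code reveals the stage. This lets one dictionary serve all stages without clearing.\<close>

lemma code_length_eq:
  assumes "cs \<in> viable i" "cs' \<in> viable j" "i \<le> n" "j \<le> n" "code cs = code cs'"
  shows "i = j"
proof -
  have "sig adj cs 0 c = sig adj cs' 0 c" if "c < k" for c
    using digit_code_row[of cs 0 c] digit_code_row[of cs' 0 c] assms that by (simp add: viable_length)
  then have "(\<Sum>c<k. sig adj cs 0 c) = (\<Sum>c<k. sig adj cs' 0 c)" by simp
  then show ?thesis using assms sum_sizes by metis
qed

text \<open>The colorings that the dictionary accounts for in the middle of stage \<open>i\<close>;
  \<open>Z\<close> is the set of pairs of a signature and a color processed so far, empty at the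
  start of the stage.\<close>

definition reached :: "nat \<Rightarrow> (nat \<times> nat) set \<Rightarrow> nat list set" where
  "reached i Z = (\<Union>j\<le>i. viable j) \<union>
     {cs @ [c] | cs c. cs \<in> viable i \<and> (code cs, c) \<in> Z \<and> cs @ [c] \<in> viable (Suc i)}"

definition tab :: "nat list set \<Rightarrow> nat \<Rightarrow> nat" where
  "tab D x = card {cs \<in> D. code cs = x}"

lemma reached_subset: "reached i Z \<subseteq> (\<Union>j\<le>Suc i. viable j)"
  by (auto simp: reached_def intro: le_SucI)

lemma finite_reached [simp]: "finite (reached i Z)"
  by (rule finite_subset[OF reached_subset]) simp

text \<open>Hence a zero entry of the dictionary marks a signature not met before, and no separate
  flag for membership in the queue is kept.\<close>

lemma tab_eq_0_iff: "finite D \<Longrightarrow> tab D x = 0 \<longleftrightarrow> x \<notin> code ` D"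
  by (auto simp: tab_def)

text \<open>Extensions made during stage \<open>i\<close> have length \<open>i + 1\<close> and
  therefore other codes, so the counts read in stage \<open>i\<close> are not altered by it. The
  second hypothesis keeps all lengths at most \<open>n\<close>, where codes are faithful.\<close>

lemma tab_reached:
  assumes "x \<in> code ` viable i" "i < n \<or> i \<le> n \<and> Z = {}"
  shows "tab (reached i Z) x = card {cs \<in> viable i. code cs = x}"
proof -
  have "{cs \<in> reached i Z. code cs = x} = {cs \<in> viable i. code cs = x}"
  proof (intro equalityI subsetI)
    fix cs assume cs: "cs \<in> {cs \<in> reached i Z. code cs = x}"
    have "reached i Z \<subseteq> (\<Union>j\<le>n. viable j)"
    proof (cases "i < n")
      case True
      then have "{..Suc i} \<subseteq> {..n}" by simp
      then show ?thesis by (rule subset_trans[OF reached_subset UN_mono[OF _ subset_refl]])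
    next
      case False
      then show ?thesis using assms(2) by (auto simp: reached_def)
    qed
    then obtain j where j: "j \<le> n" "cs \<in> viable j" using cs by blast
    then have "j = i" using assms cs code_length_eq[of cs j _ i] by auto
    then show "cs \<in> {cs \<in> viable i. code cs = x}" using j cs by simp
  qed (auto simp: reached_def)
  then show ?thesis by (simp add: tab_def)
qed

lemma reached_insert_blocked:
  assumes "blocked i c x" "c < k" "i < n"
  shows "reached i (insert (x, c) Z) = reached i Z"
  using assms snoc_viable_iff by (auto simp: reached_def)

text \<open>Appending \<open>c\<close> is injective and sends all colorings with code
  \<open>x\<close> to the same new code, so a single entry changes. The new colorings really are new
  because \<open>(x, c)\<close> was not yet processed.\<close>

lemma reached_insert:
  assumes x: "x \<in> code ` viable i" and c: "c < k" and i: "i < n" and nb: "\<not> blocked i c x"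
    and Z: "(x, c) \<notin> Z"
  shows "code ` reached i (insert (x, c) Z) = insert (next_code i c x) (code ` reached i Z)"
    "tab (reached i (insert (x, c) Z)) =
       (tab (reached i Z))(next_code i c x := tab (reached i Z) (next_code i c x) + tab (reached i Z) x)"
proof -
  let ?F = "{cs \<in> viable i. code cs = x}"
  let ?N = "(\<lambda>cs. cs @ [c]) ` ?F"
  have viable_N: "cs @ [c] \<in> viable (Suc i)" if "cs \<in> ?F" for cs
    using that snoc_viable_iff[OF _ c i] nb by auto
  have un: "reached i (insert (x, c) Z) = reached i Z \<union> ?N"
  proof (intro equalityI subsetI)
    fix cs' assume "cs' \<in> reached i (insert (x, c) Z)"
    then consider "cs' \<in> reached i Z" | cs where "cs' = cs @ [c]" "cs \<in> ?F"
      unfolding reached_def by blast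
    then show "cs' \<in> reached i Z \<union> ?N" by cases auto
  next
    fix cs' assume "cs' \<in> reached i Z \<union> ?N"
    then consider "cs' \<in> reached i Z" | cs where "cs' = cs @ [c]" "cs \<in> ?F" by blast
    then show "cs' \<in> reached i (insert (x, c) Z)"
    proof cases
      case 1
      then show ?thesis unfolding reached_def by blast
    next
      case 2
      then show ?thesis using viable_N[of cs] unfolding reached_def by blast
    qed
  qed
  have code_N: "code cs' = next_code i c x" if N: "cs' \<in> ?N" for cs'
  proof -
    obtain cs where cs: "cs' = cs @ [c]" "cs \<in> viable i" "code cs = x" using N by blast
    then show ?thesis using next_code_code[of cs c] i viable_length[of cs i] by simp
  qed
  have ne: "?N \<noteq> {}" using x by auto
  have "code ` ?N = (\<lambda>_. next_code i c x) ` ?N" by (rule image_cong[OF refl code_N])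
  then have "code ` ?N = {next_code i c x}" using ne by (simp only: image_constant_conv if_False)
  then show "code ` reached i (insert (x, c) Z) = insert (next_code i c x) (code ` reached i Z)"
    unfolding un image_Un by simp
  have disj: "cs \<notin> ?N" if "cs \<in> reached i Z" for cs
  proof
    assume N: "cs \<in> ?N"
    then have "length cs = Suc i" using viable_length by auto
    then have "cs \<notin> (\<Union>j\<le>i. viable j)" using viable_length by fastforce
    then show False using that N Z by (auto simp: reached_def)
  qed
  show "tab (reached i (insert (x, c) Z)) =
       (tab (reached i Z))(next_code i c x := tab (reached i Z) (next_code i c x) + tab (reached i Z) x)"
  proof
    fix y
    have "{cs \<in> reached i (insert (x, c) Z). code cs = y} = {cs \<in> reached i Z. code cs = y} \<union> {cs \<in> ?N. code cs = y}"
      unfolding un by blast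
    then have 1: "tab (reached i (insert (x, c) Z)) y = tab (reached i Z) y + card {cs \<in> ?N. code cs = y}"
      unfolding tab_def using disj by (simp add: card_Un_disjoint disjoint_iff)
    show "tab (reached i (insert (x, c) Z)) y =
       ((tab (reached i Z))(next_code i c x := tab (reached i Z) (next_code i c x) + tab (reached i Z) x)) y"
    proof (cases "y = next_code i c x")
      case True
      then have "{cs \<in> ?N. code cs = y} = ?N" using code_N by blast
      moreover have "card ?N = card ?F" by (intro card_image inj_onI) simp
      ultimately show ?thesis using 1 True tab_reached[OF x] i by simp
    next
      case False
      then have "{cs \<in> ?N. code cs = y} = {}" using code_N by blast
      then show ?thesis using 1 False by simp
    qed
  qed
qed

text \<open>By \<open>viable_prefix\<close> every viable coloring of length \<open>Suc i\<close>
  extends a viable one, so it is found once all pairs are processed.\<close>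

lemma reached_Suc:
  assumes "i < n" "code ` viable i \<times> {..<k} \<subseteq> Z"
  shows "reached i Z = reached (Suc i) {}"
proof -
  have "{cs @ [c] | cs c. cs \<in> viable i \<and> (code cs, c) \<in> Z \<and> cs @ [c] \<in> viable (Suc i)} = viable (Suc i)"
  proof (intro equalityI subsetI)
    fix cs' assume v: "cs' \<in> viable (Suc i)"
    then obtain cs c where "cs' = cs @ [c]" using viable_length by (metis length_Suc_conv_rev)
    then show "cs' \<in> {cs @ [c] | cs c. cs \<in> viable i \<and> (code cs, c) \<in> Z \<and> cs @ [c] \<in> viable (Suc i)}"
      using v viable_prefix[of cs c i] assms by blast
  qed blast
  then show ?thesis by (auto simp: reached_def atMost_Suc)
qed

lemma tab_reached_0: "tab (reached 0 {}) = (\<lambda>_. 0)(code [] := 1)"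
proof
  fix x
  have "{cs \<in> reached 0 {}. code cs = x} = (if x = code [] then {[]} else {})"
    by (auto simp: reached_def viable_0)
  then show "tab (reached 0 {}) x = ((\<lambda>_. 0)(code [] := 1)) x"
    by (simp add: tab_def)
qed

lemma code_Nil: "code [] = 0"
  unfolding code_def digits_def by (rule sum.neutral) (simp add: sig_def forbidden_def)

end

section \<open>The number of signatures per stage\<close>

context coloring_dp
begin

lemma card_codes_le_power: "card (code ` viable i) \<le> k ^ i"
proof -
  have "card (code ` viable i) \<le> card (viable i)" by (intro card_image_le) simp
  also have "\<dots> \<le> card {cs. set cs \<subseteq> {..<k} \<and> length cs = i}"
    by (intro card_mono finite_lists_length_eq) (auto simp: viable_def)
  finally show ?thesis by (simp add: card_lists_length_eq)
qed

text \<open>Vertices with the same label are twins towards the uncolored vertices, so the flags depend only on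
  the set of colors of each label. For a label with uncolored neighbors this set is nonempty, and in a
  viable coloring it is not the set of all colors.\<close>

lemma card_codes_le_twins:
  fixes lab :: "nat \<Rightarrow> nat"
  assumes i: "i \<le> n" and lab: "\<And>a. a < i \<Longrightarrow> lab a \<in> {1..w}"
    and twins: "\<And>a b v. a < i \<Longrightarrow> b < i \<Longrightarrow> lab a = lab b \<Longrightarrow> i \<le> v \<Longrightarrow> v < n \<Longrightarrow> adj a v \<longleftrightarrow> adj b v"
  shows "card (code ` viable i) \<le> (n + 1) ^ k * max 1 (2 ^ k - 2) ^ w"
proof -
  define L where "L = {l. \<exists>a v. a < i \<and> lab a = l \<and> i \<le> v \<and> v < n \<and> adj a v}"
  define cols where "cols cs l = {cs ! a |a. a < i \<and> lab a = l}" for cs :: "nat list" and l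
  \<comment> \<open>\<open>F\<close> records the class sizes and the color set of each label in
    \<open>L\<close>. It determines the code, and its values lie in a product of size
    \<open>(n + 1) ^ k * card S ^ card L\<close>.\<close>
  define F where "F cs = (restrict (count_list cs) {..<k}, restrict (cols cs) L)" for cs
  define S where "S = Pow {..<k} - {{}, {..<k}}"
  have LW: "L \<subseteq> {1..w}" using lab by (auto simp: L_def)
  then have finL: "finite L" by (rule finite_subset) simp
  have F_in: "F cs \<in> ({..<k} \<rightarrow>\<^sub>E {..n}) \<times> (L \<rightarrow>\<^sub>E S)" if cs: "cs \<in> viable i" for cs
  proof -
    have len: "length cs = i" and set: "set cs \<subseteq> {..<k}" using cs by (auto simp: viable_def)
    have "count_list cs c \<le> n" for c using count_le_length[of cs c] len i by simp
    moreover have "cols cs l \<in> S" if l: "l \<in> L" for l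
    proof -
      obtain a v where a: "a < i" "lab a = l" "i \<le> v" "v < n" "adj a v" using l by (auto simp: L_def)
      have "cols cs l \<subseteq> {..<k}" using set len nth_mem by (fastforce simp: cols_def)
      moreover have "cols cs l \<noteq> {}" using a by (auto simp: cols_def)
      \<comment> \<open>Look-ahead gives a color \<open>c\<close> still free at \<open>v\<close>.
        Every vertex with label \<open>l\<close> is adjacent to \<open>v\<close>, being a twin of
        \<open>a\<close>, so none of them has color \<open>c\<close>.\<close>
      moreover obtain c where c: "c < k" "\<not> forbidden adj cs v c"
        using cs a unfolding viable_def by blast
      have "c \<notin> cols cs l"
      proof
        assume "c \<in> cols cs l"
        then obtain b where b: "c = cs ! b" "b < i" "lab b = l" by (auto simp: cols_def)
        then have "adj b v" using twins[of a b v] a by simp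
        then show False using c b len by (auto simp: forbidden_def)
      qed
      ultimately show ?thesis using c by (auto simp: S_def)
    qed
    ultimately show ?thesis by (auto simp: F_def)
  qed
  have code_eq: "code cs = code cs'" if V: "cs \<in> viable i" "cs' \<in> viable i" and FF: "F cs = F cs'" for cs cs'
  proof -
    have len: "length cs = i" "length cs' = i" using V by (auto simp: viable_def)
    have cnt: "count_list cs c = count_list cs' c" if "c < k" for c
      using FF that unfolding F_def by (metis Pair_inject lessThan_iff restrict_apply')
    have cols: "cols cs l = cols cs' l" if "l \<in> L" for l
      using FF that unfolding F_def by (metis Pair_inject restrict_apply')
    have "forbidden adj cs v c \<longleftrightarrow> forbidden adj cs' v c" if v: "i \<le> v" "v < n" for v c
    proof -
      \<comment> \<open>Being twins, the vertices of a label forbid their colors at \<open>v\<close>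
        either all or not at all. So the flags at \<open>v\<close> depend only on the color sets of
        the labels adjacent to \<open>v\<close>.\<close>
      have "forbidden adj xs v c \<longleftrightarrow> (\<exists>l\<in>L. (\<exists>a<i. lab a = l \<and> adj a v) \<and> c \<in> cols xs l)"
        if xs: "length xs = i" for xs
      proof
        assume "forbidden adj xs v c"
        then obtain a where a: "a < i" "adj a v" "xs ! a = c" using xs unfolding forbidden_def by blast
        then have "lab a \<in> L" "c \<in> cols xs (lab a)" using v unfolding L_def cols_def by blast+
        then show "\<exists>l\<in>L. (\<exists>a<i. lab a = l \<and> adj a v) \<and> c \<in> cols xs l" using a by blast
      next
        assume "\<exists>l\<in>L. (\<exists>a<i. lab a = l \<and> adj a v) \<and> c \<in> cols xs l"
        then obtain a b where ab: "a < i" "adj a v" "b < i" "lab b = lab a" "c = xs ! b"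
          unfolding cols_def by blast
        then have "adj b v" using twins[of b a v] v by simp
        then show "forbidden adj xs v c" using ab xs unfolding forbidden_def by blast
      qed
      then show ?thesis using len cols by simp
    qed
    then have "sig adj cs u c = sig adj cs' u c" if "u \<le> n" "c < k" for u c
      using that cnt len by (auto simp: sig_def)
    moreover have "d div k \<le> n" "d mod k < k" if "d < (n + 1) * k" for d
      using less_mult_imp_div_less[OF that] k_pos by simp_all
    ultimately show ?thesis
      unfolding code_def by (intro digits_cong) blast
  qed
  \<comment> \<open>Since \<open>code\<close> factors through \<open>F\<close>, choosing one
    coloring per value of \<open>F\<close> already yields all codes.\<close>
  have "code ` viable i \<subseteq> (\<lambda>y. code (inv_into (viable i) F y)) ` (({..<k} \<rightarrow>\<^sub>E {..n}) \<times> (L \<rightarrow>\<^sub>E S))"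
  proof (intro image_subsetI)
    fix cs assume cs: "cs \<in> viable i"
    then have "inv_into (viable i) F (F cs) \<in> viable i" "F (inv_into (viable i) F (F cs)) = F cs"
      by (simp_all add: inv_into_into f_inv_into_f)
    then have "code cs = code (inv_into (viable i) F (F cs))"
      by (intro code_eq[OF cs]) simp_all
    then show "code cs \<in> (\<lambda>y. code (inv_into (viable i) F y)) ` (({..<k} \<rightarrow>\<^sub>E {..n}) \<times> (L \<rightarrow>\<^sub>E S))"
      using F_in[OF cs] by (rule image_eqI)
  qed
  moreover have fin: "finite (({..<k} \<rightarrow>\<^sub>E {..n}) \<times> (L \<rightarrow>\<^sub>E S))"
    using finL by (intro finite_cartesian_product finite_PiE) (auto simp: S_def)
  ultimately have "card (code ` viable i) \<le> card (({..<k} \<rightarrow>\<^sub>E {..n}) \<times> (L \<rightarrow>\<^sub>E S))"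
    by (meson card_image_le card_mono finite_imageI le_trans)
  also have "\<dots> = (n + 1) ^ k * card S ^ card L"
    using finL by (simp add: card_cartesian_product card_PiE)
  also have "card S = 2 ^ k - 2"
  proof -
    have "{} \<noteq> {..<k}" using k_pos by auto
    then have "card {{}, {..<k}} = 2" by simp
    moreover have "card S = card (Pow {..<k}) - card {{}, {..<k}}"
      unfolding S_def by (rule card_Diff_subset) auto
    ultimately show ?thesis by (simp add: card_Pow)
  qed
  also have "(n + 1) ^ k * (2 ^ k - 2) ^ card L \<le> (n + 1) ^ k * max 1 (2 ^ k - 2) ^ w"
  proof -
    \<comment> \<open>For \<open>k = 1\<close> the base is \<open>0\<close>; with
      \<open>max 1\<close> it becomes monotone in the exponent, so that \<open>card L\<close> may be
      replaced by \<open>w\<close>.\<close>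
    have "(2 ^ k - 2 :: nat) ^ card L \<le> max 1 (2 ^ k - 2) ^ card L"
      by (intro power_mono) auto
    also have "\<dots> \<le> max 1 (2 ^ k - 2) ^ w"
      using card_mono[OF _ LW] by (intro power_increasing) auto
    finally show ?thesis by simp
  qed
  finally show ?thesis .
qed

definition balanced :: "nat \<Rightarrow> bool" where
  "balanced x \<longleftrightarrow> (\<forall>c<k. \<forall>c'<k. digit x c \<le> digit x c' + 1)"

text \<open>Balance can be read off row \<open>0\<close>, so the fibres of \<open>code\<close> over
  balanced codes partition the colorings to be counted.\<close>

lemma sum_balanced:
  "(\<Sum>x\<in>code ` viable n. if balanced x then tab (reached n {}) x else 0) =
   card {cs \<in> viable n. \<forall>c<k. \<forall>c'<k. count_list cs c \<le> count_list cs c' + 1}"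
proof -
  have bal: "balanced (code cs) \<longleftrightarrow> (\<forall>c<k. \<forall>c'<k. count_list cs c \<le> count_list cs c' + 1)"
    if "cs \<in> viable n" for cs
    using digit_code_row[of cs 0] viable_length[OF that] by (simp add: balanced_def sig_def)
  let ?E = "{cs \<in> viable n. \<forall>c<k. \<forall>c'<k. count_list cs c \<le> count_list cs c' + 1}"
  let ?X = "{x \<in> code ` viable n. balanced x}"
  have "?E = {cs \<in> viable n. balanced (code cs)}"
    by (rule Collect_cong, rule conj_cong[OF refl], rule bal[symmetric])
  then have E: "?E = (\<Union>x\<in>?X. {cs \<in> viable n. code cs = x})" by auto
  have "card ?E = (\<Sum>x\<in>?X. card {cs \<in> viable n. code cs = x})"
    unfolding E by (rule card_UN_disjoint) auto
  also have "\<dots> = (\<Sum>x\<in>?X. tab (reached n {}) x)"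
    by (rule sum.cong[OF refl], rule tab_reached[symmetric]) auto
  also have "\<dots> = (\<Sum>x\<in>code ` viable n. if balanced x then tab (reached n {}) x else 0)"
    by (rule sum.inter_filter) (rule finite_imageI, rule finite_viable)
  finally show ?thesis by (rule sym)
qed

end

section \<open>List colorings versus equitable colorings of the graph\<close>

lemma count_list_map_distinct:
  "distinct us \<Longrightarrow> count_list (map g us) c = card {v \<in> set us. g v = c}"
proof (induction us)
  case (Cons u us)
  have "{v \<in> set (u # us). g v = c} = (if g u = c then insert u {v \<in> set us. g v = c} else {v \<in> set us. g v = c})"
    by auto
  then show ?case using Cons by simp
qed simp

text \<open>Color \<open>c + 1\<close> of the statement is color \<open>c\<close> of the dynamic program.\<close>

lemma card_equitable_colorings:
  assumes G: "pair_graph G" and us: "distinct us" "set us = pverts G" "length us = n"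
    and adj: "\<And>a b. a < n \<Longrightarrow> b < n \<Longrightarrow> adj a b \<longleftrightarrow> (us ! a, us ! b) \<in> parcs G"
    and k: "0 < k" and n: "0 < n"
  shows "card (equitable_colorings k G) =
    card {cs \<in> coloring_dp.viable k n adj n. \<forall>c<k. \<forall>c'<k. count_list cs c \<le> count_list cs c' + 1}"
proof -
  interpret coloring_dp k n adj using k n by unfold_locales
  interpret G: pair_graph G by (rule G)
  define f where "f \<phi> = map (\<lambda>v. \<phi> v - 1) us" for \<phi> :: "'a \<Rightarrow> nat"
  define idx where "idx v = (SOME a. a < n \<and> us ! a = v)" for v
  have idx: "idx v < n" "us ! idx v = v" if "v \<in> pverts G" for v
  proof -
    have "\<exists>a. a < n \<and> us ! a = v" using that us by (metis in_set_conv_nth)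
    then have "idx v < n \<and> us ! idx v = v" unfolding idx_def by (rule someI_ex)
    then show "idx v < n" "us ! idx v = v" by auto
  qed
  have idx_nth: "idx (us ! a) = a" if "a < n" for a
    using idx[of "us ! a"] that us by (metis nth_eq_iff_index_eq nth_mem)
  define g where "g cs = restrict (\<lambda>v. Suc (cs ! idx v)) (pverts G)" for cs :: "nat list"
  let ?C = "equitable_colorings k G"
  let ?L = "{cs \<in> viable n. \<forall>c<k. \<forall>c'<k. count_list cs c \<le> count_list cs c' + 1}"
  have arc_ends: "u \<in> pverts G" "v \<in> pverts G" if "(u, v) \<in> parcs G" for u v
    using G.in_arcsD1 G.in_arcsD2 that by blast+
  have equit: "(\<forall>i \<in> {1..k}. \<forall>j \<in> {1..k}.
     \<bar>int (card (color_class G \<phi> i)) - int (card (color_class G \<phi> j))\<bar> \<le> 1) \<longleftrightarrow>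
     (\<forall>c<k. \<forall>c'<k. count_list (f \<phi>) c \<le> count_list (f \<phi>) c' + 1)"
    if \<phi>: "\<phi> \<in> pverts G \<rightarrow>\<^sub>E {1..k}" for \<phi>
  proof -
    have cc: "card (color_class G \<phi> (Suc c)) = count_list (f \<phi>) c" if "c < k" for c
    proof -
      have "{v \<in> pverts G. \<phi> v = Suc c} = {v \<in> set us. \<phi> v - 1 = c}"
        using \<phi> us by (force simp: PiE_iff)
      then show ?thesis
        unfolding f_def color_class_def count_list_map_distinct[OF us(1)] by (rule arg_cong)
    qed
    have "{1..k} = Suc ` {..<k}" by (simp add: image_Suc_lessThan)
    then have "(\<forall>i \<in> {1..k}. \<forall>j \<in> {1..k}.
        \<bar>int (card (color_class G \<phi> i)) - int (card (color_class G \<phi> j))\<bar> \<le> 1) \<longleftrightarrow>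
      (\<forall>c<k. \<forall>c'<k. \<bar>int (count_list (f \<phi>) c) - int (count_list (f \<phi>) c')\<bar> \<le> 1)"
      using cc by (simp, simp add: Ball_def)
    \<comment> \<open>All ordered pairs are quantified over, so a one-sided inequality replaces the
      absolute value and truncated subtraction never arises.\<close>
    also have "\<dots> \<longleftrightarrow> (\<forall>c<k. \<forall>c'<k. count_list (f \<phi>) c \<le> count_list (f \<phi>) c' + 1)"
      by (auto simp: abs_le_iff) (smt (verit) of_nat_le_iff of_nat_Suc)+
    finally show ?thesis .
  qed
  have "bij_betw f ?C ?L"
  proof (rule bij_betw_byWitness[where f' = g])
    show "\<forall>\<phi>\<in>?C. g (f \<phi>) = \<phi>"
    proof
      fix \<phi> assume "\<phi> \<in> ?C"
      then have \<phi>: "\<phi> \<in> pverts G \<rightarrow>\<^sub>E {1..k}" by (simp add: equitable_colorings_def colorings_def)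
      have "g (f \<phi>) v = \<phi> v" if "v \<in> pverts G" for v
        using \<phi> that idx[OF that] us by (force simp: g_def f_def PiE_iff)
      then show "g (f \<phi>) = \<phi>"
        using \<phi> by (intro ext) (metis PiE_arb g_def restrict_apply)
    qed
    show gf: "\<forall>cs\<in>?L. f (g cs) = cs"
      using us idx_nth by (auto simp: f_def g_def viable_def intro!: nth_equalityI)
    show "f ` ?C \<subseteq> ?L"
    proof
      fix cs assume "cs \<in> f ` ?C"
      then obtain \<phi> where \<phi>: "\<phi> \<in> ?C" "cs = f \<phi>" by blast
      then have P: "\<phi> \<in> pverts G \<rightarrow>\<^sub>E {1..k}" and arcs: "\<And>u v. (u, v) \<in> parcs G \<Longrightarrow> \<phi> u \<noteq> \<phi> v"
        by (auto simp: equitable_colorings_def colorings_def)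
      have pos: "1 \<le> \<phi> (us ! a)" "\<phi> (us ! a) \<le> k" if "a < n" for a
        using P us that by (auto simp: PiE_iff)
      have "f \<phi> ! a \<noteq> f \<phi> ! b" if "a < b" "b < n" "adj a b" for a b
        using arcs[of "us ! a" "us ! b"] adj[of a b] that us pos[of a] pos[of b] by (auto simp: f_def)
      moreover have "set (f \<phi>) \<subseteq> {..<k}"
        using P us by (force simp: f_def PiE_iff)
      ultimately have "f \<phi> \<in> viable n" using us by (auto simp: viable_def f_def)
      then show "cs \<in> ?L"
        using \<phi> equit[OF P] by (simp add: equitable_colorings_def)
    qed
    show "g ` ?L \<subseteq> ?C"
    proof
      fix \<phi> assume "\<phi> \<in> g ` ?L"
      then obtain cs where cs: "cs \<in> ?L" "\<phi> = g cs" by blast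
      have len: "length cs = n" and set: "set cs \<subseteq> {..<k}" using cs by (auto simp: viable_def)
      have P: "\<phi> \<in> pverts G \<rightarrow>\<^sub>E {1..k}"
        using cs(2) idx len set nth_mem by (fastforce simp: g_def Suc_le_eq)
      \<comment> \<open>\<open>viable\<close> compares only positions \<open>a < b\<close>. By
        symmetry of the arcs and absence of loops every edge can be read in the increasing
        direction.\<close>
      have lt: "\<phi> u \<noteq> \<phi> v" if uv: "(u, v) \<in> parcs G" "idx u < idx v" for u v
      proof -
        have "adj (idx u) (idx v)" using adj arc_ends[OF uv(1)] idx uv by simp
        then have "cs ! idx u \<noteq> cs ! idx v"
          using cs(1) uv(2) idx(1) arc_ends[OF uv(1)] by (auto simp: viable_def)
        then show ?thesis using cs(2) arc_ends[OF uv(1)] by (simp add: g_def)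
      qed
      have "\<phi> u \<noteq> \<phi> v" if uv: "(u, v) \<in> parcs G" for u v
      proof -
        have "(v, u) \<in> parcs G" using G.arcs_symmetric uv by blast
        moreover have "idx u \<noteq> idx v" using idx arc_ends[OF uv] G.no_loops' uv by metis
        ultimately show ?thesis using lt[of u v] lt[of v u] uv by (metis nat_neq_iff)
      qed
      then have "\<phi> \<in> colorings k G" using P by (auto simp: colorings_def)
      moreover have "f \<phi> = cs" using gf cs by blast
      ultimately show "\<phi> \<in> ?C"
        using equit[OF P] cs(1) by (simp add: equitable_colorings_def)
    qed
  qed
  then show ?thesis by (rule bij_betw_same_card)
qed

section \<open>The dynamic program on the machine\<close>

text \<open>Arrays: \<open>0\<close> adjacency matrix, \<open>1\<close> labels, \<open>2\<close> queue of signatures, \<open>3\<close> number of colorings per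
  signature. Scalars \<open>1\<close> and \<open>2\<close> are \<open>k\<close> and \<open>n\<close>, \<open>31\<close> is the base \<open>n + 1\<close>, and the loop counters \<open>10\<close>,
  \<open>14\<close>, \<open>16\<close>, \<open>18\<close> run over vertices, colors, rows and columns of a signature. Scalars \<open>20\<close> and \<open>21\<close> are
  the current signature and its count, \<open>22\<close> and \<open>23\<close> delimit the queue, \<open>24\<close> holds the digits still to be
  read, \<open>25\<close> the new signature, \<open>26\<close> the place value, and \<open>27\<close>, \<open>28\<close> flag a dead coloring and a full row.\<close>

definition column_prog :: prog where
  "column_prog =
     Seq (assign 29 (mod_exp (Var 24) (Var 31)))
    (Seq (assign 24 (Bin Div (Var 24) (Var 31)))
    (Seq (assign 27 (or_exp (Var 27) (and_exp (and_exp (eq_exp (Var 16) (Bin Add (Var 10) (Num 1))) (eq_exp (Var 18) (Var 14))) (Var 29))))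
    (Seq (assign 30 (if_exp (eq_exp (Var 16) (Num 0)) (Bin Add (Var 29) (eq_exp (Var 18) (Var 14)))
        (and_exp (less_exp (Bin Add (Var 10) (Num 1)) (Var 16))
          (or_exp (Var 29) (and_exp (eq_exp (Var 18) (Var 14))
            (Arr 0 (Bin Add (Bin Mul (Var 10) (Var 2)) (Bin Sub (Var 16) (Num 1)))))))))
    (Seq (assign 25 (Bin Add (Var 25) (Bin Mul (Var 30) (Var 26))))
    (Seq (assign 26 (Bin Mul (Var 26) (Var 31)))
         (assign 28 (and_exp (Var 28) (Var 30))))))))"

definition row_prog :: prog where
  "row_prog =
     Seq (assign 28 (less_exp (Num 0) (Var 16)))
    (Seq (for_loop 18 19 (Var 1) column_prog)
         (assign 27 (or_exp (Var 27) (Var 28))))"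

definition step_prog :: prog where
  "step_prog =
     Seq (assign 24 (Var 20))
    (Seq (assign 25 (Num 0))
    (Seq (assign 26 (Num 1))
    (Seq (assign 27 (Num 0))
         (for_loop 16 17 (Bin Add (Var 2) (Num 1)) row_prog))))"

definition agree :: "nat set \<Rightarrow> store \<Rightarrow> store \<Rightarrow> bool" where
  "agree T s s' \<longleftrightarrow> (\<forall>x. x \<notin> T \<longrightarrow> s' (V x) = s (V x)) \<and> (\<forall>r j. s' (A r j) = s (A r j))"

lemma agreeD: "agree T s s' \<Longrightarrow> x \<notin> T \<Longrightarrow> s' (V x) = s (V x)" "agree T s s' \<Longrightarrow> s' (A r j) = s (A r j)"
  by (auto simp: agree_def)

lemma agree_refl: "agree T s s"
  by (simp add: agree_def)

lemma agree_upd: "x \<in> T \<Longrightarrow> agree T s (s'(V x := v)) \<longleftrightarrow> agree T s s'"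
  by (auto simp: agree_def)

lemma matrix_index_less: "a < n \<Longrightarrow> b < n \<Longrightarrow> a * n + b < n * n" for a b n :: nat
proof -
  assume "a < n" "b < n"
  then have "a * n + b < a * n + n" by simp
  also have "\<dots> = Suc a * n" by simp
  also have "\<dots> \<le> n * n" using \<open>a < n\<close> by (intro mult_le_mono1) simp
  finally show ?thesis .
qed

context coloring_dp
begin

definition max_code :: nat where
  "max_code = (n + 1) ^ ((n + 1) * k)"

text \<open>Four interleaved arrays explain the factors \<open>4\<close> in the addresses: the
  matrix has \<open>n * n\<close> cells, the dictionary is indexed by codes below
  \<open>max_code\<close>, and the queue holds at most \<open>(n + 1) * k ^ n\<close> codes. The
  last quantity bounds the number of viable colorings of all lengths and hence the counts
  too.\<close>

definition value_bound :: nat where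
  "value_bound = 200 + k + n + 4 * (n * n) + 4 * max_code + 4 * ((n + 1) * k ^ n)"

definition step_vars :: "nat set" where
  "step_vars = {16, 17, 18, 19, 24, 25, 26, 27, 28, 29, 30}"

definition matrix_store :: "store \<Rightarrow> bool" where
  "matrix_store s \<longleftrightarrow> s (V 1) = k \<and> s (V 2) = n \<and> s (V 31) = n + 1 \<and>
     (\<forall>a<n. \<forall>b<n. s (A 0 (a * n + b)) = of_bool (adj a b))"

definition step_store :: "nat \<Rightarrow> nat \<Rightarrow> nat \<Rightarrow> store \<Rightarrow> bool" where
  "step_store i c X s \<longleftrightarrow> matrix_store s \<and> s (V 10) = i \<and> s (V 14) = c \<and> s (V 20) = X \<and>
     i < n \<and> c < k \<and> X \<in> code ` viable i"

text \<open>The old signature is consumed and the new one produced digit by digit from the least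
  significant end; \<open>d\<close> digits are done.\<close>

definition partial_step :: "nat \<Rightarrow> nat \<Rightarrow> nat \<Rightarrow> nat \<Rightarrow> bool \<Rightarrow> store \<Rightarrow> bool" where
  "partial_step i c X d H s \<longleftrightarrow> s (V 24) = X div (n + 1) ^ d \<and> s (V 26) = (n + 1) ^ d \<and>
     s (V 25) = digits (n + 1) (next_digit i c X) d \<and> s (V 27) = of_bool H"

lemma power_le_max_code: "d \<le> (n + 1) * k \<Longrightarrow> (n + 1) ^ d \<le> max_code"
  unfolding max_code_def by (rule power_increasing) auto

text \<open>A class size may grow by one, so an arbitrary number \<open>X\<close> would not do: the
  bound holds because \<open>X\<close> is the code of a coloring with fewer than \<open>n\<close>
  vertices. It excludes carries in the new code.\<close>

lemma next_digit_le:
  assumes "X \<in> code ` viable i" "i < n" "d < (n + 1) * k"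
  shows "next_digit i c X d \<le> n"
proof -
  obtain cs where "cs \<in> viable i" "X = code cs" using assms(1) by blast
  then have "next_digit i c X d = sig adj (cs @ [c]) (d div k) (d mod k)" "length (cs @ [c]) \<le> n"
    using next_digit_code[of cs d c] assms viable_length[of cs i] by auto
  then show ?thesis using sig_le[of "cs @ [c]" n adj "d div k" "d mod k"] n_pos by simp
qed

lemma code_le: "X \<in> code ` viable i \<Longrightarrow> i \<le> n \<Longrightarrow> X < max_code"
  unfolding max_code_def using code_less viable_length by fastforce

lemma reaches_column:
  assumes s0: "step_store i c X s0" and s: "agree step_vars s0 s" and u: "u \<le> n" "s (V 16) = u"
    and c': "c' < k" "s (V 18) = c'"
    and ps: "partial_step i c X (u * k + c') H s"
    and prod: "s (V 28) = of_bool P"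
  shows "reaches xs value_bound column_prog s 0 (\<lambda>N s'. N \<le> 250 \<and>
     agree step_vars s0 s' \<and> (\<forall>z\<in>{16,17,18,19}. s' (V z) = s (V z)) \<and>
     partial_step i c X (u * k + Suc c') (H \<or> u = i + 1 \<and> c' = c \<and> digit X (u * k + c') \<noteq> 0) s' \<and>
     s' (V 28) = of_bool (P \<and> next_digit i c X (u * k + c') \<noteq> 0))"
proof -
  let ?d = "u * k + c'"
  let ?D = "next_digit i c X"
  have d: "?d < (n + 1) * k" using digit_index_less u c' by blast
  have ic: "i < n" "c < k" and X: "X \<in> code ` viable i" using s0 by (auto simp: step_store_def)
  have vals: "s (V 1) = k" "s (V 2) = n" "s (V 31) = n + 1" "s (V 10) = i" "s (V 14) = c"
    using s0 agreeD(1)[OF s] by (simp_all add: step_store_def matrix_store_def step_vars_def)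
  \<comment> \<open>The conditional expression reads the matrix in row \<open>0\<close> as well,
    where \<open>u - 1\<close> is truncated to \<open>0\<close>; the cell must be a valid one there
    too.\<close>
  have idx: "i * n + (u - 1) < n * n" using matrix_index_less ic u by simp
  have adj: "s (A 0 (i * n + (u - 1))) = of_bool (adj i (u - 1))"
    using s0 agreeD(2)[OF s] ic u by (simp add: step_store_def matrix_store_def)
  have dgn: "digit X ?d \<le> n" by (rule digit_le)
  have nd: "?D ?d = (if u = 0 then digit X ?d + of_bool (c' = c)
      else of_bool (i + 1 < u \<and> (digit X ?d \<noteq> 0 \<or> (c' = c \<and> adj i (u - 1)))))"
    using c' by (simp add: next_digit_def next_sig_def)
  have ndn: "?D d' \<le> n" if "d' < (n + 1) * k" for d' using next_digit_le X ic that by blast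
  have dl: "digits (n + 1) ?D (Suc ?d) < (n + 1) ^ Suc ?d"
    using ndn d by (intro digits_less) (simp add: less_Suc_eq_le)
  have pw: "(n + 1) ^ Suc ?d \<le> max_code" using d by (intro power_le_max_code) simp
  then have pw': "(n + 1) ^ ?d \<le> max_code" by (intro power_le_max_code) (use d in simp)
  have x_le: "digits (n + 1) ?D ?d + ?D ?d * (n + 1) ^ ?d < max_code"
    using dl pw by simp
  have XM: "X < max_code" using code_le X ic by simp
  have "X div (n + 1) ^ ?d \<le> X" by simp
  then have y: "X div (n + 1) ^ ?d < max_code" "X div (n + 1) ^ ?d div (n + 1) < max_code"
    using XM by (auto intro: le_less_trans[OF div_le_dividend])
  have B: "200 \<le> value_bound" "1 \<le> value_bound" "n + 1 \<le> value_bound" "n + 2 \<le> value_bound" "k \<le> value_bound"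
    "4 * max_code \<le> value_bound" "128 + 4 * (n * n) \<le> value_bound" "max_code \<le> value_bound"
    by (simp_all add: value_bound_def)
  have in_n: "i * n \<le> n * n" using ic by (intro mult_le_mono1) simp
  have yS: "X div (n + 1) ^ ?d div (n + 1) = X div (n + 1) ^ (u * k + Suc c')"
    by (simp only: add_Suc_right power_Suc2 div_mult2_eq)
  \<comment> \<open>\<open>v1\<close> to \<open>v7\<close> are the values stored by the seven
    assignments, in this order, and \<open>e1\<close> to \<open>e7\<close> express them through the
    values stored before.\<close>
  define v1 where "v1 = digit X ?d"
  define v2 where "v2 = X div (n + 1) ^ (u * k + Suc c')"
  define v3 where "v3 = (of_bool (H \<or> u = i + 1 \<and> c' = c \<and> digit X ?d \<noteq> 0) :: nat)"
  define v4 where "v4 = ?D ?d"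
  define v5 where "v5 = digits (n + 1) ?D (Suc ?d)"
  define v6 where "v6 = (n + 1) ^ Suc ?d"
  define v7 where "v7 = (of_bool (P \<and> ?D ?d \<noteq> 0) :: nat)"
  define y where "y = X div (n + 1) ^ ?d"
  define w where "w = (n + 1) ^ ?d"
  define z where "z = digits (n + 1) ?D ?d"
  have e1: "v1 = y mod (n + 1)" by (simp only: v1_def y_def digit_def)
  have e2: "v2 = y div (n + 1)" unfolding v2_def y_def by (rule yS[symmetric])
  have e5: "v5 = z + v4 * w" by (simp only: v5_def z_def v4_def w_def digits_simps)
  have e6: "v6 = w * (n + 1)" by (simp only: v6_def w_def power_Suc2)
  have e3: "v3 = of_bool (of_bool H \<noteq> (0::nat) \<or> (u = i + 1 \<and> c' = c) \<and> v1 \<noteq> 0)"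
    by (simp add: v3_def v1_def)
  have e4: "v4 = (if u = 0 then v1 + of_bool (c' = c)
      else of_bool (i + 1 < u \<and> (v1 \<noteq> 0 \<or> (c' = c \<and> of_bool (adj i (u - 1)) \<noteq> (0 :: nat)))))"
    unfolding v4_def v1_def nd by simp
  have e7: "v7 = of_bool (of_bool P \<noteq> (0::nat) \<and> v4 \<noteq> 0)"
    by (simp add: v7_def v4_def)
  have ps': "s (V 24) = y" "s (V 26) = w" "s (V 25) = z" "s (V 27) = of_bool H"
    using ps by (auto simp: partial_step_def y_def w_def z_def)
  have le: "v1 \<le> n" "v1 + 1 \<le> value_bound" "v1 \<le> value_bound" "v2 \<le> value_bound" "v3 \<le> 1" "v4 \<le> value_bound" "v5 \<le> value_bound"
     "v6 \<le> value_bound" "y \<le> value_bound" "w \<le> value_bound" "z \<le> value_bound" "v4 * w \<le> value_bound"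
     "z + v4 * w \<le> value_bound" "w * (n + 1) \<le> value_bound"
    using dgn ndn[OF d] x_le pw pw' y B yS unfolding v1_def v2_def v3_def v4_def v5_def v6_def y_def w_def z_def
    by (simp_all add: mult.commute)
  have i1: "i + 1 \<le> value_bound" "u \<le> value_bound" "c' \<le> value_bound" "c \<le> value_bound" "i \<le> value_bound"
    "n \<le> value_bound" "i * n \<le> value_bound" "i * n + (u - 1) \<le> value_bound" "u - 1 \<le> value_bound"
    "array_addr 0 (i * n + (u - 1)) \<le> value_bound"
    using ic u c' idx in_n B by (simp_all add: array_addr_def)
  have fin: "partial_step i c X (u * k + Suc c') (H \<or> u = i + 1 \<and> c' = c \<and> digit X ?d \<noteq> 0) s' \<longleftrightarrow>
      s' (V 24) = v2 \<and> s' (V 26) = v6 \<and> s' (V 25) = v5 \<and> s' (V 27) = v3" for s'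
    by (simp only: partial_step_def v2_def v6_def v5_def v3_def add_Suc_right)
  note ev = aval_exp aval.simps binop_val.simps fun_upd_apply loc.inject vals u(2) c'(2) adj ps' prod
  show ?thesis
    unfolding column_prog_def
    apply (rule reaches_Seq, rule reaches_assign_val[where v = v1, OF B(1)], simp, simp)
      apply (use B le in \<open>simp add: vals ps'\<close>)
     apply (simp add: vals ps' e1)
    apply (rule reaches_Seq, rule reaches_assign_val[where v = v2, OF B(1)], simp, simp)
      apply (use B le e2 in \<open>simp add: vals ps'\<close>)
     apply (simp add: vals ps' e2)
    apply (rule reaches_Seq, rule reaches_assign_val[where v = v3, OF B(1)], simp, simp)
      apply (use B le i1 in \<open>simp add: vals ps' u(2) c'(2)\<close>)
     apply (simp add: vals ps' u(2) c'(2) e3)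
    apply (rule reaches_Seq, rule reaches_assign_val[where v = v4, OF B(1)], simp, simp)
      apply (use B le i1 in \<open>simp add: vals ps' u(2) c'(2) adj[unfolded One_nat_def]\<close>)
     apply (simp only: ev loc.distinct refl if_True if_False num.inject num.distinct numeral_eq_iff e4) 
     apply (simp cong: if_cong)
    apply (rule reaches_Seq, rule reaches_assign_val[where v = v5, OF B(1)], simp, simp)
      apply (use B le in \<open>simp add: vals ps'\<close>)
     apply (simp add: ps' e5)
    apply (rule reaches_Seq, rule reaches_assign_val[where v = v6, OF B(1)], simp, simp)
      apply (use B le in \<open>simp add: vals ps'\<close>)
     apply (simp add: ps' vals e6)
    apply (rule reaches_assign_val[where v = v7, OF B(1)], simp, simp)
      apply (use B le in \<open>simp add: prod\<close>)
     apply (simp add: prod e7)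
    apply (simp only: fin v7_def[symmetric])
    apply (use s in \<open>simp add: agree_upd step_vars_def\<close>)
    done
qed

end

context coloring_dp
begin

lemma value_bound_ge:
  "200 \<le> value_bound" "1 \<le> value_bound" "n + 2 \<le> value_bound" "n \<le> value_bound" "k \<le> value_bound"
  "4 * max_code \<le> value_bound" "128 + 4 * max_code \<le> value_bound" "128 + 4 * ((n + 1) * k ^ n) \<le> value_bound"
  by (simp_all add: value_bound_def)

text \<open>The verdict after the first \<open>u\<close> rows: the conflict at vertex
  \<open>i\<close> is seen only once row \<open>i + 1\<close> has been passed. After all
  \<open>n + 1\<close> rows it is \<open>blocked\<close>.\<close>

definition row_blocked :: "nat \<Rightarrow> nat \<Rightarrow> nat \<Rightarrow> nat \<Rightarrow> bool" where
  "row_blocked i c X u \<longleftrightarrow> i + 1 < u \<and> digit X ((i + 1) * k + c) \<noteq> 0 \<or> (\<exists>u'<u. full_row i c X u')"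

lemma row_blocked_Suc:
  "row_blocked i c X (Suc u) \<longleftrightarrow>
    (row_blocked i c X u \<or> u = i + 1 \<and> digit X (u * k + c) \<noteq> 0) \<or> full_row i c X u"
  by (auto simp: row_blocked_def less_Suc_eq)

lemma row_blocked_n: "i < n \<Longrightarrow> row_blocked i c X (n + 1) \<longleftrightarrow> blocked i c X"
  by (auto simp: row_blocked_def blocked_def less_Suc_eq_le)

lemma reaches_row:
  assumes s0: "step_store i c X s0" and s: "agree step_vars s0 s" and u: "u \<le> n" "s (V 16) = u"
    and ps: "partial_step i c X (u * k) (row_blocked i c X u) s"
  shows "reaches xs value_bound row_prog s 0 (\<lambda>N s'. N \<le> 300 * (k + 1) \<and>
     agree step_vars s0 s' \<and> s' (V 16) = u \<and> s' (V 17) = s (V 17) \<and>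
     partial_step i c X (Suc u * k) (row_blocked i c X (Suc u)) s')"
proof -
  note B = value_bound_ge
  define y where "y = s (V 17)"
  \<comment> \<open>Within row \<open>u\<close>, after \<open>j\<close> columns: \<open>H\<close>
    has seen the conflict at color \<open>c\<close> only if \<open>c < j\<close>, and
    \<open>P\<close> says that the row may still turn out full.\<close>
  define H where "H j \<longleftrightarrow> row_blocked i c X u \<or> u = i + 1 \<and> c < j \<and> digit X (u * k + c) \<noteq> 0" for j
  define P where "P j \<longleftrightarrow> 0 < u \<and> (\<forall>c'<j. next_digit i c X (u * k + c') \<noteq> 0)" for j
  define I where "I j s' \<longleftrightarrow> agree step_vars s0 s' \<and> s' (V 16) = u \<and> s' (V 17) = y \<and>
     partial_step i c X (u * k + j) (H j) s' \<and> s' (V 28) = of_bool (P j)" for j s'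
  have H_Suc: "H j \<or> u = i + 1 \<and> j = c \<and> digit X (u * k + j) \<noteq> 0 \<longleftrightarrow> H (Suc j)" for j
    by (auto simp: H_def less_Suc_eq)
  have P_Suc: "P j \<and> next_digit i c X (u * k + j) \<noteq> 0 \<longleftrightarrow> P (Suc j)" for j
    by (auto simp: P_def less_Suc_eq)
  have c: "c < k" using s0 by (simp add: step_store_def)
  have vk: "s (V 1) = k" using s0 agreeD(1)[OF s] by (simp add: step_store_def matrix_store_def step_vars_def)
  show ?thesis
    unfolding row_prog_def
    apply (rule reaches_Seq, rule reaches_assign_val[where v = "of_bool (P 0)", OF B(1)], simp, simp)
      apply (use B u in simp)
     apply (simp add: P_def u)
    apply (rule reaches_Seq)
    apply (rule reaches_for_loop[where I = I and m = k and B = 250, OF B(1)])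
           apply simp
          apply (use B vk in simp)
         apply simp
        apply simp
       apply simp
      apply (use s ps u in \<open>simp add: I_def agree_upd step_vars_def y_def partial_step_def H_def\<close>)
  proof -
    fix j s'
    assume j: "j < k" and I: "I j s'" and xy: "s' (V 18) = j" "s' (V 19) = k - j"
    show "reaches xs value_bound column_prog s' 0 (\<lambda>N s''. N \<le> 250 \<and> s'' (V 18) = j \<and> s'' (V 19) = k - j \<and>
        I (Suc j) (s''(V 18 := Suc j, V 19 := k - Suc j)))"
    proof (rule reaches_mono[OF reaches_column[OF s0, where u = u and c' = j and H = "H j" and P = "P j"]], goal_cases)
      case (8 N s'')
      then show ?case
        using I xy unfolding H_Suc P_Suc
        by (simp add: I_def agree_upd step_vars_def partial_step_def)
    qed (use I j xy u in \<open>simp_all add: I_def\<close>)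
  next
    fix N s'
    assume N: "N \<le> esize (Var 1) + 4 + k * (250 + 9)" and I: "I k s'"
    show "reaches xs value_bound (assign 27 (or_exp (Var 27) (Var 28))) s' (0 + (esize (less_exp (Num 0) (Var 16)) + 1) + N)
       (\<lambda>N s'. N \<le> 300 * (k + 1) \<and> agree step_vars s0 s' \<and> s' (V 16) = u \<and> s' (V 17) = s (V 17) \<and>
          partial_step i c X (Suc u * k) (row_blocked i c X (Suc u)) s')"
    proof (rule reaches_assign_val[where v = "of_bool (row_blocked i c X (Suc u))", OF B(1)], goal_cases)
      case 4
      have "row_blocked i c X (Suc u) \<longleftrightarrow> H k \<or> P k"
        using c by (auto simp: row_blocked_Suc H_def P_def full_row_def)
      then show ?case using I by (simp add: I_def partial_step_def)
    next
      case 5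
      show ?case using I N by (simp add: I_def agree_upd step_vars_def y_def partial_step_def add.commute)
    qed (use I B in \<open>simp_all add: I_def partial_step_def\<close>)
  qed (use vk in simp)
qed

lemma reaches_step:
  assumes s: "step_store i c X s"
  shows "reaches xs value_bound step_prog s 0 (\<lambda>N s'. N \<le> 400 * ((k + 1) * (n + 2)) \<and>
     agree step_vars s s' \<and> s' (V 25) = next_code i c X \<and> s' (V 27) = of_bool (blocked i c X))"
proof -
  note B = value_bound_ge
  have i: "i < n" and X: "X < max_code" and v: "s (V 1) = k" "s (V 2) = n" "s (V 20) = X"
    using s code_le[of X i] by (auto simp: step_store_def matrix_store_def)
  define I where "I u s' \<longleftrightarrow> agree step_vars s s' \<and>
     partial_step i c X (u * k) (row_blocked i c X u) s'" for u s'
  show ?thesis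
    unfolding step_prog_def
    apply (rule reaches_Seq, rule reaches_assign_val[where v = X, OF B(1)], simp, simp)
      apply (use B X v in simp)
     apply (simp add: v)
    apply (rule reaches_Seq, rule reaches_assign_val[where v = 0, OF B(1)], simp, simp)
      apply simp
     apply simp
    apply (rule reaches_Seq, rule reaches_assign_val[where v = 1, OF B(1)], simp, simp)
      apply (use B in simp)
     apply simp
    apply (rule reaches_Seq, rule reaches_assign_val[where v = 0, OF B(1)], simp, simp)
      apply simp
     apply simp
    apply (rule reaches_for_loop[where I = I and m = "n + 1" and B = "300 * (k + 1)", OF B(1)])
           apply simp
          apply (use B v in simp)
         apply simp
        apply simp
       apply simp
      apply (simp add: I_def agree_upd step_vars_def agree_refl partial_step_def row_blocked_def)
  proof -
    fix u s'
    assume u: "u < n + 1" and I: "I u s'" and xy: "s' (V 16) = u" "s' (V 17) = n + 1 - u"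
    show "reaches xs value_bound row_prog s' 0 (\<lambda>N s''. N \<le> 300 * (k + 1) \<and> s'' (V 16) = u \<and>
        s'' (V 17) = n + 1 - u \<and> I (Suc u) (s''(V 16 := Suc u, V 17 := n + 1 - Suc u)))"
    proof (rule reaches_mono[OF reaches_row[OF s, where u = u]], goal_cases)
      case (5 N s'')
      then show ?case
        using xy by (simp add: I_def agree_upd step_vars_def partial_step_def)
    qed (use I u xy in \<open>simp_all add: I_def\<close>)
  next
    fix N s'
    assume N: "N \<le> esize (Bin Add (Var 2) (Num 1)) + 4 + (n + 1) * (300 * (k + 1) + 9)" and I: "I (n + 1) s'"
    have "(n + 1) * (300 * (k + 1) + 9) + 50 \<le> 400 * ((k + 1) * (n + 2))"
      by (simp add: algebra_simps)
    then have "0 + (esize (Var 20) + 1) + (esize (Num 0) + 1) + (esize (Num 1) + 1) + (esize (Num 0) + 1) + N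
       \<le> 400 * ((k + 1) * (n + 2))"
      using N by simp
    then show "0 + (esize (Var 20) + 1) + (esize (Num 0) + 1) + (esize (Num 1) + 1) + (esize (Num 0) + 1) + N
         \<le> 400 * ((k + 1) * (n + 2)) \<and>
       agree step_vars s s' \<and> s' (V 25) = next_code i c X \<and> s' (V 27) = of_bool (blocked i c X)"
      using I unfolding I_def partial_step_def row_blocked_n[OF i] next_code_def by simp
  qed (use v in simp)
qed

end

section \<open>Queue and dictionary: one stage of the dynamic program\<close>

definition enqueue_prog :: prog where
  "enqueue_prog = if_then_else (Arr 3 (Var 25)) Skip
     (Seq (assign_array 2 (Var 23) (Var 25)) (assign 23 (Bin Add (Var 23) (Num 1))))"

definition count_prog :: prog where
  "count_prog = assign_array 3 (Var 25) (Bin Add (Arr 3 (Var 25)) (Var 21))"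

definition color_prog :: prog where
  "color_prog = Seq step_prog (if_then_else (Var 27) Skip (Seq enqueue_prog count_prog))"

definition entry_prog :: prog where
  "entry_prog = Seq (assign 20 (Arr 2 (Var 22)))
     (Seq (assign 21 (Arr 3 (Var 20)))
     (Seq (assign 22 (Bin Add (Var 22) (Num 1)))
          (for_loop 14 15 (Var 1) color_prog)))"

text \<open>The number of iterations is fixed at the start, so signatures enqueued during the stage
  are left to the next one.\<close>

definition stage_prog :: prog where
  "stage_prog = for_loop 12 13 (Bin Sub (Var 23) (Var 22)) entry_prog"

definition agree_scalars :: "nat set \<Rightarrow> store \<Rightarrow> store \<Rightarrow> bool" where
  "agree_scalars T s s' \<longleftrightarrow> (\<forall>x. x \<notin> T \<longrightarrow> s' (V x) = s (V x))"

lemma agree_scalarsD: "agree_scalars T s s' \<Longrightarrow> x \<notin> T \<Longrightarrow> s' (V x) = s (V x)"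
  by (simp add: agree_scalars_def)

lemma agree_scalars_refl: "agree_scalars T s s"
  by (simp add: agree_scalars_def)

lemma agree_scalars_upd:
  "x \<in> T \<Longrightarrow> agree_scalars T s (s'(V x := v)) \<longleftrightarrow> agree_scalars T s s'"
  "agree_scalars T s (s'(A r j := v)) \<longleftrightarrow> agree_scalars T s s'"
  by (auto simp: agree_scalars_def)

lemma agree_scalars_trans:
  "agree_scalars T s s' \<Longrightarrow> agree_scalars T' s' s'' \<Longrightarrow> T \<subseteq> U \<Longrightarrow> T' \<subseteq> U \<Longrightarrow> agree_scalars U s s''"
  unfolding agree_scalars_def by (metis subsetD)

context coloring_dp
begin

lemma card_reached_le: "i < n \<or> i \<le> n \<and> Z = {} \<Longrightarrow> card (reached i Z) \<le> (n + 1) * k ^ n"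
proof -
  assume i: "i < n \<or> i \<le> n \<and> Z = {}"
  have "reached i Z \<subseteq> (\<Union>j\<le>n. viable j)"
  proof (cases "i < n")
    case True
    then have "{..Suc i} \<subseteq> {..n}" by simp
    then show ?thesis by (rule subset_trans[OF reached_subset UN_mono[OF _ subset_refl]])
  next
    case False
    then show ?thesis using i by (auto simp: reached_def)
  qed
  then have "card (reached i Z) \<le> card (\<Union>j\<le>n. viable j)"
    by (rule card_mono[rotated]) simp
  also have "\<dots> \<le> (\<Sum>j\<le>n. card (viable j))" by (rule card_UN_le) simp
  also have "\<dots> \<le> (\<Sum>j\<le>n. k ^ n)"
  proof (rule sum_mono)
    fix j assume "j \<in> {..n}"
    have "card (viable j) \<le> card {cs. set cs \<subseteq> {..<k} \<and> length cs = j}"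
      by (intro card_mono finite_lists_length_eq) (auto simp: viable_def)
    also have "\<dots> = k ^ j" by (simp add: card_lists_length_eq)
    also have "\<dots> \<le> k ^ n" using k_pos \<open>j \<in> {..n}\<close> by (intro power_increasing) auto
    finally show "card (viable j) \<le> k ^ n" .
  qed
  finally show ?thesis by simp
qed

lemma tab_le: "i < n \<or> i \<le> n \<and> Z = {} \<Longrightarrow> tab (reached i Z) x \<le> (n + 1) * k ^ n"
  using card_mono[of "reached i Z" "{cs \<in> reached i Z. code cs = x}"] card_reached_le[of i Z]
  unfolding tab_def by simp

text \<open>Signatures of different stages differ, so the queue entries gained during stage
  \<open>i\<close> are exactly the signatures of stage \<open>i + 1\<close>.\<close>

lemma codes_new:
  assumes "Suc i \<le> n"
  shows "code ` reached (Suc i) {} - code ` reached i {} = code ` viable (Suc i)"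
proof -
  have "code cs \<noteq> code cs'" if "cs \<in> viable (Suc i)" "j \<le> i" "cs' \<in> viable j" for cs cs' j
    using code_length_eq[OF that(1,3)] assms that(2) by force
  then have "code ` viable (Suc i) \<inter> code ` reached i {} = {}"
    unfolding reached_def by blast
  moreover have "reached (Suc i) {} = reached i {} \<union> viable (Suc i)"
    by (auto simp: reached_def atMost_Suc)
  ultimately show ?thesis by (simp add: image_Un Un_Diff) blast
qed

text \<open>\<open>Q\<close> is the queue since the very beginning: signatures of earlier stages
  stay in it, and only the read position in scalar \<open>22\<close> moves past them.\<close>

definition dp_store :: "nat \<Rightarrow> (nat \<times> nat) set \<Rightarrow> nat list \<Rightarrow> store \<Rightarrow> bool" where
  "dp_store i Z Q s \<longleftrightarrow> matrix_store s \<and> (\<forall>x. s (A 3 x) = tab (reached i Z) x) \<and>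
     s (V 23) = length Q \<and> (\<forall>j<length Q. s (A 2 j) = Q ! j) \<and> distinct Q \<and> set Q = code ` reached i Z"

lemma dp_store_length: "dp_store i Z Q s \<Longrightarrow> i < n \<or> i \<le> n \<and> Z = {} \<Longrightarrow> length Q \<le> (n + 1) * k ^ n"
  using card_image_le[of "reached i Z" code] card_reached_le[of i Z]
  by (simp add: dp_store_def flip: distinct_card)

lemma dp_store_upd: "x \<notin> {1, 2, 23, 31} \<Longrightarrow> dp_store i Z Q (s(V x := v)) \<longleftrightarrow> dp_store i Z Q s"
  by (auto simp: dp_store_def matrix_store_def)

lemma dp_store_agree: "dp_store i Z Q s \<Longrightarrow> agree step_vars s s' \<Longrightarrow> dp_store i Z Q s'"
  by (simp add: dp_store_def matrix_store_def agree_def step_vars_def)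

lemma reaches_color:
  assumes s: "dp_store i Z Q s" "s (V 10) = i" "s (V 14) = c" "s (V 20) = X" "s (V 21) = card {cs \<in> viable i. code cs = X}"
    and i: "i < n" and c: "c < k" and X: "X \<in> code ` viable i" and Z: "(X, c) \<notin> Z"
  shows "reaches xs value_bound color_prog s 0 (\<lambda>N s'. N \<le> 500 * ((k + 1) * (n + 2)) \<and>
     agree_scalars (insert 23 step_vars) s s' \<and> (\<exists>new. dp_store i (insert (X, c) Z) (Q @ new) s'))"
proof -
  note B = value_bound_ge
  let ?Y = "next_code i c X"
  let ?T = "(k + 1) * (n + 2)"
  have T: "2 \<le> ?T" by simp
  have st: "step_store i c X s" using s i c X by (simp add: step_store_def dp_store_def)
  have cnt: "s (V 21) = tab (reached i Z) X" using tab_reached[OF X] i s(5) by simp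
  have tabM: "4 * tab (reached i Z') x + 128 \<le> value_bound" for Z' x
    using tab_le[of i Z' x] i B(8) by linarith
  show ?thesis
    unfolding color_prog_def
  proof (rule reaches_Seq, rule reaches_mono[OF reaches_step[OF st]])
    fix N s1
    assume 1: "N \<le> 400 * ?T \<and> agree step_vars s s1 \<and> s1 (V 25) = ?Y \<and> s1 (V 27) = of_bool (blocked i c X)"
    then have dp1: "dp_store i Z Q s1" and as1: "agree_scalars (insert 23 step_vars) s s1"
      using dp_store_agree[OF s(1)] by (auto simp: agree_def agree_scalars_def)
    have v1: "s1 (V 21) = tab (reached i Z) X" "s1 (V 23) = length Q" "s1 (V 25) = ?Y"
      using 1 cnt dp1 by (auto simp: agree_def step_vars_def dp_store_def)
    let ?Q = "\<lambda>N s'. N \<le> 500 * ?T \<and> agree_scalars (insert 23 step_vars) s s' \<and>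
          (\<exists>new. dp_store i (insert (X, c) Z) (Q @ new) s')"
    show "reaches xs value_bound (if_then_else (Var 27) Skip (Seq enqueue_prog count_prog)) s1 (0 + N) ?Q"
    proof (cases "blocked i c X")
      case True
      then have "dp_store i (insert (X, c) Z) (Q @ []) s1"
        using dp1 reached_insert_blocked[OF True c i] by (simp add: dp_store_def)
      then have ex: "\<exists>new. dp_store i (insert (X, c) Z) (Q @ new) s1" by blast
      have v27: "s1 (V 27) = 1" using 1 True by simp
      show ?thesis
      proof (rule reaches_if_then_else, goal_cases)
        case 3
        have "0 + N + esize (Var 27) + 1 + 1 \<le> 500 * ?T" using 1 T by simp
        then show ?case using ex as1 by (intro reaches_Skip[OF B(1)]) blast
      qed (use v27 B in simp_all)
    next
      case False
      note ins = reached_insert[OF X c i False Z]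
      have t3: "s1 (A 3 ?Y) = tab (reached i Z) ?Y" using dp1 by (simp add: dp_store_def)
      have "?Y \<in> code ` reached i (insert (X, c) Z)" using ins(1) by simp
      then obtain cs where cs: "cs \<in> reached i (insert (X, c) Z)" "?Y = code cs" by blast
      then have "length cs \<le> n" using reached_subset[of i "insert (X, c) Z"] i viable_length by fastforce
      then have YM: "?Y < max_code" using code_less cs(2) by (simp add: max_code_def)
      have new_tab: "tab (reached i Z) ?Y + tab (reached i Z) X = tab (reached i (insert (X, c) Z)) ?Y"
        unfolding ins(2) by simp
      have fits1: "array_addr 3 ?Y \<le> value_bound" "?Y \<le> value_bound"
        using YM B(7) by (simp_all add: array_addr_def)
      have fin: "dp_store i (insert (X, c) Z) (Q @ new) (s2(A 3 ?Y := tab (reached i Z) ?Y + tab (reached i Z) X))"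
        if "new = (if ?Y \<in> code ` reached i Z then [] else [?Y])"
          "\<And>x. s2 (A 3 x) = s1 (A 3 x)" "\<And>j. s2 (A 0 j) = s1 (A 0 j)"
          "s2 (V 1) = s1 (V 1)" "s2 (V 2) = s1 (V 2)" "s2 (V 31) = s1 (V 31)" "s2 (V 23) = length (Q @ new)"
          "\<And>j. j < length (Q @ new) \<Longrightarrow> s2 (A 2 j) = (Q @ new) ! j" for new s2
      proof -
        have "distinct (Q @ new)" "set (Q @ new) = code ` reached i (insert (X, c) Z)"
          using dp1 ins(1) that(1) by (auto simp: dp_store_def)
        moreover have "matrix_store s2" using dp1 that(3-6) by (simp add: dp_store_def matrix_store_def)
        moreover have "s2 (A 3 x) = tab (reached i Z) x" for x
          using dp1 that(2) by (simp add: dp_store_def)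
        ultimately show ?thesis
          using that(7,8) unfolding dp_store_def ins(2) matrix_store_def by simp
      qed
      have ev27: "aval xs s1 (Var 27) = 0" using 1 False by simp
      have last: "reaches xs value_bound count_prog s2 N2 ?Q"
        if "new = (if ?Y \<in> code ` reached i Z then [] else [?Y])"
          "\<And>x. s2 (A 3 x) = s1 (A 3 x)" "\<And>j. s2 (A 0 j) = s1 (A 0 j)" "\<And>x. x \<noteq> 23 \<Longrightarrow> s2 (V x) = s1 (V x)"
          "s2 (V 23) = length (Q @ new)"
          "\<And>j. j < length (Q @ new) \<Longrightarrow> s2 (A 2 j) = (Q @ new) ! j"
          "N2 \<le> N + 30" for new s2 N2
        unfolding count_prog_def
      proof (rule reaches_assign_array[OF B(1)], goal_cases)
        case 4
        show ?case using fits1 v1 that(4) by simp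
      next
        case 5
        show ?case using fits1 v1 that(2,4) t3 tabM[of Z] tabM[of "insert (X, c) Z" ?Y] new_tab
          by (simp add: trans_le_add1)
      next
        case 6
        show ?case using fits1 v1 that(4) by simp
      next
        case 7
        have "dp_store i (insert (X, c) Z) (Q @ new) (s2(A 3 (aval xs s2 (Var 25)) := aval xs s2 (Bin Add (Arr 3 (Var 25)) (Var 21))))"
          using fin[OF that(1-3) _ _ _ that(5,6)] v1 that(2,4) t3 by simp
        moreover have "agree_scalars (insert 23 step_vars) s s2"
          using as1 that(4) by (auto simp: agree_scalars_def)
        moreover have "N2 + esize (Var 25) + esize (Bin Add (Arr 3 (Var 25)) (Var 21)) + 3 \<le> 500 * ?T"
          using that(7) 1 T by simp
        ultimately show ?case by (auto simp: agree_scalars_upd)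
      qed simp_all
      show ?thesis
      proof (rule reaches_if_then_else)
        show "wf_exp 64 (Var 27)" "fits xs s1 value_bound (Var 27)" using ev27 by simp_all
        show "aval xs s1 (Var 27) \<noteq> 0 \<Longrightarrow> reaches xs value_bound Skip s1 (0 + N + esize (Var 27) + 1) ?Q"
          using ev27 by simp
        show "reaches xs value_bound (Seq enqueue_prog count_prog) s1 (0 + N + esize (Var 27) + 1) ?Q"
          unfolding enqueue_prog_def
        proof (rule reaches_Seq, rule reaches_if_then_else, goal_cases)
          case 1
          show ?case by simp
        next
          case 2
          show ?case using fits1 v1 t3 tabM[of Z ?Y] by simp
        next
          case 3
          then have "?Y \<in> code ` reached i Z" using tab_eq_0_iff[of "reached i Z" ?Y] v1 t3 by simp
          then show ?case
            using dp1 by (intro reaches_Skip[OF B(1)] last[of "[]"]) (simp_all add: dp_store_def)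
        next
          case 4
          then have nin: "?Y \<notin> code ` reached i Z" using tab_eq_0_iff[of "reached i Z" ?Y] v1 t3 by simp
          let ?s2 = "s1(A 2 (length Q) := ?Y)"
          let ?s3 = "?s2(V 23 := length Q + 1)"
          have "matrix_store ?s3" using dp1 by (simp add: dp_store_def matrix_store_def)
          \<comment> \<open>The extended queue lists distinct codes of reached colorings, so their
            number bounds the address that is about to be written.\<close>
          have "distinct (Q @ [?Y])" "set (Q @ [?Y]) = code ` reached i (insert (X, c) Z)"
            using dp1 ins(1) nin by (auto simp: dp_store_def)
          then have "length (Q @ [?Y]) = card (code ` reached i (insert (X, c) Z))"
            by (metis distinct_card)
          then have "length Q + 1 \<le> (n + 1) * k ^ n"
            using card_image_le[of "reached i (insert (X, c) Z)" code] card_reached_le[of i "insert (X, c) Z"] i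
            by simp
          then have len: "array_addr 2 (length Q) \<le> value_bound" "length Q + 1 \<le> value_bound"
            using B(8) by (simp_all add: array_addr_def)
          show ?case
            apply (rule reaches_Seq)
            apply (rule reaches_assign_array[OF B(1)])
                  apply simp
                 apply simp
                apply simp
               apply (use v1 len in simp)
              apply (use v1 fits1 in simp)
             apply (use v1 len in simp)
            apply (rule reaches_assign_val[where v = "length Q + 1", OF B(1)], simp, simp)
              apply (use v1 len B in simp)
             apply (use v1 in simp)
            apply (rule last[of "[?Y]"])
                  apply (use v1 nin dp1 in \<open>auto simp: dp_store_def nth_append\<close>)
            done
        qed
      qed
    qed
  qed
qed

lemma reaches_entry:
  assumes s: "dp_store i Z Q s" "s (V 10) = i" "s (V 22) = h"
    and i: "i < n" and h: "h < length Q" and X: "Q ! h \<in> code ` viable i" and Z: "\<And>c. (Q ! h, c) \<notin> Z"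
  shows "reaches xs value_bound entry_prog s 0 (\<lambda>N s'. N \<le> 600 * ((k + 1) * ((k + 1) * (n + 2))) \<and>
     agree_scalars ({14, 15, 20, 21, 22, 23} \<union> step_vars) s s' \<and> s' (V 22) = h + 1 \<and>
     (\<exists>new. dp_store i ({Q ! h} \<times> {..<k} \<union> Z) (Q @ new) s'))"
proof -
  note B = value_bound_ge
  let ?X = "Q ! h"
  let ?T = "(k + 1) * (n + 2)"
  let ?F = "{14, 15, 20, 21, 22, 23} \<union> step_vars"
  define m where "m = card {cs \<in> viable i. code cs = ?X}"
  have m: "s (A 3 ?X) = m" using s(1) tab_reached[OF X] i by (simp add: dp_store_def m_def)
  have mM: "m \<le> value_bound" using tab_le[of i Z ?X] s(1) m i B(8) by (simp add: dp_store_def)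
  have X_lt: "?X < max_code" using code_le[OF X] i by simp
  have q: "s (A 2 h) = ?X" and vk: "s (V 1) = k" using s(1) h by (simp_all add: dp_store_def matrix_store_def)
  have hM: "array_addr 2 h \<le> value_bound" "h + 1 \<le> value_bound"
    using dp_store_length[OF s(1)] i h B(8) by (simp_all add: array_addr_def)
  have XM: "array_addr 3 ?X \<le> value_bound" "?X \<le> value_bound"
    using X_lt B(7) by (simp_all add: array_addr_def)
  define I where "I c s' \<longleftrightarrow> agree_scalars ?F s s' \<and> s' (V 22) = h + 1 \<and> s' (V 20) = ?X \<and> s' (V 21) = m \<and>
     (\<exists>new. dp_store i ({?X} \<times> {..<c} \<union> Z) (Q @ new) s')" for c s'
  have T: "1 \<le> ?T" by simp
  show ?thesis
    unfolding entry_prog_def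
    apply (rule reaches_Seq, rule reaches_assign_val[where v = ?X, OF B(1)], simp, simp)
      apply (use s q hM XM in simp)
     apply (use s q in simp)
    apply (rule reaches_Seq, rule reaches_assign_val[where v = m, OF B(1)], simp, simp)
      apply (use m mM XM in simp)
     apply (use m in simp)
    apply (rule reaches_Seq, rule reaches_assign_val[where v = "h + 1", OF B(1)], simp, simp)
      apply (use s hM B in simp)
     apply (use s in simp)
    apply (rule reaches_for_loop[where I = I and m = k and B = "500 * ?T", OF B(1)])
           apply simp
          apply (use B vk in simp)
         apply simp
        apply simp
       apply simp
      apply (use s(1) in \<open>auto simp: I_def agree_scalars_upd agree_scalars_refl dp_store_upd intro!: exI[of _ "[]"]\<close>)[1]
  proof -
    fix c s'
    assume c: "c < k" and I: "I c s'" and xy: "s' (V 14) = c" "s' (V 15) = k - c"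
    obtain new where new: "dp_store i ({?X} \<times> {..<c} \<union> Z) (Q @ new) s'" using I by (auto simp: I_def)
    have v10: "s' (V 10) = i" using I s(2) agree_scalarsD[of ?F s s' 10] by (simp add: I_def step_vars_def)
    show "reaches xs value_bound color_prog s' 0 (\<lambda>N s''. N \<le> 500 * ?T \<and> s'' (V 14) = c \<and> s'' (V 15) = k - c \<and>
        I (Suc c) (s''(V 14 := Suc c, V 15 := k - Suc c)))"
    proof (rule reaches_mono[OF reaches_color[OF new v10 xy(1), of ?X]], goal_cases)
      case (7 N s'')
      have ag: "agree_scalars (insert 23 step_vars) s' s''" and N: "N \<le> 500 * ?T" using 7 by simp_all
      obtain new' where new': "dp_store i (insert (?X, c) ({?X} \<times> {..<c} \<union> Z)) ((Q @ new) @ new') s''"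
        using 7 by blast
      have "insert (?X, c) ({?X} \<times> {..<c} \<union> Z) = {?X} \<times> {..<Suc c} \<union> Z" by (auto simp: less_Suc_eq)
      then have "\<exists>new. dp_store i ({?X} \<times> {..<Suc c} \<union> Z) (Q @ new) s''" using new' by auto
      moreover have "s'' (V x) = s' (V x)" if "x \<in> {14, 15, 20, 21, 22}" for x
        using agree_scalarsD[OF ag, of x] that by (auto simp: step_vars_def)
      moreover have "agree_scalars ?F s s''"
        using I by (intro agree_scalars_trans[OF _ ag, of ?F s]) (auto simp: I_def)
      ultimately show ?case
        using I N xy by (simp add: I_def agree_scalars_upd dp_store_upd)
    qed (use I c i X Z in \<open>auto simp: I_def m_def\<close>)
  next
    fix N s'
    assume N: "N \<le> esize (Var 1) + 4 + k * (500 * ?T + 9)" and I: "I k s'"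
    have "k * (500 * ?T + 9) + 30 \<le> 600 * ((k + 1) * ?T)"
      by (simp add: algebra_simps)
    then show "0 + (esize (Arr 2 (Var 22)) + 1) + (esize (Arr 3 (Var 20)) + 1) + (esize (Bin Add (Var 22) (Num 1)) + 1) + N
       \<le> 600 * ((k + 1) * ?T) \<and>
       agree_scalars ?F s s' \<and> s' (V 22) = h + 1 \<and> (\<exists>new. dp_store i ({?X} \<times> {..<k} \<union> Z) (Q @ new) s')"
      using I N by (simp add: I_def)
  qed (use vk in simp)
qed

text \<open>\<open>ps\<close> is the part of the queue read in earlier stages and \<open>rs\<close>
  the part due now. The extra \<open>+ 1\<close> in the time bound pays for setting up the
  loop.\<close>

lemma reaches_stage:
  assumes s: "dp_store i {} (ps @ rs) s" "s (V 10) = i" "s (V 22) = length ps"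
    and i: "i < n" and rs: "set rs = code ` viable i"
  shows "reaches xs value_bound stage_prog s 0 (\<lambda>N s'.
     N \<le> (card (code ` viable i) + 1) * (700 * ((k + 1) * ((k + 1) * (n + 2)))) \<and>
     s' (V 10) = i \<and> s' (V 11) = s (V 11) \<and>
     (\<exists>ps' rs'. dp_store (Suc i) {} (ps' @ rs') s' \<and> s' (V 22) = length ps' \<and> set rs' = code ` viable (Suc i)))"
proof -
  note B = value_bound_ge
  let ?Q = "ps @ rs"
  let ?F = "{12, 13, 14, 15, 20, 21, 22, 23} \<union> step_vars"
  let ?T = "(k + 1) * ((k + 1) * (n + 2))"
  have dist: "distinct ?Q" and v23: "s (V 23) = length ?Q" using s(1) by (simp_all add: dp_store_def)
  have len: "length ?Q \<le> value_bound" using dp_store_length[OF s(1)] i B(8) by simp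
  have card: "card (code ` viable i) = length rs" using dist rs distinct_card[of rs] by simp
  define Z where "Z j = set (take j rs) \<times> {..<k}" for j
  define I where "I j s' \<longleftrightarrow> agree_scalars ?F s s' \<and> s' (V 22) = length ps + j \<and>
     (\<exists>new. dp_store i (Z j) (?Q @ new) s')" for j s'
  have T: "2 \<le> ?T" by simp
  show ?thesis
    unfolding stage_prog_def
    apply (rule reaches_for_loop[where I = I and m = "length rs" and B = "600 * ?T", OF B(1)])
           apply simp
          apply (use len v23 s in simp)
         apply simp
        apply simp
       apply simp
      apply (use s in \<open>auto simp: I_def Z_def agree_scalars_upd agree_scalars_refl dp_store_upd intro!: exI[of _ "[]"]\<close>)[1]
  proof -
    fix j s'
    assume j: "j < length rs" and I: "I j s'" and xy: "s' (V 12) = j" "s' (V 13) = length rs - j"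
    obtain new where new: "dp_store i (Z j) (?Q @ new) s'" using I by (auto simp: I_def)
    have v10: "s' (V 10) = i" using I s(2) agree_scalarsD[of ?F s s' 10] by (simp add: I_def step_vars_def)
    have v22: "s' (V 22) = length ps + j" using I by (simp add: I_def)
    have nth: "(?Q @ new) ! (length ps + j) = rs ! j" using j by (simp add: nth_append)
    show "reaches xs value_bound entry_prog s' 0 (\<lambda>N s''. N \<le> 600 * ?T \<and> s'' (V 12) = j \<and> s'' (V 13) = length rs - j \<and>
        I (Suc j) (s''(V 12 := Suc j, V 13 := length rs - Suc j)))"
    proof (rule reaches_mono[OF reaches_entry[OF new v10 v22 i]], goal_cases)
      case 1
      then show ?case using j by simp
    next
      case 2
      then show ?case unfolding nth using rs nth_mem[OF j] by simp
    next
      case (3 c)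
      have "rs ! j \<notin> set (take j rs)"
        using dist j by (auto simp: in_set_conv_nth nth_eq_iff_index_eq)
      then show ?case unfolding nth by (simp add: Z_def)
    next
      case (4 N s'')
      have ag: "agree_scalars ({14, 15, 20, 21, 22, 23} \<union> step_vars) s' s''" and N: "N \<le> 600 * ?T"
        and v: "s'' (V 22) = length ps + j + 1" using 4 by simp_all
      obtain new' where new': "dp_store i ({rs ! j} \<times> {..<k} \<union> Z j) ((?Q @ new) @ new') s''"
        using 4 unfolding nth by blast
      have "{rs ! j} \<times> {..<k} \<union> Z j = Z (Suc j)" using j by (auto simp: Z_def take_Suc_conv_app_nth)
      then have "\<exists>new. dp_store i (Z (Suc j)) (?Q @ new) s''" using new' by auto
      moreover have "s'' (V x) = s' (V x)" if "x \<in> {12, 13}" for x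
        using agree_scalarsD[OF ag, of x] that by (auto simp: step_vars_def)
      moreover have "agree_scalars ?F s s''"
        using I by (intro agree_scalars_trans[OF _ ag, of ?F s]) (auto simp: I_def)
      ultimately show ?case
        using N v xy by (simp add: I_def agree_scalars_upd dp_store_upd)
    qed
  next
    fix N s'
    assume N: "N \<le> esize (Bin Sub (Var 23) (Var 22)) + 4 + length rs * (600 * ?T + 9)" and I: "I (length rs) s'"
    obtain new where new: "dp_store i (Z (length rs)) (?Q @ new) s'" using I by (auto simp: I_def)
    have re: "reached i (Z (length rs)) = reached (Suc i) {}"
      using rs i by (intro reached_Suc) (auto simp: Z_def)
    then have dp: "dp_store (Suc i) {} (?Q @ new) s'"
      using new by (simp add: dp_store_def)
    have "set new = code ` viable (Suc i)"
    proof -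
      have "set (?Q @ new) = code ` reached (Suc i) {}" "distinct (?Q @ new)" using dp by (simp_all add: dp_store_def)
      moreover have "set ?Q = code ` reached i {}" using s(1) by (simp add: dp_store_def)
      ultimately have "set new = code ` reached (Suc i) {} - code ` reached i {}" by auto
      then show ?thesis using codes_new i by simp
    qed
    moreover have "s' (V 22) = length ?Q" using I by (simp add: I_def)
    moreover have "s' (V 10) = i" "s' (V 11) = s (V 11)"
      using I s(2) agree_scalarsD[of ?F s s'] by (simp_all add: I_def step_vars_def)
    moreover have "esize (Bin Sub (Var 23) (Var 22)) + 4 + length rs * (600 * ?T + 9) \<le> (length rs + 1) * (700 * ?T)"
    proof -
      have "7 + l * (600 * t + 9) \<le> (l + 1) * (700 * t)" if "2 \<le> t" for l t :: nat
      proof -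
        have "l * (600 * t + 9) \<le> l * (700 * t)" using that by (intro mult_le_mono2) linarith
        moreover have "(l + 1) * (700 * t) = l * (700 * t) + 700 * t" by simp
        ultimately show ?thesis using that by linarith
      qed
      from this[OF T, of "length rs"] show ?thesis by simp
    qed
    ultimately show "0 + N \<le> (card (code ` viable i) + 1) * (700 * ?T) \<and> s' (V 10) = i \<and> s' (V 11) = s (V 11) \<and>
     (\<exists>ps' rs'. dp_store (Suc i) {} (ps' @ rs') s' \<and> s' (V 22) = length ps' \<and> set rs' = code ` viable (Suc i))"
      using dp N card by (intro conjI exI[of _ ?Q] exI[of _ new]) simp_all
  qed (use v23 s in simp)
qed

end

section \<open>Summation over the balanced signatures\<close>

definition size_prog :: prog where
  "size_prog = Seq (assign 29 (mod_exp (Var 24) (Var 31)))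
    (Seq (assign 24 (Bin Div (Var 24) (Var 31)))
    (Seq (assign 32 (max_exp (Var 32) (Var 29)))
         (assign 33 (min_exp (Var 33) (Var 29)))))"

definition add_prog :: prog where
  "add_prog = Seq (assign 0 (Bin Add (Var 0)
       (if_exp (less_exp (Bin Add (Var 33) (Num 1)) (Var 32)) (Num 0) (Arr 3 (Var 20)))))
     (assign 22 (Bin Add (Var 22) (Num 1)))"

definition sum_prog :: prog where
  "sum_prog = Seq (assign 20 (Arr 2 (Var 22)))
    (Seq (assign 24 (Var 20))
    (Seq (assign 32 (Num 0))
    (Seq (assign 33 (Var 2))
    (Seq (for_loop 14 15 (Var 1) size_prog) add_prog))))"

text \<open>The empty coloring has code \<open>0\<close>: the queue starts with the entry
  \<open>0\<close> and the dictionary with count \<open>1\<close> in cell \<open>0\<close>.\<close>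

definition dp_prog :: prog where
  "dp_prog = Seq (assign 31 (Bin Add (Var 2) (Num 1)))
    (Seq (assign 22 (Num 0))
    (Seq (assign 23 (Num 1))
    (Seq (assign_array 2 (Num 0) (Num 0))
    (Seq (assign_array 3 (Num 0) (Num 1))
    (Seq (for_loop 10 11 (Var 2) stage_prog)
    (Seq (assign 0 (Num 0))
         (for_loop 12 13 (Bin Sub (Var 23) (Var 22)) sum_prog)))))))"

context coloring_dp
begin

text \<open>Running maximum and minimum of the class sizes, which are the \<open>k\<close> lowest
  digits. The exceptions \<open>a = 0\<close> and \<open>b = n\<close> are the initial values, which
  need not be attained.\<close>

definition extremes :: "nat \<Rightarrow> nat \<Rightarrow> nat \<Rightarrow> nat \<Rightarrow> bool" where
  "extremes X j a b \<longleftrightarrow> (\<forall>c<j. digit X c \<le> a) \<and> (a = 0 \<or> (\<exists>c<j. digit X c = a)) \<and>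
     (\<forall>c<j. b \<le> digit X c) \<and> (b = n \<or> (\<exists>c<j. digit X c = b))"

lemma extremes_le: "extremes X j a b \<Longrightarrow> a \<le> n \<and> b \<le> n"
  unfolding extremes_def using digit_le by fastforce

lemma extremes_Suc: "extremes X j a b \<Longrightarrow> extremes X (Suc j) (max a (digit X j)) (min b (digit X j))"
  unfolding extremes_def by (auto simp: less_Suc_eq max_def min_def)

lemma extremes_balanced: "extremes X k a b \<Longrightarrow> b + 1 < a \<longleftrightarrow> \<not> balanced X"
proof -
  assume e: "extremes X k a b"
  show ?thesis
  proof
    assume ab: "b + 1 < a"
    then obtain c where c: "c < k" "digit X c = a" using e by (auto simp: extremes_def)
    \<comment> \<open>Since \<open>b + 1 < a\<close> and \<open>a <= n\<close>, neither value is an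
      initial one, so both are sizes of actual classes.\<close>
    have "b \<noteq> n" using ab extremes_le[OF e] by simp
    then obtain c' where "c' < k" "digit X c' = b" using e by (auto simp: extremes_def)
    then show "\<not> balanced X" using c ab unfolding balanced_def by fastforce
  next
    assume "\<not> balanced X"
    then obtain c c' where "c < k" "c' < k" "digit X c' + 1 < digit X c" by (auto simp: balanced_def)
    then show "b + 1 < a" using e unfolding extremes_def by fastforce
  qed
qed

lemma reaches_size:
  assumes s: "matrix_store s" "s (V 24) = X div (n + 1) ^ j" "s (V 32) = a" "s (V 33) = b"
    and ab: "extremes X j a b" and X: "X < max_code"
  shows "reaches xs value_bound size_prog s 0 (\<lambda>N s'. N \<le> 60 \<and>
     s' = s(V 29 := digit X j, V 24 := X div (n + 1) ^ Suc j, V 32 := max a (digit X j), V 33 := min b (digit X j)))"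
proof -
  note B = value_bound_ge
  define y where "y = X div (n + 1) ^ j"
  define d where "d = digit X j"
  define y' where "y' = X div (n + 1) ^ Suc j"
  have d: "d = y mod (n + 1)" by (simp only: d_def y_def digit_def)
  have y': "y' = y div (n + 1)" by (simp only: y_def y'_def power_Suc2 div_mult2_eq)
  have "y \<le> X" by (simp add: y_def)
  then have y_le: "y \<le> value_bound" using X B(6) by linarith
  then have y'_le: "y' \<le> value_bound" unfolding y' by (rule le_trans[OF div_le_dividend])
  have le: "a \<le> value_bound" "b \<le> value_bound" "d \<le> value_bound" using extremes_le[OF ab] B(4) digit_le[of X j] unfolding d_def by auto
  have v: "s (V 31) = n + 1" "s (V 24) = y" using s by (simp_all add: matrix_store_def y_def)
  show ?thesis
    unfolding size_prog_def d_def[symmetric] y'_def[symmetric]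
    apply (rule reaches_Seq, rule reaches_assign_val[where v = d, OF B(1)], simp, simp)
      apply (use v y_le B in simp)
     apply (use v d in simp)
    apply (rule reaches_Seq, rule reaches_assign_val[where v = y', OF B(1)], simp, simp)
      apply (use v y_le B y'_le y' in simp)
     apply (use v y' in simp)
    apply (rule reaches_Seq, rule reaches_assign_val[where v = "max a d", OF B(1)], simp, simp)
      apply (use s le B in simp)
     apply (use s in simp)
    apply (rule reaches_assign_val[where v = "min b d", OF B(1)], simp, simp)
      apply (use s le B in simp)
     apply (use s in simp)
    apply simp
    done
qed

lemma reaches_sum:
  assumes s: "dp_store n {} Q s" "s (V 22) = h" "s (V 0) = r"
    and h: "h < length Q" and X: "Q ! h \<in> code ` viable n"
    and r: "r + tab (reached n {}) (Q ! h) \<le> value_bound"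
  shows "reaches xs value_bound sum_prog s 0 (\<lambda>N s'. N \<le> 100 * (k + 1) \<and> dp_store n {} Q s' \<and>
     s' (V 22) = h + 1 \<and> s' (V 0) = r + (if balanced (Q ! h) then tab (reached n {}) (Q ! h) else 0) \<and>
     s' (V 12) = s (V 12) \<and> s' (V 13) = s (V 13))"
proof -
  note B = value_bound_ge
  let ?X = "Q ! h"
  let ?F = "{14, 15, 20, 24, 29, 32, 33}"
  define m where "m = tab (reached n {}) ?X"
  have X_lt: "?X < max_code" using code_le[OF X] by simp
  have q: "s (A 2 h) = ?X" and v: "s (V 1) = k" "s (V 2) = n" "s (V 31) = n + 1"
    using s(1) h by (simp_all add: dp_store_def matrix_store_def)
  have hM: "array_addr 2 h \<le> value_bound" "h + 1 \<le> value_bound"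
    using dp_store_length[OF s(1)] h B(8) by (simp_all add: array_addr_def)
  have XM: "array_addr 3 ?X \<le> value_bound" "?X \<le> value_bound"
    using X_lt B(7) by (simp_all add: array_addr_def)
  define I where "I j s' \<longleftrightarrow> agree ?F s s' \<and> s' (V 20) = ?X \<and> s' (V 24) = ?X div (n + 1) ^ j \<and>
     extremes ?X j (s' (V 32)) (s' (V 33))" for j s'
  show ?thesis
    unfolding sum_prog_def
    apply (rule reaches_Seq, rule reaches_assign_val[where v = ?X, OF B(1)], simp, simp)
      apply (use s q hM XM in simp)
     apply (use s q in simp)
    apply (rule reaches_Seq, rule reaches_assign_val[where v = ?X, OF B(1)], simp, simp)
      apply (use XM in simp)
     apply simp
    apply (rule reaches_Seq, rule reaches_assign_val[where v = 0, OF B(1)], simp, simp)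
      apply simp
     apply simp
    apply (rule reaches_Seq, rule reaches_assign_val[where v = n, OF B(1)], simp, simp)
      apply (use v B in simp)
     apply (use v in simp)
    apply (rule reaches_Seq)
    apply (rule reaches_for_loop[where I = I and m = k and B = 60, OF B(1)])
           apply simp
          apply (use B v in simp)
         apply simp
        apply simp
       apply simp
      apply (simp add: I_def agree_upd agree_refl extremes_def)
  proof -
    fix j s'
    assume j: "j < k" and I: "I j s'" and xy: "s' (V 14) = j" "s' (V 15) = k - j"
    have "matrix_store s'" using s(1) I by (simp add: dp_store_def matrix_store_def I_def agree_def)
    then show "reaches xs value_bound size_prog s' 0 (\<lambda>N s''. N \<le> 60 \<and> s'' (V 14) = j \<and> s'' (V 15) = k - j \<and>
        I (Suc j) (s''(V 14 := Suc j, V 15 := k - Suc j)))"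
    proof (rule reaches_mono[OF reaches_size[OF _ _ refl refl, where X = ?X and j = j]], goal_cases)
      case (4 N s'')
      then show ?case
        using I xy extremes_Suc[of ?X j "s' (V 32)" "s' (V 33)"] by (auto simp: I_def agree_upd)
    qed (use I X_lt in \<open>simp_all add: I_def\<close>)
  next
    fix N s'
    assume N: "N \<le> esize (Var 1) + 4 + k * (60 + 9)" and I: "I k s'"
    have v': "s' (V 20) = ?X" "s' (V 22) = h" "s' (V 0) = r" "s' (A 3 ?X) = m"
      using I s by (auto simp: I_def agree_def dp_store_def m_def)
    have bal: "s' (V 33) + 1 < s' (V 32) \<longleftrightarrow> \<not> balanced ?X"
      using I by (intro extremes_balanced) (simp add: I_def)
    have le: "s' (V 32) \<le> n" "s' (V 33) \<le> n" using I extremes_le by (auto simp: I_def)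
    have dp: "dp_store n {} Q s'" using s(1) I by (simp add: dp_store_def matrix_store_def I_def agree_def)
    let ?r = "r + (if balanced ?X then m else 0)"
    have rM: "r + m \<le> value_bound" "r \<le> value_bound" "m \<le> value_bound" "?r \<le> value_bound"
      using r by (auto simp: m_def)
    let ?n = "0 + (esize (Arr 2 (Var 22)) + 1) + (esize (Var 20) + 1) + (esize (Num 0) + 1) + (esize (Var 2) + 1) + N"
    show "reaches xs value_bound add_prog s' ?n
      (\<lambda>N s'. N \<le> 100 * (k + 1) \<and> dp_store n {} Q s' \<and>
     s' (V 22) = h + 1 \<and> s' (V 0) = r + (if balanced ?X then tab (reached n {}) ?X else 0) \<and>
     s' (V 12) = s (V 12) \<and> s' (V 13) = s (V 13))"
      unfolding add_prog_def
      apply (rule reaches_Seq, rule reaches_assign_val[where v = ?r, OF B(1)], simp, simp)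
        apply (use v' bal le B rM XM in simp)
       apply (use v' bal in simp)
      apply (rule reaches_assign_val[where v = "h + 1", OF B(1)], simp, simp)
        apply (use v' hM B in simp)
       apply (use v' in simp)
      apply (use N dp I in \<open>simp add: dp_store_upd m_def I_def agree_def\<close>)
      done
  qed (use v in simp)
qed

theorem reaches_dp:
  assumes s: "s (V 1) = k" "s (V 2) = n" "\<And>a b. a < n \<Longrightarrow> b < n \<Longrightarrow> s (A 0 (a * n + b)) = of_bool (adj a b)"
      "\<And>x. s (A 3 x) = 0"
    and S: "\<And>i. i \<le> n \<Longrightarrow> card (code ` viable i) \<le> S"
  shows "reaches xs value_bound dp_prog s 0 (\<lambda>N s'.
     N \<le> 1000 * ((n + 1) * (S + 1) * ((k + 1) * ((k + 1) * (n + 2)))) \<and>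
     s' (V 0) = card {cs \<in> viable n. \<forall>c<k. \<forall>c'<k. count_list cs c \<le> count_list cs c' + 1})"
proof -
  note B = value_bound_ge
  let ?T = "(k + 1) * ((k + 1) * (n + 2))"
  have T: "2 \<le> ?T" "k + 1 \<le> ?T" by simp_all
  define K where "K = (S + 1) * (700 * ?T)"
  define I where "I j s' \<longleftrightarrow> (\<exists>ps rs. dp_store j {} (ps @ rs) s' \<and> s' (V 22) = length ps \<and> set rs = code ` viable j)" for j s'
  have init: "I 0 ((s(V 31 := n + 1, V 22 := 0, V 23 := 1, A 2 0 := 0, A 3 0 := 1))(V 11 := n, V 10 := 0))"
  proof -
    have r0: "reached 0 {} = {[]}" by (simp add: reached_def viable_0)
    have t0: "tab {[]} = (\<lambda>_. 0)(0 := 1)" using tab_reached_0 unfolding r0 code_Nil .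
    show ?thesis
      unfolding I_def
      by (intro exI[of _ "[]"] exI[of _ "[0]"])
         (use s in \<open>simp add: dp_store_def matrix_store_def r0 t0 code_Nil viable_0\<close>)
  qed
  show ?thesis
    unfolding dp_prog_def
    apply (rule reaches_Seq, rule reaches_assign_val[where v = "n + 1", OF B(1)], simp, simp)
      apply (use s B in simp)
     apply (use s in simp)
    apply (rule reaches_Seq, rule reaches_assign_val[where v = 0, OF B(1)], simp, simp)
      apply simp
     apply simp
    apply (rule reaches_Seq, rule reaches_assign_val[where v = 1, OF B(1)], simp, simp)
      apply (use B in simp)
     apply simp
    apply (rule reaches_Seq)
    apply (rule reaches_assign_array[OF B(1)])
          apply simp
         apply simp
        apply simp
       apply simp
      apply simp
     apply (use B in \<open>simp add: array_addr_def\<close>)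
    apply (rule reaches_Seq)
    apply (rule reaches_assign_array[OF B(1)])
          apply simp
         apply simp
        apply simp
       apply simp
      apply (use B in simp)
     apply (use B in \<open>simp add: array_addr_def\<close>)
    apply (rule reaches_Seq)
    apply (rule reaches_for_loop[where I = I and m = n and B = K, OF B(1)])
           apply simp
          apply (use s B in simp)
         apply simp
        apply simp
       apply simp
      apply (use init s in simp)
  proof -
    fix j s'
    assume j: "j < n" and I: "I j s'" and xy: "s' (V 10) = j" "s' (V 11) = n - j"
    obtain ps rs where ps: "dp_store j {} (ps @ rs) s'" "s' (V 22) = length ps" "set rs = code ` viable j"
      using I by (auto simp: I_def)
    show "reaches xs value_bound stage_prog s' 0 (\<lambda>N s''. N \<le> K \<and> s'' (V 10) = j \<and> s'' (V 11) = n - j \<and>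
        I (Suc j) (s''(V 10 := Suc j, V 11 := n - Suc j)))"
    proof (rule reaches_mono[OF reaches_stage[OF ps(1) xy(1) ps(2) j ps(3)]], goal_cases)
      case (1 N s'')
      have "(card (code ` viable j) + 1) * (700 * ?T) \<le> K"
        unfolding K_def using S[of j] j by (intro mult_le_mono1) simp
      then have "N \<le> K" using 1 by linarith
      then show ?case using 1 xy by (simp add: I_def dp_store_upd)
    qed
  next
    fix N s'
    let ?e = "0 + (esize (Bin Add (Var 2) (Num 1)) + 1) + (esize (Num 0) + 1) + (esize (Num 1) + 1) + esize (Num 0) + esize (Num 0) + 3 + esize (Num 0) + esize (Num 1) + 3 + N"
    assume N: "N \<le> esize (Var 2) + 4 + n * (K + 9)" and I: "I n s'"
    obtain ps rs where dp: "dp_store n {} (ps @ rs) s'" and v22: "s' (V 22) = length ps" and rs: "set rs = code ` viable n"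
      using I by (auto simp: I_def)
    have v23: "s' (V 23) = length ps + length rs" and dist: "distinct (ps @ rs)" using dp by (simp_all add: dp_store_def)
    have len: "length ps + length rs \<le> value_bound" using dp_store_length[OF dp] B(8) by simp
    have rsS: "length rs \<le> S" using S[of n] rs dist by (simp flip: distinct_card)
    define f where "f x = (if balanced x then tab (reached n {}) x else 0)" for x
    \<comment> \<open>Distinct codes count disjoint sets of colorings, so every partial sum of the
      result stays below the bound on numbers.\<close>
    have f_le: "(\<Sum>x\<in>Y. tab (reached n {}) x) \<le> (n + 1) * k ^ n" if "finite Y" for Y
    proof -
      have "(\<Sum>x\<in>Y. tab (reached n {}) x) = card (\<Union>x\<in>Y. {cs \<in> reached n {}. code cs = x})"
        unfolding tab_def using that by (intro card_UN_disjoint[symmetric]) auto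
      also have "\<dots> \<le> card (reached n {})" by (intro card_mono) auto
      also have "\<dots> \<le> (n + 1) * k ^ n" by (intro card_reached_le) simp
      finally show ?thesis .
    qed
    define J where "J j s' \<longleftrightarrow> dp_store n {} (ps @ rs) s' \<and> s' (V 22) = length ps + j \<and>
        s' (V 0) = (\<Sum>x\<in>set (take j rs). f x)" for j s'
    show "reaches xs value_bound (Seq (assign 0 (Num 0)) (for_loop 12 13 (Bin Sub (Var 23) (Var 22)) sum_prog)) s' ?e
      (\<lambda>N s'. N \<le> 1000 * ((n + 1) * (S + 1) * ?T) \<and>
        s' (V 0) = card {cs \<in> viable n. \<forall>c<k. \<forall>c'<k. count_list cs c \<le> count_list cs c' + 1})"
      apply (rule reaches_Seq, rule reaches_assign_val[where v = 0, OF B(1)], simp, simp)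
        apply simp
       apply simp
      apply (rule reaches_for_loop[where I = J and m = "length rs" and B = "100 * (k + 1)", OF B(1)])
             apply simp
            apply (use v22 v23 len in simp)
           apply simp
          apply simp
         apply simp
        apply (use dp v22 in \<open>simp add: J_def dp_store_upd\<close>)
    proof -
      fix j s''
      assume j: "j < length rs" and J: "J j s''" and xy: "s'' (V 12) = j" "s'' (V 13) = length rs - j"
      have nth: "(ps @ rs) ! (length ps + j) = rs ! j" using j by (simp add: nth_append)
      have tk: "set (take (Suc j) rs) = insert (rs ! j) (set (take j rs))" "rs ! j \<notin> set (take j rs)"
        using dist j by (auto simp: take_Suc_conv_app_nth in_set_conv_nth nth_eq_iff_index_eq)
      have "(\<Sum>x\<in>set (take j rs). f x) + tab (reached n {}) (rs ! j) \<le> (\<Sum>x\<in>insert (rs ! j) (set (take j rs)). tab (reached n {}) x)"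
        using tk(2) by (simp add: sum_mono f_def)
      also have "\<dots> \<le> (n + 1) * k ^ n" by (intro f_le) simp
      finally have r: "(\<Sum>x\<in>set (take j rs). f x) + tab (reached n {}) ((ps @ rs) ! (length ps + j)) \<le> value_bound"
        using B(8) unfolding nth by linarith
      have mem: "(ps @ rs) ! (length ps + j) \<in> code ` viable n" unfolding nth using rs nth_mem[OF j] by simp
      show "reaches xs value_bound sum_prog s'' 0 (\<lambda>N s1. N \<le> 100 * (k + 1) \<and> s1 (V 12) = j \<and> s1 (V 13) = length rs - j \<and>
          J (Suc j) (s1(V 12 := Suc j, V 13 := length rs - Suc j)))"
      proof (rule reaches_mono[OF reaches_sum[OF _ _ _ _ mem r]], goal_cases)
        case (5 N s1)
        then show ?case
          using J xy tk unfolding nth by (simp add: J_def dp_store_upd f_def)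
      qed (use J j in \<open>simp_all add: J_def\<close>)
    next
      fix N' s''
      assume N': "N' \<le> esize (Bin Sub (Var 23) (Var 22)) + 4 + length rs * (100 * (k + 1) + 9)" and J: "J (length rs) s''"
      have "length rs * (100 * (k + 1) + 9) \<le> S * (109 * ?T)"
      proof (rule mult_le_mono[OF rsS])
        have "100 * (k + 1) + 9 \<le> 109 * (k + 1)" by simp
        also have "\<dots> \<le> 109 * ?T" by (rule mult_le_mono2[OF T(2)])
        finally show "100 * (k + 1) + 9 \<le> 109 * ?T" .
      qed
      moreover have "30 + 5 + n * ((S + 1) * (700 * t) + 9) + 7 + S * (109 * t) \<le> 1000 * ((n + 1) * (S + 1) * t)"
        if "2 \<le> t" for t
      proof -
        \<comment> \<open>The loop overhead \<open>9\<close> is at most \<open>5 * t\<close> because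
          \<open>2 <= t\<close>.\<close>
        have 1: "n * ((S + 1) * (700 * t) + 9) \<le> n * ((S + 1) * (705 * t))"
          using that by (intro mult_le_mono2) (simp add: algebra_simps)
        have 2: "1000 * ((n + 1) * (S + 1) * t) = 1000 * (n * S * t) + 1000 * (n * t) + 1000 * (S * t) + 1000 * t"
          by (simp add: algebra_simps)
        have 3: "n * ((S + 1) * (705 * t)) = 705 * (n * S * t) + 705 * (n * t)"
          by (simp add: algebra_simps)
        have 4: "S * (109 * t) = 109 * (S * t)" by simp
        show ?thesis using 1 that unfolding 2 3 4 by linarith
      qed
      from this[OF T(1)] have "30 + 5 + n * (K + 9) + 7 + S * (109 * ?T) \<le> 1000 * ((n + 1) * (S + 1) * ?T)"
        unfolding K_def .
      ultimately have "?e + (esize (Num 0) + 1) + N' \<le> 1000 * ((n + 1) * (S + 1) * ?T)"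
        using N N' unfolding esize.simps by linarith
      moreover have "s'' (V 0) = card {cs \<in> viable n. \<forall>c<k. \<forall>c'<k. count_list cs c \<le> count_list cs c' + 1}"
        using J rs sum_balanced by (simp add: J_def f_def)
      ultimately show "?e + (esize (Num 0) + 1) + N' \<le> 1000 * ((n + 1) * (S + 1) * ?T) \<and>
        s'' (V 0) = card {cs \<in> viable n. \<forall>c<k. \<forall>c'<k. count_list cs c \<le> count_list cs c' + 1}" ..
    qed (use v22 v23 in simp)
  qed (use s in simp)
qed

end

section \<open>Reading a linear expression\<close>

datatype token = VertexTok nat | UnionTok | RelabelTok nat nat | JoinTok nat nat

fun tokens :: "cw_expr \<Rightarrow> token list" where
  "tokens (Vertex i) = [VertexTok i]"
| "tokens (DisjUnion e f) = tokens e @ tokens f @ [UnionTok]"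
| "tokens (Relabel i j e) = tokens e @ [RelabelTok i j]"
| "tokens (Join i j e) = tokens e @ [JoinTok i j]"

fun token_words :: "token \<Rightarrow> nat list" where
  "token_words (VertexTok i) = [1, i]"
| "token_words UnionTok = [2]"
| "token_words (RelabelTok i j) = [3, i, j]"
| "token_words (JoinTok i j) = [4, i, j]"

lemma postfix_expr_tokens: "postfix_expr e = concat (map token_words (tokens e))"
  by (induction e) auto

lemma length_postfix_expr: "length (postfix_expr e) \<le> 3 * num_ops e"
  by (induction e) auto

lemma postfix_expr_le: "constructs w e G lab \<Longrightarrow> x \<in> set (postfix_expr e) \<Longrightarrow> x \<le> w + 4"
  by (induction arbitrary: x rule: constructs.induct) auto

text \<open>Vertices are numbered in the order of their introduction. In a linear expression the operand under
  construction is either the whole graph introduced so far or a single new vertex, so it is an interval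
  \<open>{lo..<hi}\<close>, and a union always extends it to \<open>{0..<hi}\<close>.\<close>

type_synonym parse_state = "nat \<times> nat \<times> (nat \<Rightarrow> nat) \<times> (nat \<Rightarrow> nat \<Rightarrow> bool)"

fun parse_step :: "token \<Rightarrow> parse_state \<Rightarrow> parse_state" where
  "parse_step (VertexTok i) (lo, hi, lab, adj) = (hi, Suc hi, lab(hi := i), adj)"
| "parse_step UnionTok (lo, hi, lab, adj) = (0, hi, lab, adj)"
| "parse_step (RelabelTok i j) (lo, hi, lab, adj) =
     (lo, hi, \<lambda>v. if lo \<le> v \<and> v < hi \<and> lab v = i then j else lab v, adj)"
| "parse_step (JoinTok i j) (lo, hi, lab, adj) =
     (lo, hi, lab, \<lambda>u v. adj u v \<or> lo \<le> u \<and> u < hi \<and> lo \<le> v \<and> v < hi \<and>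
        (lab u = i \<and> lab v = j \<or> lab u = j \<and> lab v = i))"

definition parsed_vertices :: "parse_state \<Rightarrow> nat" where
  "parsed_vertices st = fst (snd st)"

text \<open>The final count is \<open>n\<close>, so all intermediate counts are at most
  \<open>n\<close> and the arrays are never written beyond their range.\<close>

lemma parsed_vertices_mono: "parsed_vertices st \<le> parsed_vertices (fold parse_step ts st)"
proof (induction ts arbitrary: st)
  case (Cons t ts)
  have "parsed_vertices st \<le> parsed_vertices (parse_step t st)"
    by (cases st; cases t) (auto simp: parsed_vertices_def)
  then show ?case using Cons[of "parse_step t st"] by simp
qed simp

lemma constructs_arcs: "constructs w e G lab \<Longrightarrow> parcs G \<subseteq> pverts G \<times> pverts G"
  by (induction rule: constructs.induct) auto

lemma constructs_labels: "constructs w e G lab \<Longrightarrow> v \<in> pverts G \<Longrightarrow> lab v \<in> {1..w}"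
  by (induction rule: constructs.induct) auto

lemma num_vertices_pos: "0 < num_vertices e"
  by (induction e) auto

text \<open>\<open>l\<close> stands for the labels at the time vertex \<open>i\<close> is
  introduced, \<open>lab\<close> for those at the end of the expression. The clause that
  \<open>l\<close> refines \<open>lab\<close> is what the induction needs: a later join then treats
  the classes of \<open>l\<close> uniformly.\<close>

definition twin_labelling ::
    "nat \<Rightarrow> 'a list \<Rightarrow> 'a pair_pre_digraph \<Rightarrow> ('a \<Rightarrow> nat) \<Rightarrow> nat \<Rightarrow> (nat \<Rightarrow> nat) \<Rightarrow> bool" where
  "twin_labelling w us G lab i l \<longleftrightarrow> (\<forall>a<i. l a \<in> {1..w}) \<and>
     (\<forall>a<i. \<forall>b<i. l a = l b \<longrightarrow> lab (us ! a) = lab (us ! b) \<and>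
        (\<forall>v. i \<le> v \<and> v < length us \<longrightarrow> ((us ! a, us ! v) \<in> parcs G \<longleftrightarrow> (us ! b, us ! v) \<in> parcs G)))"

text \<open>The vertices \<open>us\<close> of the expression receive the numbers \<open>h\<close>,
  \<open>h + 1\<close>, and so on. The offset \<open>h\<close> is needed because the second operand
  of a union is parsed after the first.\<close>

definition parse_result ::
    "nat \<Rightarrow> nat \<Rightarrow> 'a list \<Rightarrow> 'a pair_pre_digraph \<Rightarrow> ('a \<Rightarrow> nat) \<Rightarrow> parse_state \<Rightarrow> parse_state \<Rightarrow> bool" where
  "parse_result h m us G lab st st' \<longleftrightarrow> (case (st, st') of ((lo, hi, l, adj), (lo', hi', l', adj')) \<Rightarrow>
     lo' = h \<and> hi' = h + m \<and> (\<forall>j<m. l' (h + j) = lab (us ! j)) \<and> (\<forall>v<h. l' v = l v) \<and>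
     (\<forall>x y. adj' x y \<longleftrightarrow> adj x y \<or> (\<exists>i<m. \<exists>j<m. x = h + i \<and> y = h + j \<and> (us ! i, us ! j) \<in> parcs G)))"

text \<open>Vertices that share a label when vertex \<open>i\<close> is introduced keep sharing one, and all arcs to
  later vertices are added afterwards: hence the labels at that time are a twin labelling.\<close>

lemma parse_linear_expr:
  assumes "constructs w e G lab" "linear_expr e"
  shows "\<exists>us. distinct us \<and> set us = pverts G \<and> length us = num_vertices e \<and>
    (\<forall>i<num_vertices e. \<exists>l. twin_labelling w us G lab i l) \<and>
    (\<forall>h lo l adj. h = 0 \<or> num_vertices e = 1 \<longrightarrow>
       parse_result h (num_vertices e) us G lab (lo, h, l, adj) (fold parse_step (tokens e) (lo, h, l, adj)))"
  using assms
proof (induction rule: constructs.induct)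
  case (Vertex i v)
  then show ?case
    by (intro exI[of _ "[v]"]) (auto simp: parse_result_def twin_labelling_def)
next
  case (DisjUnion e G lab f H lab')
  let ?m = "num_vertices e"
  have lin: "linear_expr e" "linear_expr f" "num_vertices f = 1" using DisjUnion.prems by auto
  obtain us where us: "distinct us" "set us = pverts G" "length us = ?m"
    and tw: "\<forall>i<?m. \<exists>l. twin_labelling w us G lab i l"
    and pe': "\<forall>h lo l adj. h = 0 \<or> num_vertices e = 1 \<longrightarrow>
       parse_result h ?m us G lab (lo, h, l, adj) (fold parse_step (tokens e) (lo, h, l, adj))"
    using DisjUnion.IH(1)[OF lin(1)] by (elim exE conjE)
  \<comment> \<open>A union resets \<open>lo\<close> to \<open>0\<close>, which is correct only if
    its expression starts at vertex \<open>0\<close>. An operand with a single vertex contains no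
    union and may start anywhere; hence the disjunction in the claim.\<close>
  have pe: "parse_result 0 ?m us G lab (lo, 0, l, adj) (fold parse_step (tokens e) (lo, 0, l, adj))" for lo l adj
    using pe' by simp
  obtain us' where us': "distinct us'" "set us' = pverts H" "length us' = num_vertices f"
    and pf': "\<forall>h lo l adj. h = 0 \<or> num_vertices f = 1 \<longrightarrow>
       parse_result h (num_vertices f) us' H lab' (lo, h, l, adj) (fold parse_step (tokens f) (lo, h, l, adj))"
    using DisjUnion.IH(2)[OF lin(2)] by (elim exE conjE)
  have pf: "parse_result h 1 us' H lab' (lo, h, l, adj) (fold parse_step (tokens f) (lo, h, l, adj))" for h lo l adj
    using pf' lin(3) by simp
  obtain x where x: "us' = [x]" using us'(3) lin(3) by (auto simp: length_Suc_conv)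
  have GH: "parcs G \<subseteq> pverts G \<times> pverts G" "parcs H \<subseteq> pverts H \<times> pverts H"
    using DisjUnion.hyps constructs_arcs by blast+
  have xH: "pverts H = {x}" "x \<notin> pverts G" using us' x DisjUnion.hyps by auto
  let ?U = "\<lparr>pverts = pverts G \<union> pverts H, parcs = parcs G \<union> parcs H\<rparr>"
  let ?lab = "\<lambda>v. if v \<in> pverts G then lab v else lab' v"
  let ?us = "us @ [x]"
  have nthG: "us ! a \<in> pverts G" if "a < ?m" for a using nth_mem[of a us] us(2,3) that by simp
  have labG: "lab v \<in> {1..w}" if "v \<in> pverts G" for v
    using DisjUnion.hyps(1) that by (rule constructs_labels)
  have notH: "(us ! a, z) \<notin> parcs H" "(z, us ! a) \<notin> parcs H" if "a < ?m" for a z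
  proof -
    have "us ! a \<notin> pverts H" using xH nthG[OF that] by auto
    then show "(us ! a, z) \<notin> parcs H" "(z, us ! a) \<notin> parcs H" using GH(2) by blast+
  qed
  have notG: "(y, x) \<notin> parcs G" "(x, y) \<notin> parcs G" for y
    using GH(1) xH(2) by blast+
  have nth: "?us ! a = us ! a" if "a < ?m" for a using that us(3) by (simp add: nth_append)
  have nth_m: "?us ! ?m = x" using us(3) by (metis nth_append_length)
  have labU: "?lab (?us ! a) = lab (us ! a)" if "a < ?m" for a using nthG[OF that] nth[OF that] by simp
  have arc: "(?us ! a, ?us ! v) \<in> parcs ?U \<longleftrightarrow> v < ?m \<and> (us ! a, us ! v) \<in> parcs G"
    if a: "a < ?m" and v: "v < Suc ?m" for a v
  proof (cases "v < ?m")
    case True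
    then show ?thesis using notH[OF a] by (simp add: nth[OF a] nth[OF True])
  next
    case False
    then have "v = ?m" using v by simp
    then show ?thesis using notH[OF a] notG by (simp add: nth[OF a] nth_m)
  qed
  have tw': "\<exists>l. twin_labelling w ?us ?U ?lab i l" if i: "i < Suc ?m" for i
  proof -
    have "\<exists>l. (\<forall>a<i. l a \<in> {1..w}) \<and> (\<forall>a<i. \<forall>b<i. l a = l b \<longrightarrow> lab (us ! a) = lab (us ! b) \<and>
        (\<forall>v. i \<le> v \<and> v < ?m \<longrightarrow> ((us ! a, us ! v) \<in> parcs G \<longleftrightarrow> (us ! b, us ! v) \<in> parcs G)))"
    \<comment> \<open>When the new vertex is introduced (\<open>i = ?m\<close>), the labels of the
      left operand serve directly: all its vertices precede \<open>i\<close>, and the union has no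
      arc from them to the new vertex.\<close>
    proof (cases "i = ?m")
      case True
      then show ?thesis using labG nthG by (intro exI[of _ "\<lambda>a. lab (us ! a)"]) auto
    next
      case False
      then have "i < ?m" using i by simp
      then show ?thesis using tw unfolding twin_labelling_def us(3) by simp
    qed
    then obtain l where l1: "\<And>a. a < i \<Longrightarrow> l a \<in> {1..w}"
      and l2: "\<And>a b. a < i \<Longrightarrow> b < i \<Longrightarrow> l a = l b \<Longrightarrow> lab (us ! a) = lab (us ! b)"
      and l3: "\<And>a b v. a < i \<Longrightarrow> b < i \<Longrightarrow> l a = l b \<Longrightarrow> i \<le> v \<Longrightarrow> v < ?m \<Longrightarrow>
         (us ! a, us ! v) \<in> parcs G \<longleftrightarrow> (us ! b, us ! v) \<in> parcs G"
      by blast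
    have "twin_labelling w ?us ?U ?lab i l"
      unfolding twin_labelling_def
    proof (intro conjI allI impI; (elim conjE)?)
      show "l a \<in> {1..w}" if "a < i" for a using l1 that .
      fix a b assume ab: "a < i" "b < i" "l a = l b"
      then have m: "a < ?m" "b < ?m" using i by simp_all
      show "?lab (?us ! a) = ?lab (?us ! b)" unfolding labU[OF m(1)] labU[OF m(2)] using l2 ab .
      fix v assume "i \<le> v" "v < length ?us"
      then have v: "i \<le> v" "v < Suc ?m" using us(3) by simp_all
      show "(?us ! a, ?us ! v) \<in> parcs ?U \<longleftrightarrow> (?us ! b, ?us ! v) \<in> parcs ?U"
        unfolding arc[OF m(1) v(2)] arc[OF m(2) v(2)] using l3[OF ab v(1)] by (rule conj_cong[OF refl])
    qed
    then show ?thesis by blast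
  qed
  have parse: "parse_result 0 (Suc ?m) ?us ?U ?lab (lo, 0, l, adj) (fold parse_step (tokens (DisjUnion e f)) (lo, 0, l, adj))"
    for lo l adj
  proof -
    obtain lo1 hi1 l1 adj1 where e1: "fold parse_step (tokens e) (lo, 0, l, adj) = (lo1, hi1, l1, adj1)"
      by (metis prod_cases4)
    then have r1: "lo1 = 0" "hi1 = ?m" "\<And>j. j < ?m \<Longrightarrow> l1 j = lab (us ! j)"
      "\<And>x y. adj1 x y \<longleftrightarrow> adj x y \<or> (x < ?m \<and> y < ?m \<and> (us ! x, us ! y) \<in> parcs G)"
      using pe[of lo l adj] by (auto simp: parse_result_def)
    obtain lo2 hi2 l2 adj2 where e2: "fold parse_step (tokens f) (0, ?m, l1, adj1) = (lo2, hi2, l2, adj2)"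
      by (metis prod_cases4)
    then have r2: "hi2 = Suc ?m" "l2 ?m = lab' x" "\<And>v. v < ?m \<Longrightarrow> l2 v = l1 v"
      "\<And>y z. adj2 y z \<longleftrightarrow> adj1 y z \<or> (y = ?m \<and> z = ?m \<and> (x, x) \<in> parcs H)"
      using pf[of ?m 0 l1 adj1] by (auto simp: parse_result_def x)
    have "adj2 y z \<longleftrightarrow> adj y z \<or> (y < Suc ?m \<and> z < Suc ?m \<and> (?us ! y, ?us ! z) \<in> parcs ?U)" for y z
    proof (cases "y < ?m \<and> z < Suc ?m")
      case True
      then show ?thesis using r1(4) r2(4) arc[of y z] by auto
    next
      case False
      have "(?us ! y, ?us ! z) \<in> parcs ?U \<longleftrightarrow> z = ?m \<and> (x, x) \<in> parcs H" if yz: "y = ?m" "z < Suc ?m"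
      proof (cases "z < ?m")
        case True
        then show ?thesis using yz notH[OF True] notG by (simp add: nth_m nth[OF True])
      next
        case False
        then have "z = ?m" using yz by simp
        then show ?thesis using yz notG by (simp add: nth_m)
      qed
      then show ?thesis using False r1(4)[of y z] r2(4)[of y z] by (metis less_Suc_eq)
    qed
    moreover have "l2 j = ?lab (?us ! j)" if "j < Suc ?m" for j
    proof (cases "j < ?m")
      case True
      then show ?thesis using r1(3) r2(3) labU by simp
    next
      case False
      then have "j = ?m" using that by simp
      then show ?thesis using r2(2) xH(2) by (simp add: nth_m)
    qed
    moreover have "fold parse_step (tokens (DisjUnion e f)) (lo, 0, l, adj) = (0, Suc ?m, l2, adj2)"
      using e1 e2 r1(1,2) r2(1) by simp
    ultimately show ?thesis
      by (auto simp: parse_result_def)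
  qed
  have "0 < ?m" by (rule num_vertices_pos)
  then show ?case
    using us us' x xH tw' parse lin(3) by (intro exI[of _ ?us]) auto
next
  case (Relabel e G lab i j)
  let ?m = "num_vertices e"
  let ?lab = "\<lambda>v. if lab v = i then j else lab v"
  have lin: "linear_expr e" using Relabel.prems by simp
  obtain us where us: "distinct us" "set us = pverts G" "length us = ?m"
    and tw: "\<forall>i<?m. \<exists>l. twin_labelling w us G lab i l"
    and pe: "\<forall>h lo l adj. h = 0 \<or> num_vertices e = 1 \<longrightarrow>
       parse_result h ?m us G lab (lo, h, l, adj) (fold parse_step (tokens e) (lo, h, l, adj))"
    using Relabel.IH[OF lin] by (elim exE conjE)
  have parse: "parse_result h ?m us G ?lab (lo, h, l, adj) (fold parse_step (tokens (Relabel i j e)) (lo, h, l, adj))"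
    if h: "h = 0 \<or> ?m = 1" for h lo l adj
  proof -
    obtain lo1 hi1 l1 adj1 where e1: "fold parse_step (tokens e) (lo, h, l, adj) = (lo1, hi1, l1, adj1)"
      by (metis prod_cases4)
    have "parse_result h ?m us G lab (lo, h, l, adj) (lo1, hi1, l1, adj1)"
      unfolding e1[symmetric] using h by (rule pe[rule_format])
    then show ?thesis using e1 by (simp add: parse_result_def)
  qed
  have tw': "\<exists>l. twin_labelling w us G ?lab a l" if a: "a < ?m" for a
  proof -
    obtain l where l: "twin_labelling w us G lab a l" using tw a by blast
    have "twin_labelling w us G ?lab a l"
      unfolding twin_labelling_def
    proof (intro conjI allI impI; (elim conjE)?)
      show "l b \<in> {1..w}" if "b < a" for b using l that unfolding twin_labelling_def by blast
      fix b c assume bc: "b < a" "c < a" "l b = l c"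
      have "lab (us ! b) = lab (us ! c)" using l bc unfolding twin_labelling_def by blast
      then show "?lab (us ! b) = ?lab (us ! c)" by (rule arg_cong)
      show "(us ! b, us ! v) \<in> parcs G \<longleftrightarrow> (us ! c, us ! v) \<in> parcs G" if "a \<le> v" "v < length us" for v
        using l bc that unfolding twin_labelling_def by blast
    qed
    then show ?thesis by blast
  qed
  show ?case
    unfolding num_vertices.simps
    by (rule exI[of _ us], intro conjI allI impI, rule us(1), rule us(2), rule us(3), erule tw', erule parse)
next
  case (Join e G lab i j)
  let ?m = "num_vertices e"
  let ?N = "{(u, v). u \<in> pverts G \<and> v \<in> pverts G \<and> (lab u = i \<and> lab v = j \<or> lab u = j \<and> lab v = i)}"
  let ?J = "\<lparr>pverts = pverts G, parcs = parcs G \<union> ?N\<rparr>"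
  have lin: "linear_expr e" using Join.prems by simp
  obtain us where us: "distinct us" "set us = pverts G" "length us = ?m"
    and tw: "\<forall>i<?m. \<exists>l. twin_labelling w us G lab i l"
    and pe: "\<forall>h lo l adj. h = 0 \<or> num_vertices e = 1 \<longrightarrow>
       parse_result h ?m us G lab (lo, h, l, adj) (fold parse_step (tokens e) (lo, h, l, adj))"
    using Join.IH[OF lin] by (elim exE conjE)
  have nthG: "us ! a \<in> pverts G" if "a < ?m" for a using nth_mem[of a us] us(2,3) that by simp
  have arc: "(us ! a, us ! b) \<in> parcs ?J \<longleftrightarrow> (us ! a, us ! b) \<in> parcs G \<or>
      (lab (us ! a) = i \<and> lab (us ! b) = j \<or> lab (us ! a) = j \<and> lab (us ! b) = i)"
    if "a < ?m" "b < ?m" for a b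
    using nthG that by simp
  have parse: "parse_result h ?m us ?J lab (lo, h, l, adj) (fold parse_step (tokens (Join i j e)) (lo, h, l, adj))"
    if h: "h = 0 \<or> ?m = 1" for h lo l adj
  proof -
    obtain lo1 hi1 l1 adj1 where e1: "fold parse_step (tokens e) (lo, h, l, adj) = (lo1, hi1, l1, adj1)"
      by (metis prod_cases4)
    have "parse_result h ?m us G lab (lo, h, l, adj) (lo1, hi1, l1, adj1)"
      unfolding e1[symmetric] using h by (rule pe[rule_format])
    then have r1: "lo1 = h" "hi1 = h + ?m" "\<And>j. j < ?m \<Longrightarrow> l1 (h + j) = lab (us ! j)" "\<And>v. v < h \<Longrightarrow> l1 v = l v"
      "\<And>x y. adj1 x y \<longleftrightarrow> adj x y \<or> (\<exists>i<?m. \<exists>j<?m. x = h + i \<and> y = h + j \<and> (us ! i, us ! j) \<in> parcs G)"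
      by (simp_all add: parse_result_def)
    let ?adj2 = "\<lambda>u v. adj1 u v \<or> h \<le> u \<and> u < h + ?m \<and> h \<le> v \<and> v < h + ?m \<and>
        (l1 u = i \<and> l1 v = j \<or> l1 u = j \<and> l1 v = i)"
    have "?adj2 x y \<longleftrightarrow> adj x y \<or> (\<exists>a<?m. \<exists>b<?m. x = h + a \<and> y = h + b \<and> (us ! a, us ! b) \<in> parcs ?J)" for x y
    proof (cases "h \<le> x \<and> x < h + ?m \<and> h \<le> y \<and> y < h + ?m")
      case True
      then obtain a b where xy: "x = h + a" "y = h + b" by (auto dest!: le_Suc_ex)
      then have ab: "a < ?m" "b < ?m" using True by simp_all
      have ex: "(\<exists>a'<?m. \<exists>b'<?m. x = h + a' \<and> y = h + b' \<and> Q a' b') \<longleftrightarrow> Q a b" for Q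
        using xy ab by auto
      show ?thesis unfolding r1(5) ex arc[OF ab] using True r1(3) xy ab by simp
    next
      case False
      then have ex: "(\<exists>a'<?m. \<exists>b'<?m. x = h + a' \<and> y = h + b' \<and> Q a' b') \<longleftrightarrow> False" for Q
        by auto
      show ?thesis unfolding r1(5) ex using False by auto
    qed
    moreover have "fold parse_step (tokens (Join i j e)) (lo, h, l, adj) = (h, h + ?m, l1, ?adj2)"
      using e1 r1(1,2) by simp
    ultimately show ?thesis using r1(3,4) unfolding parse_result_def by simp
  qed
  have tw': "\<exists>l. twin_labelling w us ?J lab a l" if a: "a < ?m" for a
  proof -
    obtain l where l: "twin_labelling w us G lab a l" using tw a by blast
    have "twin_labelling w us ?J lab a l"
      unfolding twin_labelling_def
    proof (intro conjI allI impI; (elim conjE)?)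
      show "l b \<in> {1..w}" if "b < a" for b using l that unfolding twin_labelling_def by blast
      fix b c assume bc: "b < a" "c < a" "l b = l c"
      show lab: "lab (us ! b) = lab (us ! c)" using l bc unfolding twin_labelling_def by blast
      fix v assume v: "a \<le> v" "v < length us"
      then have m: "b < ?m" "c < ?m" "v < ?m" using bc us(3) by simp_all
      have "(us ! b, us ! v) \<in> parcs G \<longleftrightarrow> (us ! c, us ! v) \<in> parcs G"
        using l bc v unfolding twin_labelling_def by blast
      \<comment> \<open>Twins have equal \<open>lab\<close>, so the join adds the arc to
        \<open>v\<close> for both of them or for neither.\<close>
      then show "(us ! b, us ! v) \<in> parcs ?J \<longleftrightarrow> (us ! c, us ! v) \<in> parcs ?J"
        unfolding arc[OF m(1,3)] arc[OF m(2,3)] lab by (rule arg_cong)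
    qed
    then show ?thesis by blast
  qed
  have us2: "set us = pverts ?J" using us(2) by simp
  show ?case
    unfolding num_vertices.simps
    by (rule exI[of _ us], intro conjI allI impI, rule us(1), rule us2, rule us(3), erule tw', erule parse)
qed

text \<open>Scalars \<open>3\<close> and \<open>4\<close> are the current position and the end of the expression, \<open>5\<close> and \<open>6\<close> are \<open>lo\<close> and
  \<open>hi\<close>, and \<open>7\<close>, \<open>8\<close>, \<open>9\<close> hold the next three input words.\<close>

definition new_label_exp :: aexp where
  "new_label_exp = if_exp
     (and_exp (less_exp (Var 5) (Bin Add (Var 36) (Num 1))) (eq_exp (Arr 1 (Var 36)) (Var 8)))
     (Var 9) (Arr 1 (Var 36))"

definition relabel_prog :: prog where
  "relabel_prog = Seq (for_loop 36 37 (Var 6) (assign_array 1 (Var 36) new_label_exp))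
     (assign 3 (Bin Add (Var 3) (Num 3)))"

definition entry_index_exp :: aexp where
  "entry_index_exp = Bin Add (Bin Mul (Var 36) (Var 2)) (Var 38)"

definition new_entry_exp :: aexp where
  "new_entry_exp = or_exp (Arr 0 entry_index_exp)
     (and_exp (and_exp (less_exp (Var 5) (Bin Add (Var 36) (Num 1))) (less_exp (Var 5) (Bin Add (Var 38) (Num 1))))
       (or_exp (and_exp (eq_exp (Arr 1 (Var 36)) (Var 8)) (eq_exp (Arr 1 (Var 38)) (Var 9)))
               (and_exp (eq_exp (Arr 1 (Var 36)) (Var 9)) (eq_exp (Arr 1 (Var 38)) (Var 8)))))"

definition join_cell_prog :: prog where
  "join_cell_prog = assign_array 0 entry_index_exp new_entry_exp"

definition join_prog :: prog where
  "join_prog = Seq (for_loop 36 37 (Var 6) (for_loop 38 39 (Var 6) join_cell_prog))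
     (assign 3 (Bin Add (Var 3) (Num 3)))"

definition apply_prog :: prog where
  "apply_prog = if_then_else (eq_exp (Var 7) (Num 1))
        (Seq (assign_array 1 (Var 6) (Var 8))
        (Seq (assign 5 (Var 6))
        (Seq (assign 6 (Bin Add (Var 6) (Num 1)))
             (assign 3 (Bin Add (Var 3) (Num 2))))))
        (if_then_else (eq_exp (Var 7) (Num 2))
          (Seq (assign 5 (Num 0)) (assign 3 (Bin Add (Var 3) (Num 1))))
          (if_then_else (eq_exp (Var 7) (Num 3)) relabel_prog join_prog))"

text \<open>Three words are fetched whatever the token is. Those beyond the end of the input read as
  \<open>0\<close>, and those of a following token are ignored.\<close>

definition token_prog :: prog where
  "token_prog = Seq (assign 7 (Inp (Var 3)))
    (Seq (assign 8 (Inp (Bin Add (Var 3) (Num 1))))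
    (Seq (assign 9 (Inp (Bin Add (Var 3) (Num 2)))) apply_prog))"

text \<open>The number of tokens is unknown in advance, so the loop runs once per word; each token
  has at least one word, and after the last token the remaining iterations do nothing. Word
  \<open>n * n + 3\<close> is the length of the expression, which starts right after it.\<close>

definition parse_prog :: prog where
  "parse_prog = Seq (assign 4 (Inp (Bin Add (Bin Mul (Var 2) (Var 2)) (Num 3))))
    (Seq (assign 3 (Bin Add (Bin Mul (Var 2) (Var 2)) (Num 4)))
    (Seq (assign 40 (Var 4))
    (Seq (assign 4 (Bin Add (Var 4) (Var 3)))
      (for_loop 34 35 (Var 40) (if_then_else (Bin Sub (Var 4) (Var 3)) token_prog Skip)))))"

section \<open>Correctness and cost of the parser\<close>

locale parser =
  fixes xs :: "nat list" and n W M :: nat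
  assumes words_le: "\<And>p. n * n + 3 \<le> p \<Longrightarrow> input_word xs p \<le> W"
    and M: "200 + 4 * (n * n) + 4 * n + W + length xs \<le> M"
begin

definition parse_store :: "parse_state \<Rightarrow> store \<Rightarrow> bool" where
  "parse_store st s \<longleftrightarrow> (case st of (lo, hi, lab, adj) \<Rightarrow> s (V 2) = n \<and> s (V 5) = lo \<and> s (V 6) = hi \<and> lo \<le> hi \<and> hi \<le> n \<and>
     (\<forall>v<n. s (A 1 v) = lab v \<and> lab v \<le> W) \<and> (\<forall>u<n. \<forall>v<n. s (A 0 (u * n + v)) = of_bool (adj u v)) \<and>
     (\<forall>x. s (A 3 x) = 0))"

definition unchanged :: "store \<Rightarrow> store \<Rightarrow> bool" where
  "unchanged s s' \<longleftrightarrow> (\<forall>x\<in>{1, 2, 4, 34, 35}. s' (V x) = s (V x))"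

lemma M_ge: "200 \<le> M" "1 \<le> M" "n \<le> M" "W \<le> M" "n * n \<le> M" "128 + 4 * n \<le> M" "128 + 4 * (n * n) \<le> M"
  "length xs + 10 \<le> M" "n + 1 \<le> M" "n * n + 4 \<le> M"
  using M by simp_all

lemma index_eq_iff:
  assumes "b < n" "b' < n"
  shows "a * n + b = a' * n + b' \<longleftrightarrow> a = a' \<and> b = b'"
proof
  assume eq: "a * n + b = a' * n + b'"
  have "(a * n + b) div n = a" "(a' * n + b') div n = a'" using assms by simp_all
  then have "a = a'" using eq by metis
  then show "a = a' \<and> b = b'" using eq by simp
qed simp

lemma reaches_relabel:
  assumes s: "parse_store (lo, hi, lab, adj) s" "s (V 8) = i" "s (V 9) = j" "s (V 3) = p" and W: "i \<le> W" "j \<le> W" "p < length xs"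
  shows "reaches xs M relabel_prog s 0 (\<lambda>N s'. N \<le> 150 * (n + 1) \<and>
     parse_store (parse_step (RelabelTok i j) (lo, hi, lab, adj)) s' \<and> unchanged s s' \<and> s' (V 3) = p + 3)"
proof -
  note B = M_ge
  define lab' where "lab' v = (if lo \<le> v \<and> v < hi \<and> lab v = i then j else lab v)" for v
  define I where "I a s' \<longleftrightarrow> s' (V 2) = n \<and> s' (V 5) = lo \<and> s' (V 6) = hi \<and> s' (V 3) = p \<and> s' (V 8) = i \<and> s' (V 9) = j \<and>
    unchanged s s' \<and> (\<forall>v<n. s' (A 1 v) = (if v < a then lab' v else lab v)) \<and>
    (\<forall>u<n. \<forall>v<n. s' (A 0 (u * n + v)) = of_bool (adj u v)) \<and> (\<forall>x. s' (A 3 x) = 0)" for a s'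
  have hi: "lo \<le> hi" "hi \<le> n" "s (V 6) = hi" and labW: "\<And>v. v < n \<Longrightarrow> lab v \<le> W"
    using s by (auto simp: parse_store_def)
  have lab'W: "\<And>v. v < n \<Longrightarrow> lab' v \<le> W" using labW W by (simp add: lab'_def)
  show ?thesis
    unfolding relabel_prog_def
    apply (rule reaches_Seq)
    apply (rule reaches_for_loop[where I = I and m = hi and B = 100, OF B(1)])
           apply simp
          apply (use B hi in simp)
         apply simp
        apply simp
       apply simp
      apply (use s in \<open>simp add: I_def parse_store_def unchanged_def\<close>)
  proof -
    fix a s'
    assume a: "a < hi" and I: "I a s'" and xy: "s' (V 36) = a" "s' (V 37) = hi - a"
    have an: "a < n" using a hi by simp
    have v: "s' (V 5) = lo" "s' (V 8) = i" "s' (V 9) = j" "s' (A 1 a) = lab a" using I an by (simp_all add: I_def)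
    have val: "lab' a = (if lo < a + 1 \<and> lab a = i then j else lab a)" using a by (auto simp: lab'_def)
    have M': "array_addr 1 a \<le> M" "lab a \<le> M" "lo \<le> M" "a + 1 \<le> M" "i \<le> M" "j \<le> M"
      using an B W hi labW[OF an] a by (simp_all add: array_addr_def)
    have ev: "aval xs s' new_label_exp = lab' a" unfolding val new_label_exp_def using v xy by simp
    show "reaches xs M (assign_array 1 (Var 36) new_label_exp) s' 0 (\<lambda>N s''. N \<le> 100 \<and> s'' (V 36) = a \<and> s'' (V 37) = hi - a \<and>
        I (Suc a) (s''(V 36 := Suc a, V 37 := hi - Suc a)))"
    proof (rule reaches_assign_array[OF B(1)], goal_cases)
      case 7
      then show ?case
        unfolding ev using I xy an by (auto simp: new_label_exp_def I_def unchanged_def less_Suc_eq)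
    qed (use M' B v xy in \<open>simp_all add: new_label_exp_def\<close>)
  next
    fix N s'
    assume N: "N \<le> esize (Var 6) + 4 + hi * (100 + 9)" and I: "I hi s'"
    have labs: "\<forall>v<n. s' (A 1 v) = lab' v" using I by (auto simp: I_def lab'_def)
    show "reaches xs M (assign 3 (Bin Add (Var 3) (Num 3))) s' (0 + N) (\<lambda>N s'. N \<le> 150 * (n + 1) \<and>
       parse_store (parse_step (RelabelTok i j) (lo, hi, lab, adj)) s' \<and> unchanged s s' \<and> s' (V 3) = p + 3)"
    proof (rule reaches_assign_val[where v = "p + 3", OF B(1)], goal_cases)
      case 5
      have "parse_store (lo, hi, lab', adj) (s'(V 3 := p + 3))"
        using I hi labs lab'W by (simp add: parse_store_def I_def)
      moreover have "parse_step (RelabelTok i j) (lo, hi, lab, adj) = (lo, hi, lab', adj)"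
        by (simp add: lab'_def fun_eq_iff)
      ultimately show ?case
        using I N hi by (simp add: I_def unchanged_def)
    qed (use I W B in \<open>simp_all add: I_def\<close>)
  qed (use hi in simp)
qed

lemma reaches_join:
  assumes s: "parse_store (lo, hi, lab, adj) s" "s (V 8) = i" "s (V 9) = j" "s (V 3) = p" and W: "i \<le> W" "j \<le> W" "p < length xs"
  shows "reaches xs M join_prog s 0 (\<lambda>N s'. N \<le> 250 * ((n + 1) * (n + 1)) \<and>
     parse_store (parse_step (JoinTok i j) (lo, hi, lab, adj)) s' \<and> unchanged s s' \<and> s' (V 3) = p + 3)"
proof -
  note B = M_ge
  define adj' where "adj' u v \<longleftrightarrow> adj u v \<or> lo \<le> u \<and> u < hi \<and> lo \<le> v \<and> v < hi \<and>
        (lab u = i \<and> lab v = j \<or> lab u = j \<and> lab v = i)" for u v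
  \<comment> \<open>Updating in place is safe: a new entry depends on its own old value and on
    labels only. Entries before position \<open>(a, b)\<close> are final, the others
    untouched.\<close>
  define J where "J a b s' \<longleftrightarrow> s' (V 2) = n \<and> s' (V 5) = lo \<and> s' (V 6) = hi \<and> s' (V 3) = p \<and> s' (V 8) = i \<and> s' (V 9) = j \<and>
    unchanged s s' \<and> (\<forall>v<n. s' (A 1 v) = lab v) \<and>
    (\<forall>u<n. \<forall>v<n. s' (A 0 (u * n + v)) = of_bool (if u < a \<or> u = a \<and> v < b then adj' u v else adj u v)) \<and>
    (\<forall>x. s' (A 3 x) = 0)" for a b s'
  have hi: "lo \<le> hi" "hi \<le> n" "s (V 6) = hi" and labW: "\<And>v. v < n \<Longrightarrow> lab v \<le> W"
    using s by (auto simp: parse_store_def)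
  have adj'_hi: "adj' u v = adj u v" if "hi \<le> u \<or> hi \<le> v" for u v using that by (auto simp: adj'_def)
  \<comment> \<open>Columns from \<open>hi\<close> on are not affected by the join, so a row
    processed up to \<open>hi\<close> is complete.\<close>
  have J_row: "J a hi s' \<longleftrightarrow> J (Suc a) 0 s'" for a s'
  proof -
    have "(if u < a \<or> u = a \<and> v < hi then adj' u v else adj u v) = (if u < Suc a \<or> u = Suc a \<and> v < 0 then adj' u v else adj u v)" for u v
      using adj'_hi[of u v] by (auto simp: less_Suc_eq)
    then show ?thesis unfolding J_def by simp
  qed
  have J_upd: "J a b (s'(V 38 := x, V 39 := y)) \<longleftrightarrow> J a b s'" for a b s' x y
    by (simp add: J_def unchanged_def)
  show ?thesis
    unfolding join_prog_def
    apply (rule reaches_Seq)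
    apply (rule reaches_for_loop[where I = "\<lambda>a s'. J a 0 s'" and m = hi and B = "210 * (n + 1)", OF B(1)])
           apply simp
          apply (use B hi in simp)
         apply simp
        apply simp
       apply simp
      apply (use s in \<open>simp add: J_def parse_store_def unchanged_def\<close>)
  proof -
    fix a s'
    assume a: "a < hi" and J: "J a 0 s'" and xy: "s' (V 36) = a" "s' (V 37) = hi - a"
    have an: "a < n" using a hi by simp
    show "reaches xs M (for_loop 38 39 (Var 6) join_cell_prog) s' 0
       (\<lambda>N s''. N \<le> 210 * (n + 1) \<and> s'' (V 36) = a \<and> s'' (V 37) = hi - a \<and> J (Suc a) 0 (s''(V 36 := Suc a, V 37 := hi - Suc a)))"
      apply (rule reaches_for_loop[where I = "\<lambda>b s''. J a b s'' \<and> s'' (V 36) = a \<and> s'' (V 37) = hi - a" and m = hi and B = 190, OF B(1)])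
             apply simp
            apply (use B hi J in \<open>simp add: J_def\<close>)
           apply simp
          apply simp
         apply simp
        apply (use J xy in \<open>simp add: J_def unchanged_def\<close>)
    proof -
      fix b s''
      assume b: "b < hi" and J: "J a b s'' \<and> s'' (V 36) = a \<and> s'' (V 37) = hi - a" and xy: "s'' (V 38) = b" "s'' (V 39) = hi - b"
      have bn: "b < n" using b hi by simp
      have v: "s'' (V 2) = n" "s'' (V 5) = lo" "s'' (V 8) = i" "s'' (V 9) = j" "s'' (A 1 a) = lab a" "s'' (A 1 b) = lab b"
        "s'' (A 0 (a * n + b)) = of_bool (adj a b)" "s'' (V 36) = a" "s'' (V 37) = hi - a"
        using J an bn by (simp_all add: J_def)
      have an_le: "a * n \<le> n * n" using an by (intro mult_le_mono1) simp
      have M': "array_addr 1 a \<le> M" "array_addr 1 b \<le> M" "array_addr 0 (a * n + b) \<le> M" "lab a \<le> M" "lab b \<le> M" "lo \<le> M"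
         "a + 1 \<le> M" "b + 1 \<le> M" "i \<le> M" "j \<le> M" "a * n \<le> M" "a * n + b \<le> M"
        using an bn B W hi labW[OF an] labW[OF bn] a b matrix_index_less[OF an bn] an_le by (simp_all add: array_addr_def)
      have val: "adj' a b \<longleftrightarrow> adj a b \<or> ((lo < a + 1 \<and> lo < b + 1) \<and> (lab a = i \<and> lab b = j \<or> lab a = j \<and> lab b = i))"
        using a b by (auto simp: adj'_def)
      have ev: "aval xs s'' new_entry_exp = of_bool (adj' a b)"
        unfolding val new_entry_exp_def entry_index_exp_def using v xy by simp
      have ei: "aval xs s'' entry_index_exp = a * n + b" using v xy by (simp add: entry_index_exp_def)
      show "reaches xs M join_cell_prog s'' 0 (\<lambda>N s1. N \<le> 190 \<and> s1 (V 38) = b \<and> s1 (V 39) = hi - b \<and>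
          J a (Suc b) (s1(V 38 := Suc b, V 39 := hi - Suc b)) \<and>
          (s1(V 38 := Suc b, V 39 := hi - Suc b)) (V 36) = a \<and> (s1(V 38 := Suc b, V 39 := hi - Suc b)) (V 37) = hi - a)"
        unfolding join_cell_prog_def
      proof (rule reaches_assign_array[OF B(1)], goal_cases)
        case 7
        let ?t = "s''(A 0 (a * n + b) := of_bool (adj' a b))"
        have "?t (A 0 (u * n + v)) = of_bool (if u < a \<or> u = a \<and> v < Suc b then adj' u v else adj u v)"
          if "u < n" "v < n" for u v
        proof (cases "u = a \<and> v = b")
          case True
          then show ?thesis by simp
        next
          case False
          then have "?t (A 0 (u * n + v)) = s'' (A 0 (u * n + v))" using index_eq_iff[OF that(2) bn, of u a] by auto
          also have "\<dots> = of_bool (if u < a \<or> u = a \<and> v < b then adj' u v else adj u v)"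
            using J that by (simp add: J_def)
          also have "u = a \<and> v < b \<longleftrightarrow> u = a \<and> v < Suc b" using False by (auto simp: less_Suc_eq)
          finally show ?thesis .
        qed
        then have "J a (Suc b) ?t"
          using J unfolding J_def unchanged_def by simp
        then show ?case
          unfolding ev ei using v xy by (simp add: J_upd new_entry_exp_def entry_index_exp_def)
      qed (use M' B v xy in \<open>simp_all add: new_entry_exp_def entry_index_exp_def\<close>)
    next
      fix N s''
      assume N: "N \<le> esize (Var 6) + 4 + hi * (190 + 9)" and J: "J a hi s'' \<and> s'' (V 36) = a \<and> s'' (V 37) = hi - a"
      have "J (Suc a) 0 s''" using J J_row by blast
      then show "0 + N \<le> 210 * (n + 1) \<and> s'' (V 36) = a \<and> s'' (V 37) = hi - a \<and> J (Suc a) 0 (s''(V 36 := Suc a, V 37 := hi - Suc a))"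
        using N J hi by (simp add: J_def unchanged_def)
    qed (use J in \<open>simp add: J_def\<close>)
  next
    fix N s'
    assume N: "N \<le> esize (Var 6) + 4 + hi * (210 * (n + 1) + 9)" and J: "J hi 0 s'"
    have adjs: "\<forall>u<n. \<forall>v<n. s' (A 0 (u * n + v)) = of_bool (adj' u v)"
      using J adj'_hi by (simp add: J_def)
    have "hi * (210 * (n + 1) + 9) \<le> n * (219 * (n + 1))" using hi by (intro mult_le_mono) simp_all
    moreover have "n * (219 * (n + 1)) + 20 \<le> 250 * ((n + 1) * (n + 1))" by (simp add: algebra_simps)
    ultimately have N': "N + 10 \<le> 250 * ((n + 1) * (n + 1))" using N by simp
    show "reaches xs M (assign 3 (Bin Add (Var 3) (Num 3))) s' (0 + N) (\<lambda>N s'. N \<le> 250 * ((n + 1) * (n + 1)) \<and>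
       parse_store (parse_step (JoinTok i j) (lo, hi, lab, adj)) s' \<and> unchanged s s' \<and> s' (V 3) = p + 3)"
    proof (rule reaches_assign_val[where v = "p + 3", OF B(1)], goal_cases)
      case 5
      have "parse_store (lo, hi, lab, adj') (s'(V 3 := p + 3))"
        using J hi adjs labW by (simp add: parse_store_def J_def)
      moreover have "parse_step (JoinTok i j) (lo, hi, lab, adj) = (lo, hi, lab, adj')"
        by (simp add: adj'_def fun_eq_iff)
      ultimately show ?case
        using J N' by (simp add: J_def unchanged_def)
    qed (use J W B in \<open>simp_all add: J_def\<close>)
  qed (use hi in simp)
qed

lemma reaches_token:
  assumes s: "parse_store st s" "s (V 3) = p" and p: "n * n + 3 \<le> p" "p < length xs"
    and words: "\<And>j. j < length (token_words t) \<Longrightarrow> input_word xs (p + j) = token_words t ! j"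
    and fit: "parsed_vertices (parse_step t st) \<le> n"
  shows "reaches xs M token_prog s 0 (\<lambda>N s'. N \<le> 400 * ((n + 1) * (n + 1)) \<and>
     parse_store (parse_step t st) s' \<and> unchanged s s' \<and> s' (V 3) = p + length (token_words t))"
proof -
  note B = M_ge
  obtain lo hi lab adj where st: "st = (lo, hi, lab, adj)" by (metis prod_cases4)
  define x y z where "x = input_word xs p" and "y = input_word xs (p + 1)" and "z = input_word xs (p + 2)"
  have W: "x \<le> W" "y \<le> W" "z \<le> W" using words_le p by (simp_all add: x_def y_def z_def)
  have M': "x \<le> M" "y \<le> M" "z \<le> M" "p + 5 \<le> M" using W B p by simp_all
  define s1 where "s1 = s(V 7 := x, V 8 := y, V 9 := z)"
  have ps1: "parse_store st s1" using s st by (simp add: s1_def parse_store_def)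
  have v1: "s1 (V 7) = x" "s1 (V 8) = y" "s1 (V 9) = z" "s1 (V 3) = p" "s1 (V 2) = n" "s1 (V 5) = lo" "s1 (V 6) = hi"
    using s st by (simp_all add: s1_def parse_store_def)
  have hi: "lo \<le> hi" "hi \<le> n" using s st by (simp_all add: parse_store_def)
  have un: "unchanged s s'" if "unchanged s1 s'" for s' using that by (simp add: unchanged_def s1_def)
  have nn: "1 \<le> (n + 1) * (n + 1)" "n + 1 \<le> (n + 1) * (n + 1)" by simp_all
  let ?Q = "\<lambda>N s'. N \<le> 400 * ((n + 1) * (n + 1)) \<and>
     parse_store (parse_step t st) s' \<and> unchanged s s' \<and> s' (V 3) = p + length (token_words t)"
  have body: "reaches xs M apply_prog s1 m ?Q"
    if m: "m \<le> 30" for m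
  proof (cases t)
    case (VertexTok i)
    have xy: "x = 1" "y = i" using words[of 0] words[of 1] VertexTok by (simp_all add: x_def y_def)
    have hin: "hi < n" using fit VertexTok by (simp add: st parsed_vertices_def)
    have A: "array_addr 1 hi \<le> M" "hi \<le> M" "hi + 1 \<le> M" using hin B by (simp_all add: array_addr_def)
    show ?thesis
      unfolding apply_prog_def
      apply (rule reaches_if_then_else)
         apply simp
        apply (use v1 M' B in simp)
       apply (rule reaches_Seq)
       apply (rule reaches_assign_array[OF B(1)])
             apply simp
            apply simp
           apply simp
          apply (use v1 A in simp)
         apply (use v1 M' in simp)
        apply (use v1 A in simp)
       apply (rule reaches_Seq, rule reaches_assign_val[where v = hi, OF B(1)], simp, simp)
         apply (use v1 A in simp)
        apply (use v1 in simp)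
       apply (rule reaches_Seq, rule reaches_assign_val[where v = "hi + 1", OF B(1)], simp, simp)
         apply (use v1 A B in simp)
        apply (use v1 in simp)
       apply (rule reaches_assign_val[where v = "p + 2", OF B(1)], simp, simp)
         apply (use v1 M' B in simp)
        apply (use v1 in simp)
       apply (rule conjI)
        apply (use m nn in simp)
       apply (rule conjI)
      subgoal
        using ps1 hin v1 xy W index_eq_iff by (simp add: VertexTok st parse_store_def)
       apply (use un[of s1] in \<open>simp add: VertexTok unchanged_def s1_def\<close>)
      apply (use v1 xy in simp)
      done
  next
    case UnionTok
    have x: "x = 2" using words[of 0] UnionTok by (simp add: x_def)
    show ?thesis
      unfolding apply_prog_def
      apply (rule reaches_if_then_else)
         apply simp
        apply (use v1 M' B in simp)
       apply (use v1 x in simp)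
      apply (rule reaches_if_then_else)
         apply simp
        apply (use v1 M' B in simp)
       apply (rule reaches_Seq, rule reaches_assign_val[where v = 0, OF B(1)], simp, simp)
         apply simp
        apply simp
       apply (rule reaches_assign_val[where v = "p + 1", OF B(1)], simp, simp)
         apply (use v1 M' B in simp)
        apply (use v1 in simp)
       apply (use m nn ps1 in \<open>simp add: UnionTok st parse_store_def unchanged_def s1_def\<close>)
      apply (use v1 x in simp)
      done
  next
    case (RelabelTok i j)
    have xy: "x = 3" "y = i" "z = j"
      using words[of 0] words[of 1] words[of 2] RelabelTok by (simp_all add: x_def y_def z_def)
    have "reaches xs M relabel_prog s1 m' ?Q" if m': "m' \<le> 100" for m'
    proof (rule reaches_mono[OF reaches_relabel[of lo hi lab adj s1 i j p]], goal_cases)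
      case (8 N s')
      have "N \<le> 150 * ((n + 1) * (n + 1))"
        using 8 mult_le_mono2[OF nn(2), of 150] by (auto intro: le_trans)
      then have "m' + N \<le> 400 * ((n + 1) * (n + 1))" using m' nn(1) by linarith
      then show ?case using 8 un by (simp add: RelabelTok st)
    qed (use ps1 v1 xy W p in \<open>simp_all add: st\<close>)
    then show ?thesis
      unfolding apply_prog_def using v1 M' B xy m by (intro reaches_if_then_else) simp_all
  next
    case (JoinTok i j)
    have xy: "x = 4" "y = i" "z = j"
      using words[of 0] words[of 1] words[of 2] JoinTok by (simp_all add: x_def y_def z_def)
    have "reaches xs M join_prog s1 m' ?Q" if m': "m' \<le> 100" for m'
    proof (rule reaches_mono[OF reaches_join[of lo hi lab adj s1 i j p]], goal_cases)
      case (8 N s')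
      then have "m' + N \<le> 400 * ((n + 1) * (n + 1))" using m' nn by linarith
      then show ?case using 8 un by (simp add: JoinTok st)
    qed (use ps1 v1 xy W p in \<open>simp_all add: st\<close>)
    then show ?thesis
      unfolding apply_prog_def using v1 M' B xy m by (intro reaches_if_then_else) simp_all
  qed
  show ?thesis
    unfolding token_prog_def
    apply (rule reaches_Seq, rule reaches_assign_val[where v = x, OF B(1)], simp, simp)
      apply (use s M' in \<open>simp add: x_def\<close>)
     apply (use s in \<open>simp add: x_def\<close>)
    apply (rule reaches_Seq, rule reaches_assign_val[where v = y, OF B(1)], simp, simp)
      apply (use s M' B in \<open>simp add: y_def\<close>)
     apply (use s in \<open>simp add: y_def\<close>)
    apply (rule reaches_Seq, rule reaches_assign_val[where v = z, OF B(1)], simp, simp)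
      apply (use s M' B in \<open>simp add: z_def\<close>)
     apply (use s in \<open>simp add: z_def\<close>)
    unfolding s1_def[symmetric]
    apply (rule body)
    apply simp
    done
qed

theorem reaches_parse:
  assumes s: "s (V 2) = n" "s (V 5) = 0" "s (V 6) = 0" "\<And>r j. s (A r j) = 0"
    and len: "input_word xs (n * n + 3) = length (concat (map token_words ts))"
    and words: "\<And>j. j < length (concat (map token_words ts)) \<Longrightarrow>
        input_word xs (n * n + 4 + j) = concat (map token_words ts) ! j"
    and xs: "n * n + 4 + length (concat (map token_words ts)) \<le> length xs"
    and final: "fold parse_step ts (0, 0, \<lambda>_. 0, \<lambda>_ _. False) = (lo, n, lab, adj)"
  shows "reaches xs M parse_prog s 0 (\<lambda>N s'.
     N \<le> 500 * ((length (concat (map token_words ts)) + 1) * ((n + 1) * (n + 1))) \<and> s' (V 1) = s (V 1) \<and> s' (V 2) = n \<and>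
     (\<forall>a<n. \<forall>b<n. s' (A 0 (a * n + b)) = of_bool (adj a b)) \<and> (\<forall>x. s' (A 3 x) = 0))"
proof -
  note B = M_ge
  let ?ws = "\<lambda>ts. concat (map token_words ts)"
  let ?start = "n * n + 4"
  let ?st = "\<lambda>ts. fold parse_step ts (0, 0, \<lambda>_. 0, \<lambda>_ _. False)"
  define L where "L = length (?ws ts)"
  have xsL: "?start + L \<le> length xs" "L \<le> M" using xs B(8) by (simp_all add: L_def)
  define I where "I j s' \<longleftrightarrow> s' (V 1) = s (V 1) \<and> s' (V 4) = L + ?start \<and>
     (\<exists>pre post. ts = pre @ post \<and> (length pre = j \<or> post = []) \<and>
       s' (V 3) = ?start + length (?ws pre) \<and> parse_store (?st pre) s')" for j s'
  have word_pos: "0 < length (token_words t)" for t by (cases t) auto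
  have len_ge: "length ts' \<le> length (?ws ts')" for ts' :: "token list"
  proof (induction ts')
    case (Cons t ts')
    then show ?case using word_pos[of t] by (cases "token_words t") auto
  qed simp
  show ?thesis
    unfolding parse_prog_def
    apply (rule reaches_Seq, rule reaches_assign_val[where v = L, OF B(1)], simp, simp)
      apply (use s B xsL len in \<open>simp add: L_def add.commute\<close>)
     apply (use s len in \<open>simp add: L_def add.commute\<close>)
    apply (rule reaches_Seq, rule reaches_assign_val[where v = ?start, OF B(1)], simp, simp)
      apply (use s B in simp)
     apply (use s in simp)
    apply (rule reaches_Seq, rule reaches_assign_val[where v = L, OF B(1)], simp, simp)
      apply (use xsL in simp)
     apply simp
    apply (rule reaches_Seq, rule reaches_assign_val[where v = "L + ?start", OF B(1)], simp, simp)
      apply (use xsL B in simp)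
     apply simp
    apply (rule reaches_for_loop[where I = I and m = L and B = "420 * ((n + 1) * (n + 1))", OF B(1)])
           apply simp
          apply (use xsL in simp)
         apply simp
        apply simp
       apply simp
    subgoal
      unfolding I_def
      by (intro conjI exI[of _ "[]"] exI[of _ ts]) (use s in \<open>simp_all add: parse_store_def\<close>)
  proof -
    fix j s'
    assume j: "j < L" and I: "I j s'" and xy: "s' (V 34) = j" "s' (V 35) = L - j"
    obtain pre post where ts: "ts = pre @ post" "length pre = j \<or> post = []"
      and v3: "s' (V 3) = ?start + length (?ws pre)" and ps: "parse_store (?st pre) s'"
      using I by (auto simp: I_def)
    have v: "s' (V 1) = s (V 1)" "s' (V 4) = L + ?start" using I by (simp_all add: I_def)
    have Lp: "L = length (?ws pre) + length (?ws post)" by (simp add: L_def ts)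
    have M': "L + ?start \<le> M" "?start + length (?ws pre) \<le> M" using xsL B(8) Lp by linarith+
    have nn: "1 \<le> (n + 1) * (n + 1)" by simp
    show "reaches xs M (if_then_else (Bin Sub (Var 4) (Var 3)) token_prog Skip) s' 0
      (\<lambda>N s''. N \<le> 420 * ((n + 1) * (n + 1)) \<and> s'' (V 34) = j \<and> s'' (V 35) = L - j \<and>
        I (Suc j) (s''(V 34 := Suc j, V 35 := L - Suc j)))"
    proof (cases post)
      case Nil
      have "I (Suc j) (s'(V 34 := Suc j, V 35 := L - Suc j))"
        unfolding I_def using ts v v3 ps Nil
        by (intro conjI exI[of _ pre] exI[of _ "[]"]) (simp_all add: parse_store_def split: prod.splits)
      then show ?thesis
        using v v3 M' Lp Nil xy nn
        by (intro reaches_if_then_else reaches_Skip[OF B(1)]) simp_all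
    next
      case (Cons t post')
      have len_pre: "length pre = j" using ts Cons by simp
      have pos: "?start + length (?ws pre) < L + ?start"
        using word_pos[of t] unfolding Lp Cons by (cases "token_words t") simp_all
      have "reaches xs M token_prog s' (0 + esize (Bin Sub (Var 4) (Var 3)) + 1)
      (\<lambda>N s''. N \<le> 420 * ((n + 1) * (n + 1)) \<and> s'' (V 34) = j \<and> s'' (V 35) = L - j \<and>
        I (Suc j) (s''(V 34 := Suc j, V 35 := L - Suc j)))"
      proof (rule reaches_mono[OF reaches_token[OF ps v3, of t]], goal_cases)
        case 1
        then show ?case by simp
      next
        case 2
        show ?case using xsL(1) pos by linarith
      next
        case (3 q)
        then have "length (?ws pre) + q < L" by (simp add: Lp Cons)
        then have "input_word xs (?start + (length (?ws pre) + q)) = ?ws ts ! (length (?ws pre) + q)"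
          using words by (simp add: L_def)
        also have "\<dots> = token_words t ! q" using 3 by (simp add: ts Cons nth_append)
        finally show ?case by (simp add: add.assoc)
      next
        case 4
        have "parsed_vertices (?st (pre @ [t])) \<le> parsed_vertices (fold parse_step post' (?st (pre @ [t])))"
          by (rule parsed_vertices_mono)
        also have "fold parse_step post' (?st (pre @ [t])) = (lo, n, lab, adj)"
          using final by (simp add: ts Cons)
        finally show ?case by (simp add: parsed_vertices_def)
      next
        case (5 N s'')
        then have N: "0 + esize (Bin Sub (Var 4) (Var 3)) + 1 + N \<le> 420 * ((n + 1) * (n + 1))"
          using nn unfolding esize.simps by linarith
        have un: "s'' (V 1) = s' (V 1)" "s'' (V 4) = s' (V 4)" "s'' (V 34) = s' (V 34)" "s'' (V 35) = s' (V 35)"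
          using 5 by (auto simp: unchanged_def)
        have "parse_store (?st (pre @ [t])) (s''(V 34 := Suc j, V 35 := L - Suc j))"
          using 5 by (auto simp: parse_store_def split: prod.splits)
        moreover have "s'' (V 3) = ?start + length (?ws (pre @ [t]))" using 5 by simp
        ultimately have "I (Suc j) (s''(V 34 := Suc j, V 35 := L - Suc j))"
          unfolding I_def using un v ts Cons len_pre
          by (intro conjI exI[of _ "pre @ [t]"] exI[of _ post']) simp_all
        then show ?case using N un xy by simp
      qed
      then show ?thesis
      proof (rule reaches_if_then_else[rotated 2], goal_cases)
        case 1
        then show ?case using v v3 pos by simp
      qed (use v v3 M' in simp_all)
    qed
  next
    fix N s'
    let ?c = "0 + (esize (Inp (Bin Add (Bin Mul (Var 2) (Var 2)) (Num 3))) + 1) + (esize (Bin Add (Bin Mul (Var 2) (Var 2)) (Num 4)) + 1) + (esize (Var 4) + 1) + (esize (Bin Add (Var 4) (Var 3)) + 1)"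
    assume N: "N \<le> esize (Var 40) + 4 + L * (420 * ((n + 1) * (n + 1)) + 9)" and I: "I L s'"
    obtain pre post where ts: "ts = pre @ post" "length pre = L \<or> post = []" and ps: "parse_store (?st pre) s'"
      using I by (auto simp: I_def)
    \<comment> \<open>There are at most as many tokens as words, so \<open>L\<close> iterations
      exhaust them.\<close>
    have "post = []" using ts len_ge[of ts] by (auto simp: L_def)
    then have "parse_store (lo, n, lab, adj) s'" using ps ts final by simp
    moreover have "30 + L * (420 * t + 9) \<le> 500 * ((L + 1) * t)" if "1 \<le> t" for t
    proof -
      have "L * (420 * t + 9) \<le> L * (429 * t)" using that by (intro mult_le_mono2) linarith
      moreover have "L * (429 * t) = 429 * (L * t)" "500 * ((L + 1) * t) = 500 * (L * t) + 500 * t" by simp_all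
      ultimately show ?thesis using that by linarith
    qed
    from this[of "(n + 1) * (n + 1)"] have "30 + L * (420 * ((n + 1) * (n + 1)) + 9) \<le> 500 * ((L + 1) * ((n + 1) * (n + 1)))"
      by simp
    moreover have "?c + N \<le> 30 + L * (420 * ((n + 1) * (n + 1)) + 9)" using N by simp
    ultimately show "?c + N \<le> 500 * ((length (?ws ts) + 1) * ((n + 1) * (n + 1))) \<and> s' (V 1) = s (V 1) \<and> s' (V 2) = n \<and>
     (\<forall>a<n. \<forall>b<n. s' (A 0 (a * n + b)) = of_bool (adj a b)) \<and> (\<forall>x. s' (A 3 x) = 0)"
      using I unfolding L_def[symmetric] by (simp add: parse_store_def I_def)
  qed simp
qed

end

section \<open>The complete program\<close>

definition load_prog :: prog where
  "load_prog = for_loop 34 35 (Bin Mul (Var 2) (Var 2)) (assign_array 0 (Var 34) (Inp (Bin Add (Var 34) (Num 2))))"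

text \<open>For \<open>k = 1\<close> the time bound does not depend on \<open>w\<close>, so the expression must not be read.\<close>

definition read_prog :: prog where
  "read_prog = Seq (assign 1 (Inp (Num 0)))
     (Seq (assign 2 (Inp (Num 1)))
       (if_then_else (Bin Sub (Var 1) (Num 1)) parse_prog load_prog))"

definition main_prog :: prog where
  "main_prog = Seq read_prog dp_prog"

lemma nth_concat_map:
  "a < length us \<Longrightarrow> b < length vs \<Longrightarrow>
    concat (map (\<lambda>u. map (f u) vs) us) ! (a * length vs + b) = f (us ! a) (vs ! b)"
proof (induction us arbitrary: a)
  case (Cons u us)
  then show ?case by (cases a) (auto simp: nth_append add.assoc)
qed simp

lemma length_concat_map: "length (concat (map (\<lambda>u. map (f u) vs) us)) = length us * length vs"
  by (induction us) auto

lemma encode_eq: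
  "encode k vs G w e = [k, length vs] @ concat (map (\<lambda>u. map (\<lambda>v. of_bool ((u, v) \<in> parcs G)) vs) vs) @
     [w, length (postfix_expr e)] @ postfix_expr e"
  by (simp add: encode_def encode_graph_def encode_expr_def)

lemma length_encode: "length (encode k vs G w e) = length vs * length vs + 4 + length (postfix_expr e)"
  by (simp add: encode_eq length_concat_map)

lemma input_word_encode:
  assumes n: "length vs = n"
  shows "input_word (encode k vs G w e) 0 = k" "input_word (encode k vs G w e) 1 = n"
    "a < n \<Longrightarrow> b < n \<Longrightarrow> input_word (encode k vs G w e) (a * n + b + 2) = of_bool ((vs ! a, vs ! b) \<in> parcs G)"
    "input_word (encode k vs G w e) (n * n + 3) = length (postfix_expr e)"
    "j < length (postfix_expr e) \<Longrightarrow> input_word (encode k vs G w e) (n * n + 4 + j) = postfix_expr e ! j"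
proof -
  let ?m = "concat (map (\<lambda>u. map (\<lambda>v. of_bool ((u, v) \<in> parcs G)) vs) vs) :: nat list"
  have len: "length ?m = n * n" by (simp add: length_concat_map n)
  show "input_word (encode k vs G w e) 0 = k" "input_word (encode k vs G w e) 1 = n"
    by (simp_all add: input_word_def encode_eq n)
  show "input_word (encode k vs G w e) (n * n + 3) = length (postfix_expr e)"
    "j < length (postfix_expr e) \<Longrightarrow> input_word (encode k vs G w e) (n * n + 4 + j) = postfix_expr e ! j"
    using len by (simp_all add: input_word_def encode_eq nth_append nth_Cons numeral_eq_Suc)
  assume ab: "a < n" "b < n"
  have i: "a * n + b < n * n" by (rule matrix_index_less[OF ab])
  have "encode k vs G w e ! (a * n + b + 2) = ?m ! (a * n + b)"
    using i len by (simp add: encode_eq nth_append)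
  also have "\<dots> = of_bool ((vs ! a, vs ! b) \<in> parcs G)"
    using nth_concat_map[of a vs b vs "\<lambda>u v. of_bool ((u, v) \<in> parcs G)", unfolded n, OF ab] .
  finally show "input_word (encode k vs G w e) (a * n + b + 2) = of_bool ((vs ! a, vs ! b) \<in> parcs G)"
    using i by (simp add: input_word_def length_encode n)
qed

lemma input_word_encode_le:
  assumes "constructs w e G lab" "length vs * length vs + 3 \<le> p"
  shows "input_word (encode k vs G w e) p \<le> length (postfix_expr e) + w + 4"
proof (cases "p < length (encode k vs G w e)")
  case True
  let ?n = "length vs"
  show ?thesis
  proof (cases "p = ?n * ?n + 3")
    case True
    then show ?thesis using input_word_encode(4)[OF refl, of k vs G w e] by simp
  next
    case False
    then have "p = ?n * ?n + 4 + (p - (?n * ?n + 4))" using assms(2) by simp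
    moreover have "p - (?n * ?n + 4) < length (postfix_expr e)"
      using True False assms(2) by (simp add: length_encode)
    ultimately have "input_word (encode k vs G w e) p \<in> set (postfix_expr e)"
      using input_word_encode(5)[OF refl, of "p - (?n * ?n + 4)" e k vs G w] nth_mem by metis
    then show ?thesis using postfix_expr_le[OF assms(1)] by fastforce
  qed
qed (simp add: input_word_def)

lemma reaches_load:
  assumes s: "s (V 2) = n" "\<And>x. s (A 3 x) = 0" and M: "200 + 8 * (n * n) \<le> M"
    and words: "\<And>a b. a < n \<Longrightarrow> b < n \<Longrightarrow> input_word xs (a * n + b + 2) = of_bool (adj a b)"
  shows "reaches xs M load_prog s 0 (\<lambda>N s'. N \<le> 30 * (n * n + 1) \<and> s' (V 1) = s (V 1) \<and> s' (V 2) = n \<and>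
     (\<forall>a<n. \<forall>b<n. s' (A 0 (a * n + b)) = of_bool (adj a b)) \<and> (\<forall>x. s' (A 3 x) = 0))"
proof -
  have M200: "200 \<le> M" using M by simp
  have nM: "n \<le> M" using M le_square[of n] by linarith
  define I where "I j s' \<longleftrightarrow> s' (V 1) = s (V 1) \<and> s' (V 2) = n \<and> (\<forall>x. s' (A 3 x) = 0) \<and>
     (\<forall>q<j. s' (A 0 q) = input_word xs (q + 2))" for j s'
  show ?thesis
    unfolding load_prog_def
    apply (rule reaches_for_loop[where I = I and m = "n * n" and B = 12, OF M200])
           apply simp
          apply (use s M nM in simp)
         apply simp
        apply simp
       apply simp
      apply (use s in \<open>simp add: I_def\<close>)
  proof -
    fix j s'
    assume j: "j < n * n" and I: "I j s'" and xy: "s' (V 34) = j" "s' (V 35) = n * n - j"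
    have npos: "0 < n" using j by (cases n) auto
    have "j div n < n" using j by (rule less_mult_imp_div_less)
    then have "input_word xs (j + 2) = of_bool (adj (j div n) (j mod n))"
      using words[of "j div n" "j mod n"] npos by simp
    then have le: "input_word xs (j + 2) \<le> M" using M by simp
    show "reaches xs M (assign_array 0 (Var 34) (Inp (Bin Add (Var 34) (Num 2)))) s' 0
      (\<lambda>N s''. N \<le> 12 \<and> s'' (V 34) = j \<and> s'' (V 35) = n * n - j \<and> I (Suc j) (s''(V 34 := Suc j, V 35 := n * n - Suc j)))"
    proof (rule reaches_assign_array[OF M200], goal_cases)
      case 7
      show ?case using I xy by (simp add: I_def less_Suc_eq)
    qed (use xy j M le in \<open>simp_all add: array_addr_def\<close>)
  next
    fix N s'
    assume N: "N \<le> esize (Bin Mul (Var 2) (Var 2)) + 4 + n * n * (12 + 9)" and I: "I (n * n) s'"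
    have "s' (A 0 (a * n + b)) = of_bool (adj a b)" if "a < n" "b < n" for a b
      using I words[OF that] matrix_index_less[OF that] by (simp add: I_def)
    then show "0 + N \<le> 30 * (n * n + 1) \<and> s' (V 1) = s (V 1) \<and> s' (V 2) = n \<and>
     (\<forall>a<n. \<forall>b<n. s' (A 0 (a * n + b)) = of_bool (adj a b)) \<and> (\<forall>x. s' (A 3 x) = 0)"
      using N I by (simp add: I_def)
  qed (use s in simp)
qed

definition matrix_ready :: "nat \<Rightarrow> nat \<Rightarrow> (nat \<Rightarrow> nat \<Rightarrow> bool) \<Rightarrow> store \<Rightarrow> bool" where
  "matrix_ready k n adj s \<longleftrightarrow> s (V 1) = k \<and> s (V 2) = n \<and>
     (\<forall>a<n. \<forall>b<n. s (A 0 (a * n + b)) = of_bool (adj a b)) \<and> (\<forall>x. s (A 3 x) = 0)"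

text \<open>The bound on numbers involves neither \<open>w\<close> nor the expression, as required
  when there is one color.\<close>

lemma reaches_read_matrix:
  assumes vs: "length vs = n" "0 < n"
  shows "reaches (encode 1 vs G w e) (200 + 8 * (n * n)) read_prog (\<lambda>_. 0) 0 (\<lambda>N s'. N \<le> 50 * (n * n + 1) \<and>
     matrix_ready 1 n (\<lambda>a b. (vs ! a, vs ! b) \<in> parcs G) s')"
proof -
  let ?xs = "encode 1 vs G w e"
  let ?M = "200 + 8 * (n * n)"
  have M: "200 \<le> ?M" "n \<le> ?M" using le_square[of n] by linarith+
  note word = input_word_encode(1,2)[OF vs(1), of 1 G w e]
  let ?s = "(\<lambda>_. 0)(V 1 := 1, V 2 := n)"
  show ?thesis
    unfolding read_prog_def
    apply (rule reaches_Seq, rule reaches_assign_val[where v = 1, OF M(1)], simp, simp)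
      apply (use word in simp)
     apply (use word in simp)
    apply (rule reaches_Seq, rule reaches_assign_val[where v = n, OF M(1)], simp, simp)
      apply (use word M in simp)
     apply (use word in simp)
    apply (rule reaches_if_then_else)
       apply simp
      apply simp
     apply simp
    apply (rule reaches_mono[OF reaches_load[where n = n and adj = "\<lambda>a b. (vs ! a, vs ! b) \<in> parcs G"]])
        apply simp
       apply simp
      apply simp
     apply (use input_word_encode(3)[OF vs(1), where k = 1 and G = G and w = w and e = e] in simp)
    apply (auto simp: matrix_ready_def)
    done
qed

text \<open>The bound on numbers is what \<open>parser\<close> demands for words up to
  \<open>L + w + 4\<close> and \<open>n * n + 4 + L\<close> input words, plus \<open>k\<close> for
  the first word of the input.\<close>

lemma reaches_read_expr:
  assumes vs: "length vs = n" "0 < n" and c: "constructs w e G lab" and k: "2 \<le> k"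
    and final: "fold parse_step (tokens e) (0, 0, \<lambda>_. 0, \<lambda>_ _. False) = (lo, n, l, adj)"
  defines "L \<equiv> length (postfix_expr e)"
  shows "reaches (encode k vs G w e) (220 + 5 * (n * n) + 4 * n + 2 * L + w + k) read_prog (\<lambda>_. 0) 0
     (\<lambda>N s'. N \<le> 520 * ((L + 1) * ((n + 1) * (n + 1))) \<and> matrix_ready k n adj s')"
proof -
  let ?xs = "encode k vs G w e"
  let ?M = "220 + 5 * (n * n) + 4 * n + 2 * L + w + k"
  have Mb: "200 \<le> ?M" "n \<le> ?M" "k \<le> ?M" "1 \<le> ?M" by simp_all
  have postfix: "postfix_expr e = concat (map token_words (tokens e))" by (rule postfix_expr_tokens)
  interpret parser ?xs n "L + w + 4" ?M
  proof
    show "input_word ?xs p \<le> L + w + 4" if "n * n + 3 \<le> p" for p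
      using input_word_encode_le[OF c, of vs p k] that by (simp add: vs L_def)
    show "200 + 4 * (n * n) + 4 * n + (L + w + 4) + length ?xs \<le> ?M"
      by (simp add: length_encode vs L_def)
  qed
  note word = input_word_encode(1,2)[OF vs(1), of k G w e]
  let ?s = "(\<lambda>_. 0)(V 1 := k, V 2 := n)"
  have parse: "reaches ?xs ?M parse_prog ?s 0 (\<lambda>N s'.
     N \<le> 500 * ((L + 1) * ((n + 1) * (n + 1))) \<and> s' (V 1) = ?s (V 1) \<and> s' (V 2) = n \<and>
     (\<forall>a<n. \<forall>b<n. s' (A 0 (a * n + b)) = of_bool (adj a b)) \<and> (\<forall>x. s' (A 3 x) = 0))"
    unfolding L_def postfix
    by (rule reaches_parse[where ts = "tokens e", unfolded L_def postfix, OF _ _ _ _ _ _ _ final])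
       (use input_word_encode(4,5)[OF vs(1), where k = k and G = G and w = w and e = e]
         in \<open>simp_all add: length_encode vs flip: postfix\<close>)
  have pos: "1 \<le> (L + 1) * ((n + 1) * (n + 1))" by simp
  show ?thesis
    unfolding read_prog_def
    apply (rule reaches_Seq, rule reaches_assign_val[where v = k, OF Mb(1)], simp, simp)
      apply (use word in simp)
     apply (use word in simp)
    apply (rule reaches_Seq, rule reaches_assign_val[where v = n, OF Mb(1)], simp, simp)
      apply (use word in simp)
     apply (use word in simp)
    apply (rule reaches_if_then_else)
       apply simp
      apply simp
     apply (rule reaches_mono[OF parse])
    subgoal for N s'
      using pos unfolding matrix_ready_def esize.simps by simp
    apply (use k in simp)
    done
qed

section \<open>Running time of the complete program\<close>

lemma reaches_exec:
  assumes "reaches xs M p s 0 Q" "represents m s"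
  shows "\<exists>m' s' N t. represents m' s' \<and> Q N s' \<and> exec xs p m t m' \<and> t \<le> N * (9 * bits M)"
  using assms unfolding reaches_def runs_def by (metis add_0)

lemma bits_le_exponent: "x < 2 ^ q \<Longrightarrow> 1 \<le> q \<Longrightarrow> bits x \<le> q"
  using floorlog_leI[of x 2 q] by (simp add: bits_def)

lemma bits_le: "bits x \<le> x + 1"
  by (rule bits_le_exponent) (auto intro: less_trans[OF less_exp])

text \<open>For \<open>k >= 2\<close> the degree \<open>5\<close> arises from a cubic number of
  instructions and from numbers of quadratic size, whose length is bounded crudely by their value.
  For \<open>k = 1\<close> neither \<open>w\<close> nor \<open>L\<close> may occur, since nothing
  would absorb them.\<close>

definition read_time :: "nat \<Rightarrow> nat \<Rightarrow> nat \<Rightarrow> nat \<Rightarrow> nat" where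
  "read_time k n w L = 1000000 * (if k = 1 then n + 2 else n + L + w + k + 2) ^ 5"

definition signature_bound :: "nat \<Rightarrow> nat \<Rightarrow> nat \<Rightarrow> nat" where
  "signature_bound k n w = min (k ^ n) ((n + 1) ^ k * max 1 (2 ^ k - 2) ^ w)"

text \<open>\<open>18000\<close> is \<open>1000 * 9 * 2\<close>: the constant of the instruction
  count, the cost factor per instruction, and the constant in the length of
  \<open>value_bound\<close>.\<close>

definition dp_time :: "nat \<Rightarrow> nat \<Rightarrow> nat \<Rightarrow> nat" where
  "dp_time k n w = 18000 * ((n + 2) ^ 4 * (k + 1) ^ 3 * (signature_bound k n w + 1))"

text \<open>All summands are at most \<open>2 ^ E\<close>. The largest, \<open>max_code\<close>, is
  estimated through \<open>n + 1 <= 2 ^ (n + 1)\<close>; this gives away more than a logarithm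
  would, but only a power of \<open>n\<close>.\<close>

lemma (in coloring_dp) bits_value_bound: "bits value_bound \<le> 2 * ((n + 2) ^ 2 * (k + 1))"
proof -
  define E where "E = (n + 1) * (n + 1) * k"
  have k1: "1 \<le> k" and n1: "1 \<le> n" using k_pos n_pos by simp_all
  have E: "(n + 1) * (n + 1) \<le> E" "k \<le> E" "n + k * n \<le> E"
  proof -
    show "(n + 1) * (n + 1) \<le> E" unfolding E_def using mult_le_mono2[OF k1] by (metis mult_1_right)
    show "k \<le> E" unfolding E_def by simp
    have "n \<le> k * n" using k1 by simp
    moreover have "E = k + 2 * (k * n) + k * (n * n)" by (simp add: E_def algebra_simps)
    ultimately show "n + k * n \<le> E" by linarith
  qed
  have le: "x \<le> 2 ^ E" if "x \<le> E" for x :: nat using that less_exp[of E] by linarith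
  have "n \<le> (n + 1) * (n + 1)" "n * n \<le> (n + 1) * (n + 1)" by simp_all
  then have 1: "k \<le> 2 ^ E" "n \<le> 2 ^ E" "n * n \<le> 2 ^ E" using E le by (meson le_trans)+
  have "max_code \<le> (2 ^ (n + 1)) ^ ((n + 1) * k)"
    unfolding max_code_def using less_exp[of "n + 1"] by (intro power_mono) simp_all
  also have "\<dots> = 2 ^ E" by (simp only: E_def mult.assoc power_mult[symmetric])
  finally have 2: "max_code \<le> 2 ^ E" .
  have "(n + 1) * k ^ n \<le> 2 ^ n * (2 ^ k) ^ n"
  proof (intro mult_le_mono power_mono)
    show "n + 1 \<le> 2 ^ n" using less_exp[of n] by linarith
  qed (simp_all add: less_imp_le)
  also have "\<dots> = 2 ^ (n + k * n)" by (simp add: power_add power_mult)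
  also have "\<dots> \<le> 2 ^ E" using E by (intro power_increasing) simp_all
  finally have 3: "(n + 1) * k ^ n \<le> 2 ^ E" .
  \<comment> \<open>The coefficients of \<open>value_bound\<close> sum to \<open>214\<close>, which
    is below \<open>256 = 2 ^ 8\<close>.\<close>
  have "1 \<le> (2 :: nat) ^ E" by simp
  then have "value_bound < 2 ^ E * 256" using 1 2 3 unfolding value_bound_def by linarith
  then have "value_bound < 2 ^ (E + 8)" by (simp add: power_add)
  then have "bits value_bound \<le> E + 8" by (rule bits_le_exponent) simp
  also have "E + 8 \<le> 2 * ((n + 2) ^ 2 * (k + 1))"
    using n1 k1 by (simp add: E_def algebra_simps power2_eq_square)
  finally show ?thesis .
qed

lemma pow5: "x ^ 5 = x * x * (x * x * x)" for x :: nat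
  by (simp add: eval_nat_numeral)

text \<open>Both ways of reading are unified by leaving the vertex order \<open>us\<close> open: it
  is the input order for one color and the order of introduction otherwise. Everything later uses
  only \<open>us\<close>, its adjacency and the bound on signatures.\<close>

lemma exec_read_prog:
  assumes G: "pair_graph G" and vs: "enumerates vs (pverts G)" "n = card (pverts G)"
    and e: "linear_expr_for w e G" and k: "1 \<le> k"
  shows "\<exists>us adj m s t. distinct us \<and> set us = pverts G \<and> length us = n \<and> 0 < n \<and>
    (\<forall>a<n. \<forall>b<n. adj a b \<longleftrightarrow> (us ! a, us ! b) \<in> parcs G) \<and>
    (\<forall>i\<le>n. card (coloring_dp.code k n adj ` coloring_dp.viable k n adj i) \<le> signature_bound k n w) \<and>
    represents m s \<and> matrix_ready k n adj s \<and> exec (encode k vs G w e) read_prog (\<lambda>_. 0) t m \<and>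
    t \<le> read_time k n w (length (postfix_expr e))"
proof -
  obtain lab where lin: "linear_expr e" and c: "constructs w e G lab"
    using e by (auto simp: linear_expr_for_def)
  have dvs: "distinct vs" "set vs = pverts G" "length vs = n"
    using vs distinct_card[of vs] by (auto simp: enumerates_def)
  have n: "n = num_vertices e" using constructs_num_vertices[OF c] vs(2) by simp
  then have npos: "0 < n" using num_vertices_pos by simp
  show ?thesis
  proof (cases "k = 1")
    case True
    let ?adj = "\<lambda>a b. (vs ! a, vs ! b) \<in> parcs G"
    interpret coloring_dp k n ?adj using k npos by unfold_locales simp_all
    let ?M = "200 + 8 * (n * n)"
    define q where "q = n + 2"
    obtain m s N t where r: "represents m s" "N \<le> 50 * (n * n + 1)" "matrix_ready 1 n ?adj s"
      "exec (encode 1 vs G w e) read_prog (\<lambda>_. 0) t m" "t \<le> N * (9 * bits ?M)"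
      using reaches_exec[OF reaches_read_matrix[OF dvs(3) npos, of G w e] represents_initial] by blast
    have "t \<le> (50 * (n * n + 1)) * (9 * (?M + 1))"
      by (rule le_trans[OF r(5)], rule mult_le_mono[OF r(2)], rule mult_le_mono2, rule bits_le)
    also have "\<dots> \<le> (50 * (q * q)) * (9 * (60 * (q * q * q)))"
      unfolding q_def by (intro mult_le_mono) (simp_all add: algebra_simps)
    also have "\<dots> \<le> 1000000 * q ^ 5" unfolding pow5 by simp
    also have "\<dots> = read_time k n w (length (postfix_expr e))"
      using True by (simp add: read_time_def q_def)
    finally have t: "t \<le> read_time k n w (length (postfix_expr e))" .
    have S: "card (code ` viable i) \<le> signature_bound k n w" for i
    proof -
      have "card (code ` viable i) \<le> 1" using card_codes_le_power[of i] True by simp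
      also have "1 \<le> signature_bound k n w" using True by (simp add: signature_bound_def)
      finally show ?thesis .
    qed
    show ?thesis
      by (rule exI[of _ vs], rule exI[of _ ?adj], rule exI[of _ m], rule exI[of _ s], rule exI[of _ t])
         (use dvs npos r t True S in simp)
  next
    case False
    then have k2: "2 \<le> k" using k by simp
    let ?L = "length (postfix_expr e)"
    obtain us where us: "distinct us" "set us = pverts G" "length us = num_vertices e"
      and tw: "\<forall>i<num_vertices e. \<exists>l. twin_labelling w us G lab i l"
      and pr: "\<forall>h lo l adj. h = 0 \<or> num_vertices e = 1 \<longrightarrow>
       parse_result h (num_vertices e) us G lab (lo, h, l, adj) (fold parse_step (tokens e) (lo, h, l, adj))"
      using parse_linear_expr[OF c lin] by (elim exE conjE)
    obtain lo hi l adj where fin: "fold parse_step (tokens e) (0, 0, \<lambda>_. 0, \<lambda>_ _. False) = (lo, hi, l, adj)"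
      by (metis prod_cases4)
    have "parse_result 0 n us G lab (0, 0, \<lambda>_. 0, \<lambda>_ _. False) (lo, hi, l, adj)"
      unfolding n fin[symmetric] using pr by blast
    then have hi: "hi = n"
      and adj': "\<And>x y. adj x y \<longleftrightarrow> (\<exists>i<n. \<exists>j<n. x = i \<and> y = j \<and> (us ! i, us ! j) \<in> parcs G)"
      by (simp_all add: parse_result_def)
    have adj: "adj a b \<longleftrightarrow> (us ! a, us ! b) \<in> parcs G" if "a < n" "b < n" for a b
      unfolding adj' using that by blast
    interpret coloring_dp k n adj using k npos by unfold_locales simp_all
    let ?M = "220 + 5 * (n * n) + 4 * n + 2 * ?L + w + k"
    obtain m s N t where r: "represents m s" "N \<le> 520 * ((?L + 1) * ((n + 1) * (n + 1)))" "matrix_ready k n adj s"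
      "exec (encode k vs G w e) read_prog (\<lambda>_. 0) t m" "t \<le> N * (9 * bits ?M)"
      using reaches_exec[OF reaches_read_expr[OF dvs(3) npos c k2 fin[unfolded hi]] represents_initial] by blast
    define q where "q = n + ?L + w + k + 2"
    have q: "?L + 1 \<le> q" "n + 1 \<le> q" "4 \<le> q" using k2 npos by (simp_all add: q_def)
    have M: "?M + 1 \<le> 40 * (q * q)"
    proof -
      have "4 * 4 \<le> q * q" "4 * q \<le> q * q" "n * n \<le> q * q"
        using q by (intro mult_le_mono; simp add: q_def)+
      moreover have "4 * n + 2 * ?L + w + k \<le> 4 * q" by (simp add: q_def)
      ultimately show ?thesis by linarith
    qed
    have "t \<le> (520 * ((?L + 1) * ((n + 1) * (n + 1)))) * (9 * (?M + 1))"
      by (rule le_trans[OF r(5)], rule mult_le_mono[OF r(2)], rule mult_le_mono2, rule bits_le)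
    also have "\<dots> \<le> (520 * (q * (q * q))) * (9 * (40 * (q * q)))"
      using q M by (intro mult_le_mono) simp_all
    also have "\<dots> \<le> 1000000 * q ^ 5"
      unfolding pow5 by simp
    also have "\<dots> = read_time k n w ?L" using False by (simp add: read_time_def q_def)
    finally have t: "t \<le> read_time k n w ?L" .
    have usn: "length us = n" using us(3) n by simp
    then have "us ! 0 \<in> pverts G" using nth_mem[of 0 us] us(2) npos by simp
    then have w: "1 \<le> w" using constructs_labels[OF c] by fastforce
    have S: "card (code ` viable i) \<le> signature_bound k n w" if i: "i \<le> n" for i
    proof -
      have "card (code ` viable i) \<le> k ^ n"
        using card_codes_le_power[of i] power_increasing[OF i k] by linarith
      moreover have "card (code ` viable i) \<le> (n + 1) ^ k * max 1 (2 ^ k - 2) ^ w"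
      proof (cases "i = n")
        case True
        \<comment> \<open>Twin labellings are available for \<open>i < n\<close> only. At
          \<open>i = n\<close> no uncolored vertex is left, so a constant labelling will do;
          \<open>1\<close> is a legal label because \<open>1 <= w\<close>.\<close>
        show ?thesis by (rule card_codes_le_twins[OF i, where lab = "\<lambda>_. 1"]) (use w True in simp_all)
      next
        case False
        then have "i < num_vertices e" using i n by simp
        then obtain l where l: "twin_labelling w us G lab i l" using tw by blast
        show ?thesis
        proof (rule card_codes_le_twins[OF i, where lab = l])
          show "l a \<in> {1..w}" if "a < i" for a using l that unfolding twin_labelling_def by blast
          show "adj a v \<longleftrightarrow> adj b v" if ab: "a < i" "b < i" "l a = l b" and v: "i \<le> v" "v < n" for a b v
          proof -
            have "v < length us" using v usn by simp
            then have "(us ! a, us ! v) \<in> parcs G \<longleftrightarrow> (us ! b, us ! v) \<in> parcs G"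
              using l ab v(1) unfolding twin_labelling_def by blast
            then show ?thesis using adj ab v by simp
          qed
        qed
      qed
      ultimately show ?thesis by (simp add: signature_bound_def)
    qed
    show ?thesis
      by (rule exI[of _ us], rule exI[of _ adj], rule exI[of _ m], rule exI[of _ s], rule exI[of _ t],
          intro conjI allI impI us(1,2) usn npos adj S r(1,3,4) t)
  qed
qed

text \<open>The two phases are charged with different bounds on numbers: one polynomial in
  \<open>n\<close>, \<open>k\<close>, \<open>w\<close> and the expression length for reading, and
  \<open>value_bound\<close>, free of \<open>w\<close>, for the dynamic program.\<close>

theorem main_prog_computes:
  assumes G: "pair_graph G" and vs: "enumerates vs (pverts G)" "n = card (pverts G)"
    and e: "linear_expr_for w e G" and k: "1 \<le> k"
  shows "computes_in_time main_prog (encode k vs G w e) (card (equitable_colorings k G))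
    (read_time k n w (length (postfix_expr e)) + dp_time k n w)"
proof -
  let ?xs = "encode k vs G w e"
  let ?S = "signature_bound k n w"
  obtain us adj m s t where us: "distinct us" "set us = pverts G" "length us = n" and npos: "0 < n"
    and adj: "\<forall>a<n. \<forall>b<n. adj a b \<longleftrightarrow> (us ! a, us ! b) \<in> parcs G"
    and S: "\<forall>i\<le>n. card (coloring_dp.code k n adj ` coloring_dp.viable k n adj i) \<le> ?S"
    and r: "represents m s" "matrix_ready k n adj s" "exec ?xs read_prog (\<lambda>_. 0) t m"
      "t \<le> read_time k n w (length (postfix_expr e))"
    using exec_read_prog[OF assms] by blast
  interpret coloring_dp k n adj using k npos by unfold_locales simp_all
  let ?N = "1000 * ((n + 1) * (?S + 1) * ((k + 1) * ((k + 1) * (n + 2))))"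
  have "reaches ?xs value_bound dp_prog s 0 (\<lambda>N s'. N \<le> ?N \<and>
     s' (V 0) = card {cs \<in> viable n. \<forall>c<k. \<forall>c'<k. count_list cs c \<le> count_list cs c' + 1})"
    using r(2) S by (intro reaches_dp) (simp_all add: matrix_ready_def)
  then obtain m' s' N t' where m': "represents m' s'" "N \<le> ?N"
     "s' (V 0) = card {cs \<in> viable n. \<forall>c<k. \<forall>c'<k. count_list cs c \<le> count_list cs c' + 1}"
     "exec ?xs dp_prog m t' m'" "t' \<le> N * (9 * bits value_bound)"
    using reaches_exec[OF _ r(1)] by blast
  have "card (equitable_colorings k G) = card {cs \<in> viable n. \<forall>c<k. \<forall>c'<k. count_list cs c \<le> count_list cs c' + 1}"
    by (rule card_equitable_colorings[OF G us]) (use adj k npos in auto)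
  then have "m' 0 = card (equitable_colorings k G)"
    using m'(1,3) by (simp add: represents_def)
  moreover have "t' \<le> dp_time k n w"
  proof -
    have "t' \<le> ?N * (9 * (2 * ((n + 2) ^ 2 * (k + 1))))"
      by (rule le_trans[OF m'(5)], rule mult_le_mono[OF m'(2)], rule mult_le_mono2, rule bits_value_bound)
    also have "\<dots> = 18000 * ((n + 1) * (n + 2) ^ 3 * (k + 1) ^ 3 * (?S + 1))"
    proof -
      have "1000 * (a * b * (c * (c * d))) * (9 * (2 * (d ^ 2 * c))) = 18000 * (a * d ^ 3 * c ^ 3 * b)" for a b c d :: nat
        by (simp add: power2_eq_square power3_eq_cube)
      then show ?thesis .
    qed
    also have "\<dots> \<le> 18000 * ((n + 2) * (n + 2) ^ 3 * (k + 1) ^ 3 * (?S + 1))"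
      by (intro mult_le_mono mult_le_mono2) simp_all
    also have "\<dots> = dp_time k n w"
    proof -
      have "x * x ^ 3 = x ^ 4" for x :: nat by (simp add: eval_nat_numeral)
      then show ?thesis by (simp only: dp_time_def)
    qed
    finally show ?thesis .
  qed
  moreover have "exec ?xs main_prog (\<lambda>_. 0) (t + t') m'"
    unfolding main_prog_def using r(3) m'(4) by (rule exec.Seq)
  ultimately show ?thesis
    using r(4) unfolding computes_in_time_def by (meson add_mono)
qed

section \<open>The time bounds\<close>

text \<open>Division with remainder gives
  \<open>z <= m * (z div m + 1) <= m * 2 ^ (z div m)\<close>; the \<open>m\<close>-th power of this
  is the claim.\<close>

lemma power_le_exp: "z ^ m \<le> m ^ m * 2 ^ z" for z m :: nat
proof (cases "m = 0")
  case False
  have "z = m * (z div m) + z mod m" by simp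
  also have "\<dots> \<le> m * (z div m) + m" using mod_less_divisor[of m z] False by linarith
  also have "\<dots> = m * (z div m + 1)" by simp
  also have "\<dots> \<le> m * 2 ^ (z div m)" using less_exp[of "z div m"] by (intro mult_le_mono2) linarith
  finally have "z ^ m \<le> (m * 2 ^ (z div m)) ^ m" by (rule power_mono) simp
  also have "\<dots> = m ^ m * 2 ^ (z div m * m)" by (simp add: power_mult_distrib power_mult)
  also have "\<dots> \<le> m ^ m * 2 ^ z" by (intro mult_le_mono2 power_increasing) simp_all
  finally show ?thesis .
qed simp

text \<open>Since \<open>2 ^ k \<le> (2 ^ k - 2) ^ 2\<close>, the main factor absorbs every polynomial in \<open>k\<close> and \<open>w\<close>.\<close>

lemma power_le_main_factor:
  assumes "2 \<le> k"
  shows "(k * w) ^ c \<le> (2 * c) ^ c * (2 ^ k - 2) ^ w"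
proof -
  let ?R = "2 ^ k - 2 :: nat"
  have "2 ^ k \<le> ?R ^ 2"
  proof (cases "k = 2")
    case False
    then have "2 ^ 3 \<le> (2 ^ k :: nat)" using assms by (intro power_increasing) simp_all
    moreover define x where "x = (2 ^ k - 2 :: nat)"
    ultimately have x: "6 \<le> x" "2 ^ k = x + 2" by simp_all
    have "x + 2 \<le> 6 * x" using x by simp
    also have "\<dots> \<le> x * x" using x by (intro mult_le_mono1) simp
    finally show ?thesis unfolding x_def[symmetric] x(2) by (simp add: power2_eq_square)
  qed simp
  then have "(2 ^ k) ^ w \<le> (?R ^ 2) ^ w" by (rule power_mono) simp
  then have R: "2 ^ (k * w) \<le> (?R ^ w) ^ 2" by (simp add: power_mult mult.commute flip: power_mult)
  \<comment> \<open>Squares are compared, because only the square of the main factor dominates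
    \<open>2 ^ (k * w)\<close>; \<open>power_le_exp\<close> is therefore used with exponent
    \<open>2 * c\<close>.\<close>
  have "((k * w) ^ c) ^ 2 = (k * w) ^ (2 * c)" by (simp add: mult.commute flip: power_mult)
  also have "\<dots> \<le> (2 * c) ^ (2 * c) * 2 ^ (k * w)" by (rule power_le_exp)
  also have "\<dots> \<le> (2 * c) ^ (2 * c) * (?R ^ w) ^ 2" using R by (rule mult_le_mono2)
  also have "\<dots> = ((2 * c) ^ c * ?R ^ w) ^ 2" by (simp add: power_mult_distrib mult.commute flip: power_mult)
  finally show ?thesis by (rule power2_le_imp_le) simp
qed

text \<open>The quotient is \<open>(1 + 1 / n) ^ k <= exp (k / n) <= exp 1 <= 3\<close>.\<close>

lemma Suc_power_le:
  assumes "k \<le> n" "0 < n"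
  shows "(n + 1) ^ k \<le> 3 * n ^ k"
proof -
  have "(1 + 1 / real n) ^ k \<le> exp (1 / real n) ^ k"
    by (intro power_mono exp_ge_add_one_self) simp
  also have "\<dots> = exp (real k / real n)" by (simp flip: exp_of_nat_mult)
  also have "\<dots> \<le> exp 1" using assms by simp
  also have "\<dots> \<le> 3" by (rule exp_le)
  finally have "(1 + 1 / real n) ^ k * real n ^ k \<le> 3 * real n ^ k" by (rule mult_right_mono) simp
  moreover have "(1 + 1 / real n) ^ k * real n ^ k = real (n + 1) ^ k"
    using assms by (simp add: field_simps flip: power_mult_distrib)
  ultimately have "real ((n + 1) ^ k) \<le> real (3 * n ^ k)" by simp
  then show ?thesis by (simp only: of_nat_le_iff)
qed

text \<open>For \<open>n >= 3\<close> even \<open>k ^ n <= n ^ k\<close> holds, by induction on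
  \<open>k\<close> from \<open>k = n\<close>: a step multiplies the left side by at most
  \<open>3\<close> and the right side by \<open>n\<close>. The factor \<open>k ^ 2\<close> is there
  for \<open>n <= 2\<close>.\<close>

lemma power_swap_le:
  assumes "1 \<le> n" "n \<le> k"
  shows "k ^ n \<le> k ^ 2 * n ^ k"
proof (cases "n \<le> 2")
  case True
  have "k ^ n \<le> k ^ 2" using True assms by (intro power_increasing) simp_all
  also have "\<dots> \<le> k ^ 2 * n ^ k" using assms by simp
  finally show ?thesis .
next
  case False
  have "k ^ n \<le> n ^ k"
    using assms(2)
  proof (induction k rule: dec_induct)
    case (step k)
    have "Suc k ^ n \<le> 3 * k ^ n" using Suc_power_le[of n k] step assms by simp
    also have "\<dots> \<le> n * n ^ k" using False step by (intro mult_le_mono) simp_all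
    finally show ?case by simp
  qed simp
  also have "\<dots> \<le> k ^ 2 * n ^ k" using assms by simp
  finally show ?thesis .
qed

lemma linear_le: "1 \<le> n \<Longrightarrow> (n + 2) ^ m \<le> 3 ^ m * n ^ m" for n :: nat
  using power_mono[of "n + 2" "3 * n" m] by (simp add: power_mult_distrib)

text \<open>Origin of the constants: \<open>81 = 3 ^ 4\<close> from \<open>n + 2 <= 3 * n\<close>;
  \<open>16 = 2 * 2 ^ 3\<close> from \<open>k + 1 <= 2 * k\<close> and the added \<open>1\<close>;
  \<open>10 ^ 5\<close> from absorbing \<open>k ^ 5\<close>, that is \<open>k ^ 2\<close> of
  \<open>power_swap_le\<close> times the cubic factor.\<close>

lemma dp_time_le:
  assumes k: "2 \<le> k" and n: "1 \<le> n" and w: "1 \<le> w"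
  shows "dp_time k n w \<le> 18000 * 81 * 16 * 10 ^ 5 * ((2 ^ k - 2) ^ w * n ^ (k + 7))"
proof -
  let ?R = "2 ^ k - 2 :: nat"
  have "2 ^ 2 \<le> (2 ^ k :: nat)" using k by (intro power_increasing) simp_all
  then have R: "1 \<le> ?R" by simp
  have pos: "1 \<le> n ^ k" "1 \<le> ?R ^ w" "1 \<le> k ^ 2" using n R k by simp_all
  have main: "(k + 1) ^ 3 * (signature_bound k n w + 1) \<le> 16 * 10 ^ 5 * (?R ^ w * n ^ (k + 3))"
  proof (cases "k < n")
    case True
    have "signature_bound k n w \<le> (n + 1) ^ k * ?R ^ w" using R by (simp add: signature_bound_def max_absorb2)
    also have "\<dots> \<le> (3 * n ^ k) * ?R ^ w" using Suc_power_le[of k n] True by (intro mult_le_mono1) simp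
    finally have "signature_bound k n w + 1 \<le> 4 * (n ^ k * ?R ^ w)" using mult_le_mono[OF pos(1,2)] unfolding mult.assoc by linarith
    moreover have "(k + 1) ^ 3 \<le> n ^ 3" using True by (intro power_mono) simp_all
    ultimately have "(k + 1) ^ 3 * (signature_bound k n w + 1) \<le> n ^ 3 * (4 * (n ^ k * ?R ^ w))"
      by (rule mult_le_mono[rotated])
    also have "\<dots> = 4 * (?R ^ w * n ^ (k + 3))" by (simp add: power_add)
    also have "\<dots> \<le> 16 * 10 ^ 5 * (?R ^ w * n ^ (k + 3))" by (intro mult_le_mono1) simp
    finally show ?thesis .
  next
    case False
    have "signature_bound k n w \<le> k ^ 2 * n ^ k"
      using power_swap_le[of n k] False n by (simp add: signature_bound_def)
    then have "signature_bound k n w + 1 \<le> 2 * (k ^ 2 * n ^ k)" using mult_le_mono[OF pos(3,1)] by linarith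
    moreover have "(k + 1) ^ 3 \<le> (2 * k) ^ 3" using k by (intro power_mono) simp_all
    ultimately have "(k + 1) ^ 3 * (signature_bound k n w + 1) \<le> (2 * k) ^ 3 * (2 * (k ^ 2 * n ^ k))"
      by (rule mult_le_mono[rotated])
    also have "\<dots> = 16 * (k ^ 5 * n ^ k)" by (simp add: power_mult_distrib power_add[symmetric])
    also have "\<dots> \<le> 16 * ((k * w) ^ 5 * n ^ k)" using w by (intro mult_le_mono mult_le_mono2 power_mono) simp_all
    also have "\<dots> \<le> 16 * (((2 * 5) ^ 5 * ?R ^ w) * n ^ k)"
      by (intro mult_le_mono2 mult_le_mono1 power_le_main_factor k)
    also have "\<dots> \<le> 16 * (((2 * 5) ^ 5 * ?R ^ w) * n ^ (k + 3))"
      using n by (intro mult_le_mono2 power_increasing) simp_all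
    also have "\<dots> = 16 * 10 ^ 5 * (?R ^ w * n ^ (k + 3))" by simp
    finally show ?thesis .
  qed
  have "dp_time k n w = 18000 * ((n + 2) ^ 4 * ((k + 1) ^ 3 * (signature_bound k n w + 1)))"
    by (simp only: dp_time_def mult.assoc)
  also have "\<dots> \<le> 18000 * ((3 ^ 4 * n ^ 4) * (16 * 10 ^ 5 * (?R ^ w * n ^ (k + 3))))"
    by (intro mult_le_mono2 mult_le_mono linear_le main n)
  also have "\<dots> = 18000 * 81 * 16 * 10 ^ 5 * (?R ^ w * (n ^ 4 * n ^ (k + 3)))"
    by simp
  also have "n ^ 4 * n ^ (k + 3) = n ^ (k + 7)" by (simp add: add.commute flip: power_add)
  finally show ?thesis .
qed

text \<open>A sum of three positive numbers is at most three times their product. This separates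
  \<open>n\<close> from \<open>k * w\<close>, whose power is then absorbed by the main
  factor.\<close>

lemma read_time_le:
  assumes k: "2 \<le> k" and n: "1 \<le> n" and w: "1 \<le> w" and L: "L \<le> 3 * (b * (n + w) ^ a)"
  defines "c \<equiv> 5 * (a + 1)"
  shows "read_time k n w L \<le> 1000000 * (3 + 3 * b) ^ 5 * 3 ^ c * (2 * c) ^ c * ((2 ^ k - 2) ^ w * n ^ c)"
proof -
  let ?R = "2 ^ k - 2 :: nat"
  define p where "p = n + w + k"
  have p1: "1 \<le> p" using n by (simp add: p_def)
  have pa: "p \<le> p ^ (a + 1)" "1 \<le> p ^ (a + 1)" using p1 by (simp_all add: self_le_power)
  have "(n + w) ^ a \<le> p ^ a" by (rule power_mono) (simp_all add: p_def)
  also have "\<dots> \<le> p ^ (a + 1)" using p1 by (intro power_increasing) simp_all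
  finally have "b * (n + w) ^ a \<le> b * p ^ (a + 1)" by (rule mult_le_mono2)
  then have L': "L \<le> 3 * (b * p ^ (a + 1))" using L by linarith
  have "n + L + w + k + 2 = p + L + 2" by (simp add: p_def)
  also have "\<dots> \<le> p ^ (a + 1) + 3 * (b * p ^ (a + 1)) + 2 * p ^ (a + 1)" using pa L' by linarith
  also have "\<dots> = (3 + 3 * b) * p ^ (a + 1)" by (simp add: distrib_right)
  finally have q: "n + L + w + k + 2 \<le> (3 + 3 * b) * p ^ (a + 1)" .
  have "p \<le> 3 * (n * (k * w))"
  proof -
    have "n \<le> n * (k * w)" "k \<le> n * (k * w)" "w \<le> n * (k * w)" using n k w by simp_all
    then show ?thesis unfolding p_def by linarith
  qed
  then have "p ^ c \<le> (3 * (n * (k * w))) ^ c" by (rule power_mono) simp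
  also have "\<dots> = 3 ^ c * (n ^ c * (k * w) ^ c)" by (simp only: power_mult_distrib)
  also have "\<dots> \<le> 3 ^ c * (n ^ c * ((2 * c) ^ c * ?R ^ w))"
    by (intro mult_le_mono2 power_le_main_factor k)
  finally have pc: "p ^ c \<le> 3 ^ c * (n ^ c * ((2 * c) ^ c * ?R ^ w))" .
  have "read_time k n w L = 1000000 * (n + L + w + k + 2) ^ 5" using k by (simp add: read_time_def)
  also have "\<dots> \<le> 1000000 * ((3 + 3 * b) * p ^ (a + 1)) ^ 5" using q by (intro mult_le_mono2 power_mono) simp_all
  also have "\<dots> = 1000000 * (3 + 3 * b) ^ 5 * p ^ c"
    by (simp only: power_mult_distrib c_def power_mult[symmetric] mult.assoc mult.commute[of "a + 1"])
  also have "\<dots> \<le> 1000000 * (3 + 3 * b) ^ 5 * (3 ^ c * (n ^ c * ((2 * c) ^ c * ?R ^ w)))"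
    using pc by (rule mult_le_mono2)
  also have "\<dots> = 1000000 * (3 + 3 * b) ^ 5 * 3 ^ c * (2 * c) ^ c * (?R ^ w * n ^ c)"
    by (simp only: mult_ac)
  finally show ?thesis .
qed

lemma time_one_color_le:
  assumes "1 \<le> n"
  shows "read_time 1 n w L + dp_time 1 n w \<le> (1000000 * 243 + 18000 * 16 * 81) * n ^ 5"
proof -
  have "(n + 2) ^ 5 \<le> 243 * n ^ 5" using linear_le[OF assms, of 5] by simp
  then have 1: "read_time 1 n w L \<le> 1000000 * (243 * n ^ 5)" by (simp add: read_time_def)
  have "signature_bound 1 n w \<le> 1" by (simp add: signature_bound_def)
  then have "dp_time 1 n w \<le> 18000 * ((n + 2) ^ 4 * (1 + 1) ^ 3 * 2)"
    unfolding dp_time_def by (intro mult_le_mono2 mult_le_mono power_mono) simp_all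
  also have "\<dots> \<le> 18000 * ((3 ^ 4 * n ^ 4) * (1 + 1) ^ 3 * 2)"
    by (intro mult_le_mono2 mult_le_mono1 linear_le assms)
  also have "\<dots> = 18000 * 16 * 81 * n ^ 4" by (simp add: power3_eq_cube)
  also have "\<dots> \<le> 18000 * 16 * 81 * n ^ 5" using assms by (intro mult_le_mono2 power_increasing) simp_all
  finally show ?thesis using 1 by simp
qed

text \<open>\<open>C\<close> and \<open>c\<close> are chosen from \<open>a\<close> and
  \<open>b\<close> alone, before \<open>k\<close>, \<open>n\<close> and \<open>w\<close>. The
  exponent \<open>c + 7\<close> of the proof covers both reading, of degree
  \<open>5 * (a + 1)\<close>, and the dynamic program, of degree \<open>k + 7\<close>.\<close>

lemma time_le:
  fixes a b :: nat
  shows "\<exists>C c. \<forall>k\<ge>1. \<forall>n\<ge>1. \<forall>w\<ge>1. \<forall>L. L \<le> 3 * (b * (n + w) ^ a) \<longrightarrow>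
    read_time k n w L + dp_time k n w \<le> C * max 1 (2 ^ k - 2) ^ w * n ^ (k + c)"
proof -
  define c where "c = 5 * (a + 1)"
  define C1 :: nat where "C1 = 1000000 * 243 + 18000 * 16 * 81"
  define C2 :: nat where "C2 = 1000000 * (3 + 3 * b) ^ 5 * 3 ^ c * (2 * c) ^ c"
  define C3 :: nat where "C3 = 18000 * 81 * 16 * 10 ^ 5"
  have "read_time k n w L + dp_time k n w \<le> (C1 + C2 + C3) * max 1 (2 ^ k - 2) ^ w * n ^ (k + (c + 7))"
    if k: "1 \<le> k" and n: "1 \<le> n" and w: "1 \<le> w" and L: "L \<le> 3 * (b * (n + w) ^ a)" for k n w L
  proof (cases "k = 1")
    case True
    have "read_time k n w L + dp_time k n w \<le> C1 * n ^ 5"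
      unfolding True C1_def by (rule time_one_color_le[OF n])
    also have "\<dots> \<le> (C1 + C2 + C3) * n ^ (k + (c + 7))"
      using n by (intro mult_le_mono power_increasing) (simp_all add: c_def)
    finally show ?thesis using True by simp
  next
    case False
    let ?R = "2 ^ k - 2 :: nat"
    have k2: "2 \<le> k" using k False by simp
    have "2 ^ 2 \<le> (2 ^ k :: nat)" using k2 by (intro power_increasing) simp_all
    then have R: "max 1 ?R = ?R" by simp
    have "read_time k n w L \<le> C2 * (?R ^ w * n ^ c)"
      unfolding C2_def c_def by (rule read_time_le[OF k2 n w L])
    also have "\<dots> \<le> C2 * (?R ^ w * n ^ (k + (c + 7)))" using n by (intro mult_le_mono2 power_increasing) simp_all
    finally have 1: "read_time k n w L \<le> C2 * (?R ^ w * n ^ (k + (c + 7)))" .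
    have "dp_time k n w \<le> C3 * (?R ^ w * n ^ (k + 7))"
      unfolding C3_def by (rule dp_time_le[OF k2 n w])
    also have "\<dots> \<le> C3 * (?R ^ w * n ^ (k + (c + 7)))" using n by (intro mult_le_mono2 power_increasing) simp_all
    finally have 2: "dp_time k n w \<le> C3 * (?R ^ w * n ^ (k + (c + 7)))" .
    have "read_time k n w L + dp_time k n w \<le> (C1 + C2 + C3) * (?R ^ w * n ^ (k + (c + 7)))"
      using 1 2 by (simp add: distrib_right)
    then show ?thesis unfolding R mult.assoc .
  qed
  then show ?thesis by blast
qed

text \<open>With \<open>k\<close> and \<open>W\<close> fixed nothing has to be absorbed. Degree
  \<open>k + 9\<close> is a common bound for degree \<open>5\<close> of reading and degree
  \<open>k + 4\<close> of the dynamic program.\<close>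

lemma time_fixed_le:
  assumes "w \<le> W" "n + 2 + L \<le> l"
  shows "read_time k n w L + dp_time k n w \<le>
    (1000000 * (1 + W + k) ^ 5 + 36000 * (k + 1) ^ 3 * max 1 (2 ^ k - 2) ^ W) * l ^ (k + 9)"
proof -
  let ?R = "max 1 (2 ^ k - 2) :: nat"
  have l1: "1 \<le> l" using assms(2) by simp
  have "W \<le> W * l" "k \<le> k * l" using l1 by simp_all
  then have "n + L + w + k + 2 \<le> l + W * l + k * l" using assms by linarith
  then have "n + L + w + k + 2 \<le> (1 + W + k) * l" by (simp only: distrib_right mult_1)
  moreover have "n + 2 \<le> n + L + w + k + 2" by simp
  ultimately have "read_time k n w L \<le> 1000000 * ((1 + W + k) * l) ^ 5"
    unfolding read_time_def by (intro mult_le_mono2 power_mono) auto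
  also have "\<dots> = 1000000 * (1 + W + k) ^ 5 * l ^ 5" by (simp only: power_mult_distrib mult.assoc)
  also have "\<dots> \<le> 1000000 * (1 + W + k) ^ 5 * l ^ (k + 9)" using l1 by (intro mult_le_mono2 power_increasing) simp_all
  finally have 1: "read_time k n w L \<le> 1000000 * (1 + W + k) ^ 5 * l ^ (k + 9)" .
  have "signature_bound k n w \<le> (n + 1) ^ k * ?R ^ w" by (simp add: signature_bound_def)
  also have "\<dots> \<le> l ^ k * ?R ^ W"
    using assms by (intro mult_le_mono power_mono power_increasing) simp_all
  finally have "signature_bound k n w \<le> l ^ k * ?R ^ W" .
  moreover have "1 \<le> l ^ k * ?R ^ W" using mult_le_mono[of 1 "l ^ k" 1 "?R ^ W"] l1 by simp
  ultimately have S: "signature_bound k n w + 1 \<le> 2 * (l ^ k * ?R ^ W)" by linarith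
  have "dp_time k n w \<le> 18000 * (l ^ 4 * (k + 1) ^ 3 * (2 * (l ^ k * ?R ^ W)))"
    unfolding dp_time_def using assms S by (intro mult_le_mono2 mult_le_mono power_mono) simp_all
  also have "\<dots> = 36000 * (k + 1) ^ 3 * ?R ^ W * (l ^ 4 * l ^ k)" by simp
  also have "l ^ 4 * l ^ k = l ^ (k + 4)" by (simp flip: power_add add: add.commute)
  also have "36000 * (k + 1) ^ 3 * ?R ^ W * l ^ (k + 4) \<le> 36000 * (k + 1) ^ 3 * ?R ^ W * l ^ (k + 9)"
    using l1 by (intro mult_le_mono2 power_increasing) simp_all
  finally show ?thesis using 1 by (simp only: distrib_right)
qed

lemma computes_in_time_mono: "computes_in_time p xs y T \<Longrightarrow> T \<le> T' \<Longrightarrow> computes_in_time p xs y T'"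
  unfolding computes_in_time_def using le_trans by blast

lemma length_le_input_length: "length xs \<le> input_length xs"
proof (induction xs)
  case (Cons x xs)
  then show ?case using bits_ge_1[of x] by (simp add: input_length_def)
qed (simp add: input_length_def)

theorem theorem1p3:
  shows
    "(\<exists>P. \<forall>a b. \<exists>C c. \<forall>k \<ge> 1. \<forall>(G :: nat pair_pre_digraph) vs n w e.
        pair_graph G \<and> enumerates vs (pverts G) \<and> n = card (pverts G) \<and>
        linear_expr_for w e G \<and> num_ops e \<le> b * (n + w) ^ a \<longrightarrow>
        computes_in_time P (encode k vs G w e) (card (equitable_colorings k G))
          (C * max 1 (2 ^ k - 2) ^ w * n ^ (k + c)))
     \<and>
     (\<forall>k \<ge> 1. \<forall>\<G> :: nat pair_pre_digraph set.
        (\<forall>G \<in> \<G>. pair_graph G) \<and> bounded_lcw \<G> \<longrightarrow>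
        (\<forall>W. \<exists>P C d. \<forall>G \<in> \<G>. \<forall>vs w e.
           enumerates vs (pverts G) \<and> w \<le> W \<and> linear_expr_for w e G \<longrightarrow>
           computes_in_time P (encode k vs G w e) (card (equitable_colorings k G))
             (C * input_length (encode k vs G w e) ^ d)))"
proof (intro conjI allI impI)
  show "\<exists>P. \<forall>a b. \<exists>C c. \<forall>k \<ge> 1. \<forall>(G :: nat pair_pre_digraph) vs n w e.
        pair_graph G \<and> enumerates vs (pverts G) \<and> n = card (pverts G) \<and>
        linear_expr_for w e G \<and> num_ops e \<le> b * (n + w) ^ a \<longrightarrow>
        computes_in_time P (encode k vs G w e) (card (equitable_colorings k G))
          (C * max 1 (2 ^ k - 2) ^ w * n ^ (k + c))"
  proof (rule exI[of _ main_prog], intro allI)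
    fix a b
    obtain C c where C: "\<And>k n w L. 1 \<le> k \<Longrightarrow> 1 \<le> n \<Longrightarrow> 1 \<le> w \<Longrightarrow> L \<le> 3 * (b * (n + w) ^ a) \<Longrightarrow>
        read_time k n w L + dp_time k n w \<le> C * max 1 (2 ^ k - 2) ^ w * n ^ (k + c)"
      using time_le[of b a] by blast
    have "computes_in_time main_prog (encode k vs G w e) (card (equitable_colorings k G))
          (C * max 1 (2 ^ k - 2) ^ w * n ^ (k + c))"
      if k: "1 \<le> k" and H: "pair_graph G" "enumerates vs (pverts G)" "n = card (pverts G)" "linear_expr_for w e G"
        and e: "num_ops e \<le> b * (n + w) ^ a" for k and G :: "nat pair_pre_digraph" and vs n w e
    proof (rule computes_in_time_mono[OF main_prog_computes[OF H k] C[OF k]])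
      obtain lab where c: "constructs w e G lab" using H(4) by (auto simp: linear_expr_for_def)
      have v: "finite (pverts G)" "card (pverts G) = num_vertices e" using constructs_num_vertices[OF c] by auto
      \<comment> \<open>An expression creates at least one vertex, and that vertex carries a label
        in \<open>{1..w}\<close>; so \<open>n\<close> and \<open>w\<close> are positive without
        being assumed to be.\<close>
      show n: "1 \<le> n" using v(2) H(3) num_vertices_pos[of e] by simp
      then obtain v where "v \<in> pverts G" using H(3) by fastforce
      then show "1 \<le> w" using constructs_labels[OF c] by fastforce
      show "length (postfix_expr e) \<le> 3 * (b * (n + w) ^ a)"
        using length_postfix_expr[of e] e by linarith
    qed
    then show "\<exists>C c. \<forall>k \<ge> 1. \<forall>(G :: nat pair_pre_digraph) vs n w e.
        pair_graph G \<and> enumerates vs (pverts G) \<and> n = card (pverts G) \<and>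
        linear_expr_for w e G \<and> num_ops e \<le> b * (n + w) ^ a \<longrightarrow>
        computes_in_time main_prog (encode k vs G w e) (card (equitable_colorings k G))
          (C * max 1 (2 ^ k - 2) ^ w * n ^ (k + c))"
      by blast
  qed
next
  fix k W :: nat and \<G> :: "nat pair_pre_digraph set"
  assume k: "1 \<le> k" and \<G>: "(\<forall>G \<in> \<G>. pair_graph G) \<and> bounded_lcw \<G>"
  let ?C = "1000000 * (1 + W + k) ^ 5 + 36000 * (k + 1) ^ 3 * max 1 (2 ^ k - 2) ^ W"
  have "computes_in_time main_prog (encode k vs G w e) (card (equitable_colorings k G))
      (?C * input_length (encode k vs G w e) ^ (k + 9))"
    if H: "G \<in> \<G>" "enumerates vs (pverts G)" "w \<le> W" "linear_expr_for w e G" for G vs w e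
  proof (rule computes_in_time_mono[OF main_prog_computes[OF _ H(2) refl H(4) k] time_fixed_le[OF H(3)]])
    show "pair_graph G" using H(1) \<G> by blast
    have "length vs = card (pverts G)" using H(2) distinct_card[of vs] by (auto simp: enumerates_def)
    then have "card (pverts G) + 2 + length (postfix_expr e) \<le> length (encode k vs G w e)"
      using le_square[of "length vs"] unfolding length_encode by linarith
    then show "card (pverts G) + 2 + length (postfix_expr e) \<le> input_length (encode k vs G w e)"
      using length_le_input_length by (rule le_trans)
  qed
  then show "\<exists>P C d. \<forall>G \<in> \<G>. \<forall>vs w e.
           enumerates vs (pverts G) \<and> w \<le> W \<and> linear_expr_for w e G \<longrightarrow>
           computes_in_time P (encode k vs G w e) (card (equitable_colorings k G))
             (C * input_length (encode k vs G w e) ^ d)"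
    by blast
qed

end
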